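(* For all $m,n\geq 1$, $\mathcal{A}(mn)^{Sp(2n)}$ has a minimal strong generating set $$\{\omega^{j,j}_{0,2r}\mid 1\leq j\leq m,\ 0\leq r\leq n-1\}\ \cup\ \{\omega^{j,k}_{0,s}\mid 1\leq j<k\leq m,\ 0\leq s\leq 2n-1\},$$ where $$\omega^{j,k}_{a,b}=\frac12\sum_{i=1}^n\big(:\partial^a e^{i,j}\,\partial^b f^{i,k}:+:\partial^b e^{i,k}\,\partial^a f^{i,j}:\big).$$
   Context: The rank $mn$ symplectic fermion algebra $\mathcal{A}(mn)$ is the vertex (super)algebra over $\mathbb{C}$ freely generated by odd elements $e^{i,j},f^{i,j}$, $i=1,\dots,n$, $j=1,\dots,m$, whose only nontrivial operator product expansions are $e^{i,j}(z)f^{k,l}(w)\sim\delta_{i,k}\delta_{j,l}(z-w)^{-2}$ (and correspondingly $f^{k,l}(z)e^{i,j}(w)\sim-\delta_{i,k}\delta_{j,l}(z-w)^{-2}$). The group $Sp(2n)$ acts by automorphisms so that for each $j=1,\dots,m$ the set $\{e^{i,j},f^{i,j}\mid i=1,\dots,n\}$ is a symplectic basis of a copy of the standard module $\mathbb{C}^{2n}$. $\mathcal{A}(mn)^{Sp(2n)}$ is the subalgebra of invariants. A subset $\{a_i\}$ of a vertex algebra strongly generates it if the algebra is spanned by the iterated Wick products $:\partial^{k_1}a_{i_1}\cdots\partial^{k_t}a_{i_t}:$ with $k_1,\dots,k_t\geq 0$. A strong generating set is minimal if no proper subset of it is a strong generating set. *)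

theory Defs
  imports
    "Jordan_Normal_Form.Determinant"
    "HOL-Algebra.Group_Action"
    "HOL-Library.Z2"
    "HOL-Library.Product_Lexorder"
begin

section \<open>Vertex superalgebras over the complex numbers\<close>

text \<open>
  The underlying space is the whole type \<open>'v\<close>. The component \<open>grade p\<close> is the subspace of elements of
  parity \<open>p\<close>, and \<open>nprod V a r b\<close> is \<open>a\<^sub>(\<^sub>r\<^sub>) b\<close>, so the field of \<open>a\<close> is
  \<open>Y(a,z) = \<Sum>r. a\<^sub>(\<^sub>r\<^sub>) z powi (-r-1)\<close>.
\<close>

record 'v vertex_data =
  smult :: "complex \<Rightarrow> 'v \<Rightarrow> 'v"
  grade :: "bit \<Rightarrow> 'v set"
  vac :: 'v
  nprod :: "'v \<Rightarrow> int \<Rightarrow> 'v \<Rightarrow> 'v"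

definition transl :: "('v, 'z) vertex_data_scheme \<Rightarrow> 'v \<Rightarrow> 'v" where
  "transl V a = nprod V a (- 2) (vac V)"

definition koszul_sign :: "bit \<Rightarrow> bit \<Rightarrow> complex" where
  "koszul_sign p q = (if p = 1 \<and> q = 1 then - 1 else 1)"

text \<open>
  The axiom \<open>translation\<close> is \<open>[T, Y(a,z)] = \<partial>\<^sub>z Y(a,z)\<close>, and \<open>locality\<close> is
  \<open>(z - w)^N [Y(a,z), Y(b,w)] = 0\<close> (with the supercommutator); both are read off coefficientwise, in
  the second case at \<open>z powi (-k-1) * w powi (-l-1)\<close>.
\<close>

locale vertex_superalgebra = vector_space "smult V"
  for V :: "('v::ab_group_add, 'z) vertex_data_scheme" +
  assumes grade_subspace: "subspace (grade V p)"
    and grade_disjoint: "grade V 0 \<inter> grade V 1 = {0}"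
    and grade_sum: "\<exists>a\<in>grade V 0. \<exists>b\<in>grade V 1. v = a + b"
    and nprod_linear_left: "Vector_Spaces.linear (smult V) (smult V) (\<lambda>a. nprod V a r b)"
    and nprod_linear_right: "Vector_Spaces.linear (smult V) (smult V) (nprod V a r)"
    and nprod_grade: "a \<in> grade V p \<Longrightarrow> b \<in> grade V q \<Longrightarrow> nprod V a r b \<in> grade V (p + q)"
    and nprod_field: "\<exists>N. \<forall>r\<ge>N. nprod V a r b = 0"
    and vac_even: "vac V \<in> grade V 0"
    and vac_left: "nprod V (vac V) r b = (if r = - 1 then b else 0)"
    and vac_creation: "nprod V a (- 1) (vac V) = a"
    and vac_right: "r \<ge> 0 \<Longrightarrow> nprod V a r (vac V) = 0"
    and translation: "transl V (nprod V a r b) - nprod V a r (transl V b)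
           = smult V (- of_int r) (nprod V a (r - 1) b)"
    and locality: "a \<in> grade V p \<Longrightarrow> b \<in> grade V q \<Longrightarrow>
           \<exists>N::nat. \<forall>k l c.
             (\<Sum>i\<le>N. smult V ((- 1) ^ i * of_nat (N choose i))
                (nprod V a (k + int N - int i) (nprod V b (l + int i) c)
                 - smult V (koszul_sign p q)
                     (nprod V b (l + int i) (nprod V a (k + int N - int i) c)))) = 0"

definition vertex_automorphism ::
    "('v::ab_group_add, 'z) vertex_data_scheme \<Rightarrow> ('v \<Rightarrow> 'v) \<Rightarrow> bool" where
  "vertex_automorphism V \<phi> \<longleftrightarrow>
     Vector_Spaces.linear (smult V) (smult V) \<phi> \<and> bij \<phi> \<and>
     (\<forall>p. \<phi> ` grade V p = grade V p) \<and>
     \<phi> (vac V) = vac V \<and>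
     (\<forall>a r b. \<phi> (nprod V a r b) = nprod V (\<phi> a) r (\<phi> b))"


section \<open>Wick products and generation\<close>

definition wick :: "('v, 'z) vertex_data_scheme \<Rightarrow> 'v \<Rightarrow> 'v \<Rightarrow> 'v" where
  "wick V a b = nprod V a (- 1) b"

text \<open>Iterated Wick products are nested to the right; the empty product is the vacuum.\<close>

definition wick_list :: "('v, 'z) vertex_data_scheme \<Rightarrow> 'v list \<Rightarrow> 'v" where
  "wick_list V as = foldr (wick V) as (vac V)"

definition strongly_generates ::
    "('v::ab_group_add, 'z) vertex_data_scheme \<Rightarrow> 'v set \<Rightarrow> 'v set \<Rightarrow> bool" where
  "strongly_generates V S W \<longleftrightarrow>
     S \<subseteq> W \<and>
     W = Modules.module.span (smult V)
           {wick_list V (map (\<lambda>(a, k). (transl V ^^ k) a) as) | as :: ('v \<times> nat) list.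
              fst ` set as \<subseteq> S}"

definition minimal_strong_generating_set ::
    "('v::ab_group_add, 'z) vertex_data_scheme \<Rightarrow> 'v set \<Rightarrow> 'v set \<Rightarrow> bool" where
  "minimal_strong_generating_set V S W \<longleftrightarrow>
     strongly_generates V S W \<and> (\<forall>S'. S' \<subset> S \<longrightarrow> \<not> strongly_generates V S' W)"

text \<open>
  Free generation by a family \<open>x\<close> of homogeneous elements: the ordered Wick monomials in
  the \<open>transl\<^sup>k (x i)\<close>, with no odd factor repeated, form a basis. A monomial is encoded by
  the sorted list of the pairs \<open>(i, k)\<close>.
\<close>

definition pbw_index ::
    "('v, 'z) vertex_data_scheme \<Rightarrow> 'i::linorder set \<Rightarrow> ('i \<Rightarrow> 'v) \<Rightarrow> ('i \<times> nat) list set" where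
  "pbw_index V I x = {is. sorted is \<and> fst ` set is \<subseteq> I \<and>
     (\<forall>i k. x i \<in> grade V 1 \<longrightarrow> count_list is (i, k) \<le> 1)}"

definition pbw_monomial ::
    "('v, 'z) vertex_data_scheme \<Rightarrow> ('i \<Rightarrow> 'v) \<Rightarrow> ('i \<times> nat) list \<Rightarrow> 'v" where
  "pbw_monomial V x is = wick_list V (map (\<lambda>(i, k). (transl V ^^ k) (x i)) is)"

definition freely_generated ::
    "('v::ab_group_add, 'z) vertex_data_scheme \<Rightarrow> 'i::linorder set \<Rightarrow> ('i \<Rightarrow> 'v) \<Rightarrow> bool" where
  "freely_generated V I x \<longleftrightarrow>
     (\<forall>i\<in>I. x i \<in> grade V 0 \<union> grade V 1) \<and>
     inj_on (pbw_monomial V x) (pbw_index V I x) \<and>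
     \<not> Modules.module.dependent (smult V) (pbw_monomial V x ` pbw_index V I x) \<and>
     Modules.module.span (smult V) (pbw_monomial V x ` pbw_index V I x) = UNIV"


section \<open>The symplectic fermion algebra\<close>

text \<open>
  For a fixed \<open>j\<close>, the vectors \<open>symp_basis n e f j p\<close>, \<open>p < 2 * n\<close>, are
  \<open>e 1 j, \<dots>, e n j, f 1 j, \<dots>, f n j\<close>; matrix indices start at 0.
\<close>

definition symp_basis ::
    "nat \<Rightarrow> (nat \<Rightarrow> nat \<Rightarrow> 'v) \<Rightarrow> (nat \<Rightarrow> nat \<Rightarrow> 'v) \<Rightarrow> nat \<Rightarrow> nat \<Rightarrow> 'v" where
  "symp_basis n e f j p = (if p < n then e (p + 1) j else f (p - n + 1) j)"

text \<open>
  An OPE \<open>a(z) b(w) \<sim> \<Sum>r\<ge>0. (a\<^sub>(\<^sub>r\<^sub>) b)(w) (z - w) powi (-r-1)\<close> is given by the products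
  \<open>a\<^sub>(\<^sub>r\<^sub>) b\<close> with \<open>r \<ge> 0\<close>; the pole \<open>(z - w) powi (-2)\<close> belongs to \<open>r = 1\<close>.
\<close>

locale symplectic_fermion_algebra = vertex_superalgebra V
  for V :: "('v::ab_group_add, 'z) vertex_data_scheme"
    and m n :: nat
    and e f :: "nat \<Rightarrow> nat \<Rightarrow> 'v" +
  assumes odd_e: "i \<in> {1..n} \<Longrightarrow> j \<in> {1..m} \<Longrightarrow> e i j \<in> grade V 1"
    and odd_f: "i \<in> {1..n} \<Longrightarrow> j \<in> {1..m} \<Longrightarrow> f i j \<in> grade V 1"
    and ope_ef: "i \<in> {1..n} \<Longrightarrow> k \<in> {1..n} \<Longrightarrow> j \<in> {1..m} \<Longrightarrow> l \<in> {1..m} \<Longrightarrow> r \<ge> 0 \<Longrightarrow>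
           nprod V (e i j) r (f k l) = (if r = 1 \<and> i = k \<and> j = l then vac V else 0)"
    and ope_fe: "i \<in> {1..n} \<Longrightarrow> k \<in> {1..n} \<Longrightarrow> j \<in> {1..m} \<Longrightarrow> l \<in> {1..m} \<Longrightarrow> r \<ge> 0 \<Longrightarrow>
           nprod V (f k l) r (e i j) = (if r = 1 \<and> i = k \<and> j = l then - vac V else 0)"
    and ope_ee: "i \<in> {1..n} \<Longrightarrow> k \<in> {1..n} \<Longrightarrow> j \<in> {1..m} \<Longrightarrow> l \<in> {1..m} \<Longrightarrow> r \<ge> 0 \<Longrightarrow>
           nprod V (e i j) r (e k l) = 0"
    and ope_ff: "i \<in> {1..n} \<Longrightarrow> k \<in> {1..n} \<Longrightarrow> j \<in> {1..m} \<Longrightarrow> l \<in> {1..m} \<Longrightarrow> r \<ge> 0 \<Longrightarrow>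
           nprod V (f i j) r (f k l) = 0"
    and free: "freely_generated V ({1..m} \<times> {..<2 * n}) (\<lambda>(j, p). symp_basis n e f j p)"

definition omega ::
    "('v::ab_group_add, 'z) vertex_data_scheme \<Rightarrow> nat \<Rightarrow> (nat \<Rightarrow> nat \<Rightarrow> 'v) \<Rightarrow> (nat \<Rightarrow> nat \<Rightarrow> 'v)
      \<Rightarrow> nat \<Rightarrow> nat \<Rightarrow> nat \<Rightarrow> nat \<Rightarrow> 'v" where
  "omega V n e f j k a b = smult V (1 / 2)
     (\<Sum>i = 1..n. wick V ((transl V ^^ a) (e i j)) ((transl V ^^ b) (f i k))
               + wick V ((transl V ^^ b) (e i k)) ((transl V ^^ a) (f i j)))"


section \<open>The action of the symplectic group\<close>

definition symp_form :: "nat \<Rightarrow> complex mat" where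
  "symp_form n = four_block_mat (0\<^sub>m n n) (1\<^sub>m n) (- 1\<^sub>m n) (0\<^sub>m n n)"

definition Sp :: "nat \<Rightarrow> complex mat monoid" where
  "Sp n = \<lparr>carrier = {g \<in> carrier_mat (2 * n) (2 * n).
                       transpose_mat g * symp_form n * g = symp_form n},
           monoid.mult = (*), one = 1\<^sub>m (2 * n)\<rparr>"

lemma symp_form_carrier: "symp_form n \<in> carrier_mat (2 * n) (2 * n)"
  unfolding symp_form_def
  by (metis four_block_carrier_mat mult_2 zero_carrier_mat)

lemma symp_form_square: "- symp_form n * symp_form n = 1\<^sub>m (2 * n)"
proof -
  have "symp_form n * symp_form n = - 1\<^sub>m (2 * n)"
    unfolding symp_form_def
    by (subst mult_four_block_mat[where ?nr1.0=n and ?n1.0=n and ?n2.0=n and ?nr2.0=n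
          and ?nc1.0=n and ?nc2.0=n]) (auto intro!: eq_matI)
  then show ?thesis
    using symp_form_carrier[of n] by (simp add: uminus_mult_left_mat)
qed

lemma group_Sp: "group (Sp n)"
proof (rule groupI)
  let ?N = "2 * n" and ?J = "symp_form n"
  note J = symp_form_carrier[of n]
  fix g assume "g \<in> carrier (Sp n)"
  then have g: "g \<in> carrier_mat ?N ?N" and gJ: "transpose_mat g * ?J * g = ?J"
    by (auto simp: Sp_def)
  define h where "h = - ?J * transpose_mat g * ?J"
  have h: "h \<in> carrier_mat ?N ?N" using g J by (auto simp: h_def)
  have gt: "transpose_mat g \<in> carrier_mat ?N ?N" and mJ: "- ?J \<in> carrier_mat ?N ?N"
    using g J by auto
  have "h * g = - ?J * (transpose_mat g * ?J * g)"
    unfolding h_def using g gt J mJ by (simp add: assoc_mult_mat[of _ ?N ?N _ ?N _ ?N])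
  then have hg: "h * g = 1\<^sub>m ?N" by (simp add: gJ symp_form_square)
  then have gh: "g * h = 1\<^sub>m ?N"
    using mat_mult_left_right_inverse[OF h g] by simp
  have ht: "transpose_mat h \<in> carrier_mat ?N ?N" using h by simp
  have "transpose_mat h * transpose_mat g = 1\<^sub>m ?N"
    using transpose_mult[OF g h] gh by simp
  then have "transpose_mat h * (transpose_mat g * ?J * g) * h = ?J"
    using g h gt ht J gh by (simp add: assoc_mult_mat[of _ ?N ?N _ ?N _ ?N]
      flip: assoc_mult_mat[of "transpose_mat h" ?N ?N "transpose_mat g" ?N])
  then have "h \<in> carrier (Sp n)" using h gJ by (simp add: Sp_def)
  then show "\<exists>y\<in>carrier (Sp n). y \<otimes>\<^bsub>Sp n\<^esub> g = \<one>\<^bsub>Sp n\<^esub>"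
    using hg by (intro bexI[of _ h]) (auto simp: Sp_def)
next
  let ?N = "2 * n" and ?J = "symp_form n"
  note J = symp_form_carrier[of n]
  fix g h assume "g \<in> carrier (Sp n)" "h \<in> carrier (Sp n)"
  then have g: "g \<in> carrier_mat ?N ?N" and gJ: "transpose_mat g * ?J * g = ?J"
    and h: "h \<in> carrier_mat ?N ?N" and hJ: "transpose_mat h * ?J * h = ?J"
    by (auto simp: Sp_def)
  have gt: "transpose_mat g \<in> carrier_mat ?N ?N" "transpose_mat h \<in> carrier_mat ?N ?N"
    using g h by auto
  have "transpose_mat (g * h) * ?J * (g * h) = transpose_mat h * (transpose_mat g * ?J * g) * h"
    using g h gt J transpose_mult[OF g h] by (simp add: assoc_mult_mat[of _ ?N ?N _ ?N _ ?N])
  then show "g \<otimes>\<^bsub>Sp n\<^esub> h \<in> carrier (Sp n)"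
    using g h gJ hJ by (simp add: Sp_def)
next
  show "\<one>\<^bsub>Sp n\<^esub> \<in> carrier (Sp n)"
    using symp_form_carrier[of n]
    by (simp add: Sp_def left_mult_one_mat[of _ "2 * n" "2 * n"] right_mult_one_mat[of _ "2 * n" "2 * n"])
qed (auto simp: Sp_def intro: assoc_mult_mat)

text \<open>
  For each \<open>j\<close>, the group acts on the span of the \<open>symp_basis n e f j\<close> as on column vectors.
\<close>

definition Sp_acts ::
    "('v::ab_group_add, 'z) vertex_data_scheme \<Rightarrow> nat \<Rightarrow> nat \<Rightarrow> (nat \<Rightarrow> nat \<Rightarrow> 'v)
      \<Rightarrow> (nat \<Rightarrow> nat \<Rightarrow> 'v) \<Rightarrow> (complex mat \<Rightarrow> 'v \<Rightarrow> 'v) \<Rightarrow> bool" where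
  "Sp_acts V m n e f \<rho> \<longleftrightarrow>
     group_action (Sp n) UNIV \<rho> \<and>
     (\<forall>g\<in>carrier (Sp n). vertex_automorphism V (\<rho> g) \<and>
        (\<forall>j\<in>{1..m}. \<forall>p<2 * n.
           \<rho> g (symp_basis n e f j p) = (\<Sum>q<2 * n. smult V (g $$ (q, p)) (symp_basis n e f j q))))"

definition Sp_invariants :: "nat \<Rightarrow> (complex mat \<Rightarrow> 'v \<Rightarrow> 'v) \<Rightarrow> 'v set" where
  "Sp_invariants n \<rho> = {v. \<forall>g\<in>carrier (Sp n). \<rho> g v = v}"

end

theory Submission
  imports Defs "HOL-Library.Multiset"
begin

text \<open>
  The commutator formula identifies the algebra with a fermionic Fock space. Write \<open>\<Omega> \<alpha> \<beta>\<close> for the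
  contraction of two creation operators with the symplectic form, \<open>\<Delta> \<alpha> \<beta>\<close> for its adjoint. On
  \<open>sp(2n)\<close>-invariants the operator \<open>\<Sum> \<Omega> \<Delta>\<close> is a nonnegative operator plus the number operator, so the
  invariants are spanned by the products of the \<open>\<Omega>\<close> applied to the vacuum.

  Wick multiplication by \<open>\<Omega> vac\<close> differs from \<open>\<Omega>\<close> by a derivation. For exponents of even parity all its
  coefficients have the same sign, hence rewriting the relation \<open>\<Omega>\<^sub>x\<^sub>x ^ n \<Omega>\<^sub>x\<^sub>y = 0\<close> in Wick products
  gives a nonzero multiple of a generator of weight at least \<open>2n + 2\<close>: these generators decouple.

  Products of at most \<open>n\<close> of the \<open>\<Omega>\<close> satisfy no relation besides commutativity and the symmetry of
  \<open>\<Omega>\<close>. So a combination of Wick products of weight below \<open>2n + 2\<close> equal to a linear expression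
  reduces, modulo derivatives, to a trivial one, and no generator is redundant.
\<close>

text \<open>The axioms contain locality but no commutator formula, so the latter is first derived by
  way of Goddard's uniqueness principle and Dong's lemma.

  The number 2n + 2 is a weight count. Each \<open>Om (j, 0) (j, 0)\<close> has weight 2, so turning
  n such factors into Wick products can raise one order in the remaining factor by 2n in all. Thus a
  quadratic with total derivative order N >= 2n is reached from the relation whose last factor has
  orders 0 and N - 2n. Its final coefficient is a sum over many ways of raising; instead of
  computing it, convex cones record that each contribution is nonnegative and one is positive.

  The same count serves minimality: more than n factors have weight at least 2n + 2, whereas every
  generator has weight at most 2n + 1. So the Wick products that matter there lie in the range
  without relations.

  The passage from Sp(2n) to its Lie algebra is algebraic: matrices 1 + tX with X nilpotent act on
  every monomial polynomially in t.\<close>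

section \<open>Difference operators and locality\<close>

text \<open>Coefficientwise, \<open>dif\<close> is multiplication of a series in \<open>z, w\<close> by \<open>z - w\<close>.\<close>

definition dif :: "(int \<Rightarrow> int \<Rightarrow> 'v::ab_group_add) \<Rightarrow> int \<Rightarrow> int \<Rightarrow> 'v" where
  "dif f r s = f (r + 1) s - f r (s + 1)"

definition dif12 :: "(int \<Rightarrow> int \<Rightarrow> int \<Rightarrow> 'v::ab_group_add) \<Rightarrow> int \<Rightarrow> int \<Rightarrow> int \<Rightarrow> 'v" where
  "dif12 f p q r = f (p + 1) q r - f p (q + 1) r"

definition dif13 :: "(int \<Rightarrow> int \<Rightarrow> int \<Rightarrow> 'v::ab_group_add) \<Rightarrow> int \<Rightarrow> int \<Rightarrow> int \<Rightarrow> 'v" where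
  "dif13 f p q r = f (p + 1) q r - f p q (r + 1)"

definition dif23 :: "(int \<Rightarrow> int \<Rightarrow> int \<Rightarrow> 'v::ab_group_add) \<Rightarrow> int \<Rightarrow> int \<Rightarrow> int \<Rightarrow> 'v" where
  "dif23 f p q r = f p (q + 1) r - f p q (r + 1)"

lemma funpow_commute_fun: "(\<And>x. f (g x) = g (f x)) \<Longrightarrow> f ((g ^^ n) x) = (g ^^ n) (f x)"
  by (induction n) auto

lemma dif_funpow_diff: "(dif ^^ N) (\<lambda>r s. f r s - g r s) = (\<lambda>r s. (dif ^^ N) f r s - (dif ^^ N) g r s)"
  by (induction N) (auto simp: dif_def fun_eq_iff)

lemma dif_funpow_zero: "(dif ^^ N) (\<lambda>r s. 0) = (\<lambda>r s. 0)"
  by (induction N) (auto simp: dif_def fun_eq_iff)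

lemma dif_funpow_sum:
  "(dif ^^ N) (\<lambda>r s. \<Sum>j\<in>J. f j r s) = (\<lambda>r s. \<Sum>j\<in>J. (dif ^^ N) (f j) r s)"
  by (induction N) (auto simp: dif_def fun_eq_iff sum_subtractf)

lemma dif_funpow_mono: "(dif ^^ N) f = (\<lambda>r s. 0) \<Longrightarrow> N \<le> M \<Longrightarrow> (dif ^^ M) f = (\<lambda>r s. 0)"
  using fun_cong[OF funpow_add[of "M - N" N dif], of f] by (simp add: dif_funpow_zero)

lemma dif12_funpow: "(dif12 ^^ N) f p q r = (dif ^^ N) (\<lambda>p q. f p q r) p q"
  by (induction N arbitrary: p q) (auto simp: dif12_def dif_def)

lemma dif13_funpow: "(dif13 ^^ N) f p q r = (dif ^^ N) (\<lambda>p r. f p q r) p r"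
  by (induction N arbitrary: p r) (auto simp: dif13_def dif_def)

lemma dif23_funpow: "(dif23 ^^ N) f p q r = (dif ^^ N) (\<lambda>q r. f p q r) q r"
  by (induction N arbitrary: q r) (auto simp: dif23_def dif_def)

lemma dif23_funpow_diff:
  "(dif23 ^^ N) (\<lambda>p q r. f p q r - g p q r) = (\<lambda>p q r. (dif23 ^^ N) f p q r - (dif23 ^^ N) g p q r)"
  by (induction N) (auto simp: dif23_def fun_eq_iff)

lemma dif23_funpow_add:
  "(dif23 ^^ N) (\<lambda>p q r. f p q r + g p q r) = (\<lambda>p q r. (dif23 ^^ N) f p q r + (dif23 ^^ N) g p q r)"
  by (induction N) (auto simp: dif23_def fun_eq_iff)

lemma dif23_funpow_zero: "(dif23 ^^ N) (\<lambda>p q r. 0) = (\<lambda>p q r. 0)"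
  by (induction N) (auto simp: dif23_def fun_eq_iff)

lemma dif23_funpow_mono: "(dif23 ^^ N) f = (\<lambda>p q r. 0) \<Longrightarrow> N \<le> M \<Longrightarrow> (dif23 ^^ M) f = (\<lambda>p q r. 0)"
  using fun_cong[OF funpow_add[of "M - N" N dif23], of f] by (simp add: dif23_funpow_zero)

lemma dif12_13_commute: "dif12 (dif13 f) = dif13 (dif12 f)"
  and dif12_23_commute: "dif12 (dif23 f) = dif23 (dif12 f)"
  and dif13_23_commute: "dif13 (dif23 f) = dif23 (dif13 f)"
  by (auto simp: fun_eq_iff dif12_def dif13_def dif23_def algebra_simps)

text \<open>The combinatorial core of Dong's lemma, from \<open>z - u = (z - w) + (w - u)\<close>.\<close>

lemma dong_dif:
  assumes "(dif12 ^^ i) f = (\<lambda>p q r. 0)" "(dif13 ^^ j) ((dif23 ^^ k) f) = (\<lambda>p q r. 0)"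
  shows "(dif23 ^^ (i + j + k)) f = (\<lambda>p q r. 0)"
  using assms
\<comment> \<open>Each further factor w - u splits into z - u, which lowers j, and z - w, which
  lowers i.\<close>
proof (induction "i + j" arbitrary: i j f rule: less_induct)
  case less
  show ?case
  proof (cases i)
    case 0
    then have "f = (\<lambda>p q r. 0)" using less.prems by simp
    then show ?thesis by (simp add: dif23_funpow_zero)
  next
    case (Suc i')
    show ?thesis
    proof (cases j)
      case 0
      then show ?thesis using less.prems by (auto intro: dif23_funpow_mono[of k])
    next
      case (Suc j')
      have i: "i = Suc i'" by fact
      have z12: "dif12 (\<lambda>p q r. 0) = (\<lambda>p q r. (0::'a))"
        by (simp add: dif12_def fun_eq_iff)
      have z13: "dif13 (\<lambda>p q r. 0) = (\<lambda>p q r. (0::'a))"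
        by (simp add: dif13_def fun_eq_iff)
      have "(dif12 ^^ i') (dif12 f) = (\<lambda>p q r. 0)"
        using less.prems(1) by (simp add: i funpow_swap1)
      moreover have "(dif13 ^^ j) ((dif23 ^^ k) (dif12 f)) = dif12 ((dif13 ^^ j) ((dif23 ^^ k) f))"
        by (simp add: funpow_commute_fun[where f=dif12] dif12_13_commute dif12_23_commute)
      ultimately have M1: "(dif23 ^^ (i' + j + k)) (dif12 f) = (\<lambda>p q r. 0)"
        using less.hyps[of i' j "dif12 f"] less.prems(2) z12 by (auto simp: i)
      have "(dif12 ^^ i) (dif13 f) = dif13 ((dif12 ^^ i) f)"
        by (simp add: funpow_commute_fun[where f=dif13] dif12_13_commute)
      moreover have "(dif13 ^^ j') ((dif23 ^^ k) (dif13 f)) = (dif13 ^^ j) ((dif23 ^^ k) f)"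
        by (simp add: Suc funpow_swap1 funpow_commute_fun[where f=dif13] dif13_23_commute)
      ultimately have M2: "(dif23 ^^ (i + j' + k)) (dif13 f) = (\<lambda>p q r. 0)"
        using less.hyps[of i j' "dif13 f"] less.prems z13 by (auto simp: Suc)
      let ?M = "i' + j + k"
      have "dif23 f = (\<lambda>p q r. dif13 f p q r - dif12 f p q r)"
        by (auto simp: fun_eq_iff dif12_def dif13_def dif23_def)
      then have "(dif23 ^^ ?M) (dif23 f) = (\<lambda>p q r. (dif23 ^^ ?M) (dif13 f) p q r - (dif23 ^^ ?M) (dif12 f) p q r)"
        by (simp add: dif23_funpow_diff)
      also have "\<dots> = (\<lambda>p q r. 0)"
        using M1 M2 by (simp add: fun_eq_iff i Suc)
      finally show ?thesis by (simp add: i funpow_swap1)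
    qed
  qed
qed

text \<open>In column -1 the subtracted entry lies in column 0, where the array vanishes; so
  \<open>dif\<close> acts there as a pure shift of the row.\<close>

lemma dif_funpow_boundary:
  assumes "\<And>r s. r \<ge> r0 \<Longrightarrow> s \<ge> 0 \<Longrightarrow> f r s = 0" and "r \<ge> r0"
  shows "s \<ge> 0 \<Longrightarrow> (dif ^^ N) f r s = 0"
    and "(dif ^^ N) f r (- 1) = f (r + int N) (- 1)"
proof -
  have "(\<forall>r s. r \<ge> r0 \<longrightarrow> s \<ge> 0 \<longrightarrow> (dif ^^ N) f r s = 0) \<and>
    (\<forall>r\<ge>r0. (dif ^^ N) f r (- 1) = f (r + int N) (- 1))"
    by (induction N) (auto simp: dif_def assms(1) ac_simps)
  then show "s \<ge> 0 \<Longrightarrow> (dif ^^ N) f r s = 0"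
    and "(dif ^^ N) f r (- 1) = f (r + int N) (- 1)" using assms(2) by blast+
qed

lemma int_shift_const:
  assumes "\<And>r s. f (r + 1) s = (f r (s + 1) :: 'a)"
  shows "f r s = f (0::int) (r + s :: int)"
proof (induction r arbitrary: s rule: int_induct[where k=0])
  case base then show ?case by simp
next
  case (step1 i) then show ?case using assms[of i s] by (simp add: ac_simps)
next
  case (step2 i) then show ?case using assms[of "i - 1" "s - 1"] by (simp add: algebra_simps)
qed

text \<open>An array killed by (z - w)^N behaves like a combination of derivatives of the delta
  distribution, and the zeroth rows of its first N differences are the coefficients. In the
  induction, the kernel of \<open>dif\<close> consists of arrays depending on r + s only.\<close>

lemma dif_eq_zeroI:
  assumes "(dif ^^ N) f = (\<lambda>r s. 0)" "\<And>i s. i < N \<Longrightarrow> (dif ^^ i) f 0 s = 0"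
  shows "f = (\<lambda>r s. 0)"
  using assms
proof (induction N arbitrary: f)
  case (Suc N)
  have "dif f = (\<lambda>r s. 0)"
  proof (rule Suc.IH)
    show "(dif ^^ N) (dif f) = (\<lambda>r s. 0)" using Suc.prems(1) by (simp add: funpow_swap1)
    show "(dif ^^ i) (dif f) 0 s = 0" if "i < N" for i s
      using Suc.prems(2)[of "Suc i" s] that by (simp add: funpow_swap1)
  qed
  then have "f (r + 1) s = f r (s + 1)" for r s
    by (auto simp: fun_eq_iff dif_def)
  then have "f r s = f 0 (r + s)" for r s by (rule int_shift_const)
  then show ?case using Suc.prems(2)[of 0] by (auto simp: fun_eq_iff)
qed simp

section \<open>The commutator formula in a vertex superalgebra\<close>

lemma koszul_sign_add: "koszul_sign (p + q) r = koszul_sign p r * koszul_sign q r"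
  by (cases p; cases q; cases r) (auto simp: koszul_sign_def)

context vertex_superalgebra
begin

abbreviation "T \<equiv> transl V"
abbreviation "lin \<equiv> Vector_Spaces.linear (smult V) (smult V)"

sublocale VV: vector_space_pair "smult V" "smult V"
  by unfold_locales

lemma nprod_add_left: "nprod V (a + a') r b = nprod V a r b + nprod V a' r b"
  and nprod_scale_left: "nprod V (smult V c a) r b = smult V c (nprod V a r b)"
  and nprod_sum_left: "nprod V (sum g J) r b = (\<Sum>j\<in>J. nprod V (g j) r b)"
  and nprod_zero_left [simp]: "nprod V 0 r b = 0"
  and nprod_minus_left: "nprod V (- a) r b = - nprod V a r b"
proof -
  interpret L: Vector_Spaces.linear "smult V" "smult V" "\<lambda>a. nprod V a r b" by (rule nprod_linear_left)
  show "nprod V (a + a') r b = nprod V a r b + nprod V a' r b" by (rule L.add)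
  show "nprod V (smult V c a) r b = smult V c (nprod V a r b)" by (rule L.scale)
  show "nprod V (sum g J) r b = (\<Sum>j\<in>J. nprod V (g j) r b)" by (rule L.sum)
  show "nprod V 0 r b = 0" by (rule L.zero)
  show "nprod V (- a) r b = - nprod V a r b" by (rule L.neg)
qed

lemma nprod_add_right: "nprod V a r (b + b') = nprod V a r b + nprod V a r b'"
  and nprod_diff_right: "nprod V a r (b - b') = nprod V a r b - nprod V a r b'"
  and nprod_scale_right: "nprod V a r (smult V c b) = smult V c (nprod V a r b)"
  and nprod_sum_right: "nprod V a r (sum g J) = (\<Sum>j\<in>J. nprod V a r (g j))"
  and nprod_zero_right [simp]: "nprod V a r 0 = 0"
  and nprod_minus_right: "nprod V a r (- b) = - nprod V a r b"
proof -
  interpret L: Vector_Spaces.linear "smult V" "smult V" "nprod V a r" by (rule nprod_linear_right)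
  show "nprod V a r (b + b') = nprod V a r b + nprod V a r b'" by (rule L.add)
  show "nprod V a r (b - b') = nprod V a r b - nprod V a r b'" by (rule L.diff)
  show "nprod V a r (smult V c b) = smult V c (nprod V a r b)" by (rule L.scale)
  show "nprod V a r (sum g J) = (\<Sum>j\<in>J. nprod V a r (g j))" by (rule L.sum)
  show "nprod V a r 0 = 0" by (rule L.zero)
  show "nprod V a r (- b) = - nprod V a r b" by (rule L.neg)
qed

lemma T_linear: "lin T"
  using nprod_linear_left[of "-2" "vac V"] by (simp add: transl_def[abs_def])

lemma T_add: "T (a + b) = T a + T b"
  and T_diff: "T (a - b) = T a - T b"
  and T_scale: "T (smult V c a) = smult V c (T a)"
  and T_sum: "T (sum g J) = (\<Sum>j\<in>J. T (g j))"
  and T_zero [simp]: "T 0 = 0"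
proof -
  interpret L: Vector_Spaces.linear "smult V" "smult V" "T" by (rule T_linear)
  show "T (a + b) = T a + T b" by (rule L.add)
  show "T (a - b) = T a - T b" by (rule L.diff)
  show "T (smult V c a) = smult V c (T a)" by (rule L.scale)
  show "T (sum g J) = (\<Sum>j\<in>J. T (g j))" by (rule L.sum)
  show "T 0 = 0" by (rule L.zero)
qed

lemma T_vac [simp]: "T (vac V) = 0"
  by (simp add: transl_def vac_left)

lemma T_nprod: "T (nprod V a r b) = nprod V a r (T b) + smult V (- of_int r) (nprod V a (r - 1) b)"
  using translation[of a r b] by (simp add: algebra_simps)

lemma T_grade: "a \<in> grade V p \<Longrightarrow> T a \<in> grade V p"
  using nprod_grade[of a p "vac V" 0 "- 2"] vac_even by (simp only: transl_def add_0_right)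

section \<open>Locality and Goddard's uniqueness principle\<close>

lemma dif_funpow_scale: "(dif ^^ N) (\<lambda>r s. smult V c (f r s)) = (\<lambda>r s. smult V c ((dif ^^ N) f r s))"
  by (induction N) (auto simp: dif_def fun_eq_iff scale_right_diff_distrib)

lemma dif_funpow_T: "(dif ^^ N) (\<lambda>r s. T (f r s)) = (\<lambda>r s. T ((dif ^^ N) f r s))"
  by (induction N) (auto simp: dif_def fun_eq_iff T_diff)

lemma dif_funpow_linear:
  assumes "lin L"
  shows "(dif ^^ N) (\<lambda>r s. L (f r s)) = (\<lambda>r s. L ((dif ^^ N) f r s))"
proof -
  interpret L: Vector_Spaces.linear "smult V" "smult V" L by fact
  show ?thesis by (induction N) (auto simp: dif_def fun_eq_iff L.diff)
qed

text \<open>This is the alternating sum in the axiom \<open>locality\<close>, which thereby says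
  that a power of \<open>dif\<close> kills the array of supercommutators.\<close>

lemma dif_funpow_binomial:
  "(dif ^^ N) f k l = (\<Sum>i\<le>N. smult V ((- 1) ^ i * of_nat (N choose i)) (f (k + int N - int i) (l + int i)))"
proof (induction N arbitrary: k l)
  case (Suc N)
  let ?g = "\<lambda>i. f (k + int (Suc N) - int i) (l + int i)"
  have "(\<Sum>i\<le>Suc N. smult V ((- 1) ^ i * of_nat (Suc N choose i)) (?g i))
     = ?g 0 + (\<Sum>i\<le>N. smult V ((- 1) ^ Suc i * of_nat (N choose Suc i)) (?g (Suc i))
          + smult V ((- 1) ^ Suc i * of_nat (N choose i)) (?g (Suc i)))"
    by (subst sum.atMost_Suc_shift) (simp add: algebra_simps)
  also have "\<dots> = (\<Sum>i\<le>Suc N. smult V ((- 1) ^ i * of_nat (N choose i)) (?g i))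
      - (\<Sum>i\<le>N. smult V ((- 1) ^ i * of_nat (N choose i)) (?g (Suc i)))"
    using sum.atMost_Suc_shift[of "\<lambda>i. smult V ((- 1) ^ i * of_nat (N choose i)) (?g i)" N]
    by (simp add: sum.distrib sum_negf sum_subtractf)
  also have "(\<Sum>i\<le>Suc N. smult V ((- 1) ^ i * of_nat (N choose i)) (?g i))
     = (\<Sum>i\<le>N. smult V ((- 1) ^ i * of_nat (N choose i)) (?g i))"
    by simp
  also have "\<dots> = (dif ^^ N) f (k + 1) l"
    by (simp add: Suc algebra_simps)
  also have "(\<Sum>i\<le>N. smult V ((- 1) ^ i * of_nat (N choose i)) (?g (Suc i))) = (dif ^^ N) f k (l + 1)"
    by (simp add: Suc algebra_simps)
  finally show ?case by (simp add: dif_def[of "(dif ^^ N) f" k l])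
qed simp

text \<open>\<open>B\<close> is any series of operators, not necessarily the field of a vector;
  hence the sign is a parameter instead of being read off from a parity. The order N is uniform in
  v.\<close>

definition local_with :: "(int \<Rightarrow> 'v \<Rightarrow> 'v) \<Rightarrow> complex \<Rightarrow> 'v \<Rightarrow> bool" where
  "local_with B \<kappa> c \<longleftrightarrow> (\<exists>N. \<forall>v. (dif ^^ N)
     (\<lambda>r s. B r (nprod V c s v) - smult V \<kappa> (nprod V c s (B r v))) = (\<lambda>r s. 0))"

lemma local_with_nprod:
  assumes "a \<in> grade V p" "c \<in> grade V q"
  shows "local_with (nprod V a) (koszul_sign p q) c"
proof -
  obtain N where N: "\<forall>k l v. (\<Sum>i\<le>N. smult V ((- 1) ^ i * of_nat (N choose i))
                (nprod V a (k + int N - int i) (nprod V c (l + int i) v)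
                 - smult V (koszul_sign p q)
                     (nprod V c (l + int i) (nprod V a (k + int N - int i) v)))) = 0"
    using locality[OF assms] by blast
  show ?thesis unfolding local_with_def
    by (rule exI[of _ N]) (auto simp: fun_eq_iff dif_funpow_binomial N)
qed

lemma local_with_diff:
  assumes "local_with B \<kappa> c" "local_with B' \<kappa> c"
  shows "local_with (\<lambda>r v. B r v - B' r v) \<kappa> c"
proof -
  obtain N where N: "\<And>v. (dif ^^ N)
     (\<lambda>r s. B r (nprod V c s v) - smult V \<kappa> (nprod V c s (B r v))) = (\<lambda>r s. 0)"
    using assms(1) by (auto simp: local_with_def)
  obtain N' where N': "\<And>v. (dif ^^ N')
     (\<lambda>r s. B' r (nprod V c s v) - smult V \<kappa> (nprod V c s (B' r v))) = (\<lambda>r s. 0)"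
    using assms(2) by (auto simp: local_with_def)
  let ?M = "max N N'"
  have "(dif ^^ ?M) (\<lambda>r s. (B r (nprod V c s v) - B' r (nprod V c s v))
       - smult V \<kappa> (nprod V c s (B r v - B' r v))) = (\<lambda>r s. 0)" for v
  proof -
    have "(\<lambda>r s. (B r (nprod V c s v) - B' r (nprod V c s v))
       - smult V \<kappa> (nprod V c s (B r v - B' r v)))
      = (\<lambda>r s. (B r (nprod V c s v) - smult V \<kappa> (nprod V c s (B r v)))
         - (B' r (nprod V c s v) - smult V \<kappa> (nprod V c s (B' r v))))"
      by (auto simp: fun_eq_iff nprod_diff_right scale_right_diff_distrib)
    then show ?thesis
      using dif_funpow_mono[OF N, of ?M] dif_funpow_mono[OF N', of ?M]
      by (simp add: dif_funpow_diff)
  qed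
  then show ?thesis by (auto simp: local_with_def)
qed

text \<open>Apply locality to the vacuum. The terms with \<open>B\<close> next to the vacuum vanish,
  and the coefficient at -1 of the field of c recovers c itself.\<close>

lemma goddard:
  assumes "\<And>r. lin (B r)" "\<And>r. B r (vac V) = 0"
    "\<And>c q. c \<in> grade V q \<Longrightarrow> \<exists>\<kappa>. local_with B \<kappa> c"
  shows "B r v = 0"
proof -
  note [simp] = VV.linear_0[OF assms(1)] and add = VV.linear_add[OF assms(1)]
  have hom: "B r c = 0" if c: "c \<in> grade V q" for r c q
  proof -
    obtain \<kappa> N where N: "\<And>v. (dif ^^ N)
     (\<lambda>r s. B r (nprod V c s v) - smult V \<kappa> (nprod V c s (B r v))) = (\<lambda>r s. 0)"
      using assms(3)[OF c] by (auto simp: local_with_def)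
    define f where "f = (\<lambda>r s. B r (nprod V c s (vac V)) - smult V \<kappa> (nprod V c s (B r (vac V))))"
    \<comment> \<open>The N shifts of the boundary column lead from row r - N to row r.\<close>
    have "(dif ^^ N) f (r - int N) (- 1) = f (r - int N + int N) (- 1)"
      using dif_funpow_boundary(2)[of "r - int N" f "r - int N" N] by (simp add: f_def vac_right assms(2))
    then show ?thesis using N[of "vac V"] by (simp add: f_def fun_eq_iff assms(2) vac_creation)
  qed
  obtain a b where "a \<in> grade V 0" "b \<in> grade V 1" "v = a + b" using grade_sum by blast
  then show ?thesis using hom by (simp add: add)
qed

lemma T_nprod_vac: "T (nprod V a r (vac V)) = smult V (- of_int r) (nprod V a (r - 1) (vac V))"
  by (simp add: T_nprod)

text \<open>A field is determined on the vacuum by its coefficient at \<open>-1\<close> and translation covariance.\<close>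

lemma covariant_vac_eq:
  assumes "\<And>s. s \<ge> 0 \<Longrightarrow> F s = 0" "F (- 1) = a" "\<And>s. T (F s) = smult V (- of_int s) (F (s - 1))"
  shows "F s = nprod V a s (vac V)"
proof (cases "s \<ge> 0")
  case False
  have "F (- 1 - int k) = nprod V a (- 1 - int k) (vac V)" for k
  proof (induction k)
    case (Suc k)
    \<comment> \<open>At s = -1 - k the covariance factor is k + 1, hence nonzero, and determines
      the next lower coefficient.\<close>
    have "smult V (of_nat k + 1) (F (- 1 - int k - 1)) = smult V (of_nat k + 1) (nprod V a (- 1 - int k - 1) (vac V))"
      using assms(3)[of "- 1 - int k"] T_nprod_vac[of a "- 1 - int k"]
      by (simp only: Suc of_int_diff of_int_minus of_int_1 of_int_of_nat_eq minus_diff_eq diff_minus_eq_add)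
    moreover have "of_nat k + 1 \<noteq> (0::complex)" by (metis of_nat_Suc add.commute of_nat_neq_0)
    ultimately have "F (- 1 - int k - 1) = nprod V a (- 1 - int k - 1) (vac V)"
      using scale_left_imp_eq by blast
    then show ?case by (simp add: algebra_simps)
  qed (simp add: assms vac_creation)
  from this[of "nat (- 1 - s)"] False show ?thesis by simp
qed (simp add: assms vac_right)

text \<open>The field of T a and the z-derivative of the field of a agree on the vacuum by
  \<open>covariant_vac_eq\<close>; their difference is local, so Goddard's principle
  applies.\<close>

lemma nprod_T_left: "nprod V (T a) r b = smult V (- of_int r) (nprod V a (r - 1) b)"
proof -
  have "nprod V (T a) r b - smult V (- of_int r) (nprod V a (r - 1) b) = 0" if a: "a \<in> grade V p" for a p
  proof (rule goddard[where B="\<lambda>r b. nprod V (T a) r b - smult V (- of_int r) (nprod V a (r - 1) b)"])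
    show "lin (\<lambda>b. nprod V (T a) r b - smult V (- of_int r) (nprod V a (r - 1) b))" for r
      by (intro VV.linear_compose_sub VV.linear_compose_scale_right nprod_linear_right)
    show "nprod V (T a) r (vac V) - smult V (- of_int r) (nprod V a (r - 1) (vac V)) = 0" for r
    proof -
      have *: "T (smult V (- of_int s) (nprod V a (s - 1) (vac V))) =
         smult V (- of_int s) (smult V (- of_int (s - 1)) (nprod V a (s - 1 - 1) (vac V)))" for s
        by (simp only: T_scale T_nprod_vac)
      have F0: "smult V (- of_int s) (nprod V a (s - 1) (vac V)) = 0" if "s \<ge> 0" for s
        using that vac_right[of "s - 1" a] by (cases "s = 0") auto
      have "smult V (- of_int r) (nprod V a (r - 1) (vac V)) = nprod V (T a) r (vac V)"
        by (rule covariant_vac_eq[where F="\<lambda>r. smult V (- of_int r) (nprod V a (r - 1) (vac V))"])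
          (use * F0 in \<open>auto simp: transl_def\<close>)
      then show ?thesis by simp
    qed
  next
    fix c q assume c: "c \<in> grade V q"
    let ?\<kappa> = "koszul_sign p q"
    obtain N where N: "\<And>v. (dif ^^ N)
     (\<lambda>r s. nprod V a r (nprod V c s v) - smult V ?\<kappa> (nprod V c s (nprod V a r v))) = (\<lambda>r s. 0)"
      using local_with_nprod[OF a c] by (auto simp: local_with_def)
    \<comment> \<open>Leibniz rule: (z - w)^(N+1) commutes with the z-derivative up to (N+1) (z -
      w)^N. Differentiating therefore costs one order of locality.\<close>
    have shift: "(dif ^^ N) f = (\<lambda>r s. 0) \<Longrightarrow>
       (dif ^^ Suc N) (\<lambda>r s. smult V (- of_int r) (f (r - 1) s)) = (\<lambda>r s. 0)" for N and f :: "int \<Rightarrow> int \<Rightarrow> 'v"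
    proof -
      have "(dif ^^ Suc N) (\<lambda>r s. smult V (- of_int r) (f (r - 1) s)) =
        (\<lambda>r s. smult V (- of_int r) ((dif ^^ Suc N) f (r - 1) s) - smult V (of_nat (Suc N)) ((dif ^^ N) f r s))"
      proof (induction N)
        case 0 show ?case by (auto simp: dif_def fun_eq_iff algebra_simps)
      next
        case (Suc N)
        have "(dif ^^ Suc (Suc N)) (\<lambda>r s. smult V (- of_int r) (f (r - 1) s)) =
          dif (\<lambda>r s. smult V (- of_int r) ((dif ^^ Suc N) f (r - 1) s) - smult V (of_nat (Suc N)) ((dif ^^ N) f r s))"
          by (subst funpow.simps(2), subst o_apply, subst Suc, rule refl)
        also have "\<dots> = (\<lambda>r s. smult V (- of_int r) ((dif ^^ Suc (Suc N)) f (r - 1) s) - smult V (of_nat (Suc (Suc N))) ((dif ^^ Suc N) f r s))"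
        proof (intro ext)
          fix r s
          define g where "g = (dif ^^ N) f"
          define D where "D = (dif ^^ Suc N) f"
          have D: "g (r + 1) s = D r s + g r (s + 1)" by (simp add: D_def g_def dif_def[of "(dif ^^ N) f"])
          have "(dif ^^ Suc (Suc N)) f = dif D" by (simp add: D_def)
          then show "dif (\<lambda>r s. smult V (- of_int r) ((dif ^^ Suc N) f (r - 1) s) - smult V (of_nat (Suc N)) ((dif ^^ N) f r s)) r s
            = smult V (- of_int r) ((dif ^^ Suc (Suc N)) f (r - 1) s) - smult V (of_nat (Suc (Suc N))) ((dif ^^ Suc N) f r s)"
            unfolding D_def[symmetric] g_def[symmetric]
            using scale_left_distrib[of 1 1 "D r s"]
            by (simp add: dif_def[of "\<lambda>r s. _ r s - _ r s"] dif_def[of D] D[simplified add.commute] D algebra_simps)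
        qed
        finally show ?case .
      qed
      then show "(dif ^^ N) f = (\<lambda>r s. 0) \<Longrightarrow> ?thesis"
        using dif_funpow_mono[of N f "Suc N"] by (simp add: fun_eq_iff del: funpow.simps)
    qed
    have "local_with (\<lambda>r b. smult V (- of_int r) (nprod V a (r - 1) b)) ?\<kappa> c"
      unfolding local_with_def
    proof (intro exI allI)
      fix v
      show "(dif ^^ Suc N) (\<lambda>r s. smult V (- of_int r) (nprod V a (r - 1) (nprod V c s v)) -
         smult V ?\<kappa> (nprod V c s (smult V (- of_int r) (nprod V a (r - 1) v)))) = (\<lambda>r s. 0)"
        using shift[OF N[of v]] by (simp add: nprod_scale_right algebra_simps nprod_minus_right del: funpow.simps)
    qed
    then show "\<exists>\<kappa>. local_with (\<lambda>r b. nprod V (T a) r b - smult V (- of_int r) (nprod V a (r - 1) b)) \<kappa> c"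
      using local_with_diff local_with_nprod[OF T_grade[OF a] c] by blast
  qed
  note hom = this
  obtain a0 a1 where "a0 \<in> grade V 0" "a1 \<in> grade V 1" "a = a0 + a1" using grade_sum by blast
  then show ?thesis using hom[of a0 0] hom[of a1 1]
    by (simp add: T_add nprod_add_left scale_right_distrib add_eq_0_iff2)
qed


lemma T_funpow_left:
  "nprod V ((T ^^ k) a) (- 1 - int t) b = smult V (fact (t + k) / fact t) (nprod V a (- 1 - int t - int k) b)"
proof (induction k arbitrary: t)
  case (Suc k)
  have "nprod V ((T ^^ Suc k) a) (- 1 - int t) b = smult V (of_nat (Suc t)) (nprod V ((T ^^ k) a) (- 1 - int (Suc t)) b)"
    by (simp add: nprod_T_left algebra_simps)
  also have "\<dots> = smult V (of_nat (Suc t) * (fact (Suc t + k) / fact (Suc t))) (nprod V a (- 1 - int (Suc t) - int k) b)"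
    by (subst Suc) (simp del: of_nat_Suc fact_Suc)
  also have "of_nat (Suc t) * (fact (Suc t + k) / fact (Suc t)) = fact (t + Suc k) / (fact t :: complex)"
    by (simp del: of_nat_Suc)
  also have "- 1 - int (Suc t) - int k = - 1 - int t - int (Suc k)" by simp
  finally show ?case .
qed simp

section \<open>Dong's lemma and the commutator formula\<close>

lemma dif_funpow_lin:
  "(\<And>r s. lin (\<lambda>v. F v r s)) \<Longrightarrow> lin (\<lambda>v. (dif ^^ N) (F v) r s)"
  by (induction N arbitrary: r s) (auto simp: dif_def intro!: VV.linear_compose_sub)

text \<open>The array is a field times the j-th divided derivative of the delta distribution; by
  Pascal's rule each factor z - w lowers j by one, and the array with j = 0 is killed.\<close>

lemma dif_funpow_binomial_shift:
  "(dif ^^ i) (\<lambda>r s. smult V (of_int r gchoose j) (y (r + s - int j)))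
    = (\<lambda>r s. if i \<le> j then smult V (of_int r gchoose (j - i)) (y (r + s - int (j - i))) else 0)"
proof (induction i)
  case (Suc i)
  note step = funpow.simps(2)[of i dif] o_apply[of dif "dif ^^ i"] Suc
  show ?case
  proof (cases "Suc i \<le> j")
    case True
    then obtain k where k: "j - i = Suc k" "j - Suc i = k" by (metis Suc_diff_le diff_Suc_Suc)
    have "smult V (of_int (r + 1) gchoose Suc k) (y (r + 1 + s - int (Suc k))) - smult V (of_int r gchoose Suc k) (y (r + (s + 1) - int (Suc k)))
       = smult V (of_int r gchoose k) (y (r + s - int k))" for r s
      by (simp add: gbinomial_Suc_Suc scale_left_distrib add_diff_eq)
    with True k show ?thesis
      unfolding step by (simp add: dif_def fun_eq_iff)
  next
    case False
    then consider "i = j" | "i > j" by linarith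
    then show ?thesis unfolding step by cases (auto simp: dif_def fun_eq_iff algebra_simps)
  qed
qed simp

text \<open>Dong's lemma for the series that will turn out to be the field of
  \<open>nprod V a (int j) b\<close>. It is stated for the series because that identification itself
  uses locality.\<close>

lemma local_with_commutator:
  assumes a: "a \<in> grade V p" and b: "b \<in> grade V q" and c: "c \<in> grade V g"
  defines "H \<equiv> \<lambda>v r s. nprod V a r (nprod V b s v) - smult V (koszul_sign p q) (nprod V b s (nprod V a r v))"
  shows "local_with (\<lambda>s v. (dif ^^ j) (H v) 0 s) (koszul_sign (p + q) g) c"
proof -
  let ?pq = "koszul_sign p q" and ?pg = "koszul_sign p g" and ?qg = "koszul_sign q g"
  obtain N1 where N1: "\<And>v. (dif ^^ N1) (H v) = (\<lambda>r s. 0)"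
    using local_with_nprod[OF a b] by (auto simp: local_with_def H_def)
  define H2 where "H2 = (\<lambda>v r s. nprod V b r (nprod V c s v) - smult V ?qg (nprod V c s (nprod V b r v)))"
  define H3 where "H3 = (\<lambda>v r s. nprod V a r (nprod V c s v) - smult V ?pg (nprod V c s (nprod V a r v)))"
  obtain N2 where N2: "\<And>v. (dif ^^ N2) (H2 v) = (\<lambda>r s. 0)"
    using local_with_nprod[OF b c] by (auto simp: local_with_def H2_def)
  obtain N3 where N3: "\<And>v. (dif ^^ N3) (H3 v) = (\<lambda>r s. 0)"
    using local_with_nprod[OF a c] by (auto simp: local_with_def H3_def)
  have eq: "(dif ^^ (N1 + N3 + N2)) (\<lambda>s t. (dif ^^ j) (H (nprod V c t v)) 0 s
      - smult V (?pg * ?qg) (nprod V c t ((dif ^^ j) (H v) 0 s))) = (\<lambda>r s. 0)" for v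
  proof -
    define \<Phi> where "\<Phi> = (\<lambda>x y z. H (nprod V c z v) x y - smult V (?pg * ?qg) (nprod V c z (H v x y)))"
    have "(dif12 ^^ N1) \<Phi> x y z = 0" for x y z
      unfolding dif12_funpow \<Phi>_def
      using dif_funpow_linear[OF nprod_linear_right[of c z]]
      by (simp add: dif_funpow_diff dif_funpow_scale N1)
    then have 1: "(dif12 ^^ N1) \<Phi> = (\<lambda>x y z. 0)" by (simp add: fun_eq_iff)
    \<comment> \<open>Jacobi identity: the double commutator splits into a part built from [b, c],
      killed by powers of \<open>dif23\<close>, and a part built from [a, c], killed by powers of
      \<open>dif13\<close>.\<close>
    define \<Phi>1 where "\<Phi>1 = (\<lambda>x y z. nprod V a x (H2 v y z) - smult V (?pq * ?pg) (H2 (nprod V a x v) y z))"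
    define \<Phi>2 where "\<Phi>2 = (\<lambda>x y z. smult V ?qg (H3 (nprod V b y v) x z) - smult V ?pq (nprod V b y (H3 v x z)))"
    have \<Phi>: "\<Phi> = (\<lambda>x y z. \<Phi>1 x y z + \<Phi>2 x y z)"
      by (auto simp: fun_eq_iff \<Phi>_def \<Phi>1_def \<Phi>2_def H_def H2_def H3_def nprod_diff_right nprod_scale_right algebra_simps)
    have "(dif23 ^^ N2) \<Phi>1 x y z = 0" for x y z
      unfolding dif23_funpow \<Phi>1_def
      using dif_funpow_linear[OF nprod_linear_right[of a x]]
      by (simp add: dif_funpow_diff dif_funpow_scale N2)
    then have 21: "(dif23 ^^ N2) \<Phi>1 = (\<lambda>x y z. 0)" by (simp add: fun_eq_iff)
    have "(dif13 ^^ N3) \<Phi>2 x y z = 0" for x y z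
      unfolding dif13_funpow \<Phi>2_def
      using dif_funpow_linear[OF nprod_linear_right[of b y]]
      by (simp add: dif_funpow_diff dif_funpow_scale N3)
    then have "(dif13 ^^ N3) \<Phi>2 = (\<lambda>x y z. 0)" by (simp add: fun_eq_iff)
    moreover have "(dif13 ^^ N3) ((dif23 ^^ N2) \<Phi>2) = (dif23 ^^ N2) ((dif13 ^^ N3) \<Phi>2)"
      by (simp add: funpow_commute_fun[where g=dif23] funpow_commute_fun[where f=dif23] dif13_23_commute)
    ultimately have "(dif13 ^^ N3) ((dif23 ^^ N2) \<Phi>) = (\<lambda>x y z. 0)"
      by (simp add: \<Phi> dif23_funpow_add 21 dif23_funpow_zero)
    from dong_dif[OF 1 this]
    have "(dif12 ^^ j) ((dif23 ^^ (N1 + N3 + N2)) \<Phi>) = (\<lambda>x y z. 0)"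
      by (simp add: fun_eq_iff dif12_funpow dif_funpow_zero)
    moreover have "(dif12 ^^ j) ((dif23 ^^ (N1 + N3 + N2)) \<Phi>) = (dif23 ^^ (N1 + N3 + N2)) ((dif12 ^^ j) \<Phi>)"
      by (rule funpow_commute_fun) (metis dif12_23_commute funpow_commute_fun)
    ultimately have "(dif23 ^^ (N1 + N3 + N2)) ((dif12 ^^ j) \<Phi>) = (\<lambda>x y z. 0)" by simp
    then have "(dif ^^ (N1 + N3 + N2)) (\<lambda>y z. (dif12 ^^ j) \<Phi> 0 y z) y z = 0" for y z
      by (metis dif23_funpow)
    moreover have "(\<lambda>y z. (dif12 ^^ j) \<Phi> 0 y z) = (\<lambda>s t. (dif ^^ j) (H (nprod V c t v)) 0 s
      - smult V (?pg * ?qg) (nprod V c t ((dif ^^ j) (H v) 0 s)))"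
      unfolding dif12_funpow \<Phi>_def using dif_funpow_linear[OF nprod_linear_right[of c]]
      by (simp add: dif_funpow_diff dif_funpow_scale)
    ultimately show ?thesis by (simp add: fun_eq_iff)
  qed
  then show ?thesis unfolding local_with_def koszul_sign_add by blast
qed

text \<open>Both sides are local series in s, so it is enough to compare them on the vacuum. There
  translation covariance leaves only the coefficient at s = -1, which is
  \<open>nprod V a (int j) b\<close>.\<close>

lemma commutator_difference:
  assumes a: "a \<in> grade V p" and b: "b \<in> grade V q"
  defines "H \<equiv> \<lambda>v r s. nprod V a r (nprod V b s v) - smult V (koszul_sign p q) (nprod V b s (nprod V a r v))"
  shows "(dif ^^ j) (H v) 0 s = nprod V (nprod V a (int j) b) s v"
proof -
  have linH: "lin (\<lambda>v. H v r s)" for r s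
    unfolding H_def
    by (intro VV.linear_compose_sub VV.linear_compose_scale_right nprod_linear_right
        Vector_Spaces.linear_compose[OF nprod_linear_right nprod_linear_right, unfolded o_def])
  \<comment> \<open>Coefficientwise, \<open>M\<close> is the sum of the z- and w-derivatives; it
    commutes with multiplication by z - w. In row 0 its first summand vanishes and plain covariance
    in s is left.\<close>
  define M where "M = (\<lambda>(f :: int \<Rightarrow> int \<Rightarrow> 'v) r s. smult V (- of_int r) (f (r - 1) s) + smult V (- of_int s) (f r (s - 1)))"
  have comm: "dif (M f) = M (dif f)" for f
    by (auto simp: fun_eq_iff dif_def M_def algebra_simps)
  let ?h = "H (vac V)"
  have TH: "(\<lambda>r s. T (?h r s)) = M ?h"
    by (auto simp: fun_eq_iff H_def M_def T_diff T_scale T_nprod nprod_add_right nprod_scale_right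
        nprod_minus_right algebra_simps)
  have vac: "(dif ^^ j) ?h 0 s = nprod V (nprod V a (int j) b) s (vac V)" for s
  proof (rule covariant_vac_eq)
    show "(dif ^^ j) ?h 0 s = 0" if "s \<ge> 0" for s
      by (rule dif_funpow_boundary(1)[where r0=0]) (auto simp: H_def vac_right that)
    have "(dif ^^ j) ?h 0 (- 1) = ?h (0 + int j) (- 1)"
      by (rule dif_funpow_boundary(2)[where r0=0]) (auto simp: H_def vac_right)
    then show "(dif ^^ j) ?h 0 (- 1) = nprod V a (int j) b"
      by (simp add: H_def vac_right vac_creation)
    have "(\<lambda>r s. T ((dif ^^ j) ?h r s)) = (dif ^^ j) (\<lambda>r s. T (?h r s))"
      by (simp add: dif_funpow_T)
    also have "\<dots> = M ((dif ^^ j) ?h)"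
      by (simp add: TH funpow_commute_fun[where f=M] comm)
    finally show "T ((dif ^^ j) ?h 0 s) = smult V (- of_int s) ((dif ^^ j) ?h 0 (s - 1))" for s
      by (simp add: fun_eq_iff M_def)
  qed
  have "(dif ^^ j) (H v) 0 s - nprod V (nprod V a (int j) b) s v = 0"
  proof (rule goddard[where B="\<lambda>s v. (dif ^^ j) (H v) 0 s - nprod V (nprod V a (int j) b) s v"])
    show "lin (\<lambda>v. (dif ^^ j) (H v) 0 s - nprod V (nprod V a (int j) b) s v)" for s
      by (intro VV.linear_compose_sub dif_funpow_lin linH nprod_linear_right)
    show "(dif ^^ j) (H (vac V)) 0 s - nprod V (nprod V a (int j) b) s (vac V) = 0" for s
      by (simp add: vac)
    show "\<exists>\<kappa>. local_with (\<lambda>s v. (dif ^^ j) (H v) 0 s - nprod V (nprod V a (int j) b) s v) \<kappa> c"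
      if "c \<in> grade V g" for c g
      using local_with_diff[OF local_with_commutator[OF a b that, of j] local_with_nprod[OF nprod_grade[OF a b] that]]
      unfolding H_def by blast
  qed
  then show ?thesis by simp
qed

text \<open>Subtract the claimed expansion from the commutator: both have the same zeroth rows of
  differences, so \<open>dif_eq_zeroI\<close> applies. The bound is independent of r, s and v, and
  every larger number of terms is allowed, so that users may lengthen the sum.\<close>

lemma commutator_formula:
  assumes a: "a \<in> grade V p" and b: "b \<in> grade V q"
  obtains N0 where "\<And>N r s v. N \<ge> N0 \<Longrightarrow>
    nprod V a r (nprod V b s v) - smult V (koszul_sign p q) (nprod V b s (nprod V a r v))
      = (\<Sum>j<N. smult V (of_int r gchoose j) (nprod V (nprod V a (int j) b) (r + s - int j) v))"
proof -
  define H where "H = (\<lambda>v r s. nprod V a r (nprod V b s v) - smult V (koszul_sign p q) (nprod V b s (nprod V a r v)))"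
  obtain N0 where N0: "\<And>v. (dif ^^ N0) (H v) = (\<lambda>r s. 0)"
    using local_with_nprod[OF a b] by (auto simp: local_with_def H_def)
  have "H v r s = (\<Sum>j<N. smult V (of_int r gchoose j) (nprod V (nprod V a (int j) b) (r + s - int j) v))"
    if N: "N \<ge> N0" for N r s v
  proof -
    let ?y = "\<lambda>j t. nprod V (nprod V a (int j) b) t v"
    let ?K = "\<lambda>r s. H v r s - (\<Sum>j<N. smult V (of_int r gchoose j) (?y j (r + s - int j)))"
    have K: "(dif ^^ i) ?K = (\<lambda>r s. (dif ^^ i) (H v) r s -
       (\<Sum>j<N. if i \<le> j then smult V (of_int r gchoose (j - i)) (?y j (r + s - int (j - i))) else 0))" for i
      unfolding dif_funpow_diff dif_funpow_sum
      using dif_funpow_binomial_shift[of i _ "?y _"] by (simp only:)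
    have "?K = (\<lambda>r s. 0)"
    proof (rule dif_eq_zeroI)
      show "(dif ^^ N) ?K = (\<lambda>r s. 0)"
        unfolding K using dif_funpow_mono[OF N0 N, of v] by (auto simp: fun_eq_iff)
      fix i s assume i: "i < N"
      have "(\<Sum>j<N. if i \<le> j then smult V (of_int 0 gchoose (j - i)) (?y j (0 + s - int (j - i))) else 0)
        = (\<Sum>j<N. if j = i then ?y i s else 0)"
        by (rule sum.cong) (auto simp: gbinomial_0_left)
      also have "\<dots> = ?y i s" using i by simp
      finally show "(dif ^^ i) ?K 0 s = 0"
        unfolding K using commutator_difference[OF a b, of i v s] by (simp add: H_def)
    qed
    then show ?thesis by (simp add: fun_eq_iff)
  qed
  then show thesis using that unfolding H_def by blast
qed

end

section \<open>Symplectic invariants in a fermionic Fock space\<close>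

text \<open>With \<open>sg\<close> this describes \<open>symp_form n\<close>: its nonzero entries
  are \<open>sg n p\<close> at (p, \<open>dual n p\<close>).\<close>

definition dual :: "nat \<Rightarrow> nat \<Rightarrow> nat" where
  "dual n p = (if p < n then p + n else p - n)"

definition sg :: "nat \<Rightarrow> nat \<Rightarrow> complex" where
  "sg n p = (if p < n then 1 else - 1)"

lemma dual_less [simp]: "p < 2 * n \<Longrightarrow> dual n p < 2 * n"
  and dual_dual [simp]: "p < 2 * n \<Longrightarrow> dual n (dual n p) = p"
  and dual_neq: "p < 2 * n \<Longrightarrow> dual n p \<noteq> p"
  and sg_dual [simp]: "p < 2 * n \<Longrightarrow> sg n (dual n p) = - sg n p"
  by (auto simp: dual_def sg_def)

lemma sg_sq [simp]: "sg n p * sg n p = 1"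
  by (auto simp: sg_def)

lemma sg_sq' [simp]: "sg n p * (sg n p * z) = z"
  by (auto simp: sg_def)

lemma dual_eq_iff: "p < 2 * n \<Longrightarrow> q < 2 * n \<Longrightarrow> dual n q = p \<longleftrightarrow> q = dual n p"
  by auto

lemma sum_dual: "(\<Sum>p<2*n. f (dual n p)) = (\<Sum>p<2*n. f p)"
  by (rule sum.reindex_bij_witness[of _ "dual n" "dual n"]) auto

lemma (in vector_space) injective_endo_surj:
  assumes "finite B0" "subspace W" "W \<subseteq> span B0" "Vector_Spaces.linear scale scale E"
    "E ` W \<subseteq> W" "\<And>v. v \<in> W \<Longrightarrow> E v = 0 \<Longrightarrow> v = 0"
  shows "E ` W = W"
proof -
  interpret E: Vector_Spaces.linear scale scale E by fact
  obtain B where B: "B \<subseteq> W" "independent B" "W \<subseteq> span B"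
    by (rule maximal_independent_subset[of W])
  have "B \<subseteq> span B0" using B(1) assms(3) by (rule order_trans)
  then have fB: "finite B" using independent_span_bound[OF assms(1) B(2)] by simp
  have spB: "span B = W" using B assms(2) by (simp add: span_subspace)
  have inj: "inj_on E W"
    using E.inj_on_iff_eq_0[OF assms(2)] assms(6) by auto
  have ind: "independent (E ` B)"
    by (rule E.independent_injective_image[OF B(2)]) (use inj spB in simp)
  have "w \<in> E ` W" if w: "w \<in> W" for w
  proof (rule ccontr)
    assume "w \<notin> E ` W"
    then have "w \<notin> span (E ` B)" by (simp add: E.span_image spB)
    then have ind': "independent (insert w (E ` B))" and "w \<notin> E ` B"
      using ind by (auto simp: independent_insertI span_base)
    moreover have "card (E ` B) = card B"
      using inj B(1) by (meson card_image inj_on_subset)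
    ultimately have "card (insert w (E ` B)) = Suc (card B)" using fB by simp
    moreover have "insert w (E ` B) \<subseteq> span B" using w B assms(5) by blast
    ultimately show False
      using independent_span_bound[OF fB ind'] by simp
  qed
  with assms(5) show ?thesis by blast
qed

text \<open>
  The index \<open>p < 2 * n\<close> runs through a symplectic basis in which \<open>p\<close> is paired with \<open>dual n p\<close>; the
  elements of \<open>A\<close> are the remaining quantum numbers of a mode.
\<close>

locale fermi_fock = vector_space scale
  for scale :: "complex \<Rightarrow> 'v::ab_group_add \<Rightarrow> 'v" (infixr \<open>*s\<close> 75) +
  fixes A :: "'a set" and n :: nat
    and c d :: "'a \<Rightarrow> nat \<Rightarrow> 'v \<Rightarrow> 'v" and vac :: 'v and mon :: "('a \<times> nat) set \<Rightarrow> 'v"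
  assumes c_linear: "Vector_Spaces.linear scale scale (c \<alpha> p)"
    and d_linear: "Vector_Spaces.linear scale scale (d \<alpha> p)"
    and cc: "\<alpha> \<in> A \<Longrightarrow> \<beta> \<in> A \<Longrightarrow> p < 2 * n \<Longrightarrow> q < 2 * n \<Longrightarrow> c \<alpha> p (c \<beta> q v) = - c \<beta> q (c \<alpha> p v)"
    and dd: "\<alpha> \<in> A \<Longrightarrow> \<beta> \<in> A \<Longrightarrow> p < 2 * n \<Longrightarrow> q < 2 * n \<Longrightarrow> d \<alpha> p (d \<beta> q v) = - d \<beta> q (d \<alpha> p v)"
    and dc: "\<alpha> \<in> A \<Longrightarrow> \<beta> \<in> A \<Longrightarrow> p < 2 * n \<Longrightarrow> q < 2 * n \<Longrightarrow>
       d \<alpha> p (c \<beta> q v) = (if \<alpha> = \<beta> \<and> p = q then v else 0) - c \<beta> q (d \<alpha> p v)"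
    and d_vac: "\<alpha> \<in> A \<Longrightarrow> p < 2 * n \<Longrightarrow> d \<alpha> p vac = 0"
    and mon_empty: "mon {} = vac"
    and mon_insert: "\<alpha> \<in> A \<Longrightarrow> p < 2 * n \<Longrightarrow> finite S \<Longrightarrow> S \<subseteq> A \<times> {..<2 * n} \<Longrightarrow> (\<alpha>, p) \<notin> S \<Longrightarrow>
       c \<alpha> p (mon S) = mon (insert (\<alpha>, p) S) \<or> c \<alpha> p (mon S) = - mon (insert (\<alpha>, p) S)"
    and mon_inj: "inj_on mon {S. finite S \<and> S \<subseteq> A \<times> {..<2 * n}}"
    and mon_independent: "independent (mon ` {S. finite S \<and> S \<subseteq> A \<times> {..<2 * n}})"
    and mon_span: "span (mon ` {S. finite S \<and> S \<subseteq> A \<times> {..<2 * n}}) = UNIV"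
begin

abbreviation "lin \<equiv> Vector_Spaces.linear scale scale"

sublocale VV: vector_space_pair scale scale
  by unfold_locales

lemma c_add: "c \<alpha> p (x + y) = c \<alpha> p x + c \<alpha> p y"
  and c_diff: "c \<alpha> p (x - y) = c \<alpha> p x - c \<alpha> p y"
  and c_scale: "c \<alpha> p (k *s x) = k *s c \<alpha> p x"
  and c_sum: "c \<alpha> p (sum g J) = (\<Sum>j\<in>J. c \<alpha> p (g j))"
  and c_zero [simp]: "c \<alpha> p 0 = 0"
  and c_minus: "c \<alpha> p (- x) = - c \<alpha> p x"
proof -
  interpret L: Vector_Spaces.linear scale scale "c \<alpha> p" by (rule c_linear)
  show "c \<alpha> p (x + y) = c \<alpha> p x + c \<alpha> p y" by (rule L.add)
  show "c \<alpha> p (x - y) = c \<alpha> p x - c \<alpha> p y" by (rule L.diff)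
  show "c \<alpha> p (k *s x) = k *s c \<alpha> p x" by (rule L.scale)
  show "c \<alpha> p (sum g J) = (\<Sum>j\<in>J. c \<alpha> p (g j))" by (rule L.sum)
  show "c \<alpha> p 0 = 0" by (rule L.zero)
  show "c \<alpha> p (- x) = - c \<alpha> p x" by (rule L.neg)
qed

lemma d_add: "d \<alpha> p (x + y) = d \<alpha> p x + d \<alpha> p y"
  and d_diff: "d \<alpha> p (x - y) = d \<alpha> p x - d \<alpha> p y"
  and d_scale: "d \<alpha> p (k *s x) = k *s d \<alpha> p x"
  and d_sum: "d \<alpha> p (sum g J) = (\<Sum>j\<in>J. d \<alpha> p (g j))"
  and d_zero [simp]: "d \<alpha> p 0 = 0"
  and d_minus: "d \<alpha> p (- x) = - d \<alpha> p x"
proof -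
  interpret L: Vector_Spaces.linear scale scale "d \<alpha> p" by (rule d_linear)
  show "d \<alpha> p (x + y) = d \<alpha> p x + d \<alpha> p y" by (rule L.add)
  show "d \<alpha> p (x - y) = d \<alpha> p x - d \<alpha> p y" by (rule L.diff)
  show "d \<alpha> p (k *s x) = k *s d \<alpha> p x" by (rule L.scale)
  show "d \<alpha> p (sum g J) = (\<Sum>j\<in>J. d \<alpha> p (g j))" by (rule L.sum)
  show "d \<alpha> p 0 = 0" by (rule L.zero)
  show "d \<alpha> p (- x) = - d \<alpha> p x" by (rule L.neg)
qed

definition "M = A \<times> {..<2 * n}"
definition "Fin = {S. finite S \<and> S \<subseteq> M}"

lemma Fin_insert [simp]: "insert (\<alpha>, p) S \<in> Fin \<longleftrightarrow> \<alpha> \<in> A \<and> p < 2 * n \<and> S \<in> Fin"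
  and Fin_empty [simp]: "{} \<in> Fin"
  and Fin_Diff: "S \<in> Fin \<Longrightarrow> S - X \<in> Fin"
  by (auto simp: Fin_def M_def)

lemmas basis_facts = mon_inj[folded M_def Fin_def] mon_independent[folded M_def Fin_def] mon_span[folded M_def Fin_def]

lemma double_eq_zero: "x = - x \<Longrightarrow> x = (0::'v)"
proof -
  assume "x = - x"
  then have "x + x = 0" by (metis add.right_inverse)
  then have "2 *s x = 0" using scale_left_distrib[of 1 1 x] by simp
  then show "x = 0" by simp
qed

definition cf :: "('a \<times> nat) set \<Rightarrow> 'v \<Rightarrow> complex" where
  "cf S v = representation (mon ` Fin) v (mon S)"

lemma cf_add: "cf S (u + v) = cf S u + cf S v"
  and cf_scale: "cf S (k *s v) = k * cf S v"
  and cf_zero [simp]: "cf S 0 = 0"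
  and cf_minus: "cf S (- v) = - cf S v"
  using basis_facts(2,3)
  by (simp_all add: cf_def representation_add representation_scale representation_zero representation_neg)

lemma cf_sum: "cf S (sum g J) = (\<Sum>j\<in>J. cf S (g j))"
  by (induction J rule: infinite_finite_induct) (auto simp: cf_add)

lemma cf_mon: "S \<in> Fin \<Longrightarrow> S' \<in> Fin \<Longrightarrow> cf S (mon S') = (if S = S' then 1 else 0)"
  using basis_facts(1,2) by (auto simp: cf_def representation_basis dest: inj_onD)

lemma finite_supp: "finite {S \<in> Fin. cf S v \<noteq> 0}"
proof -
  have "finite {b. representation (mon ` Fin) v b \<noteq> 0}" by (rule finite_representation)
  moreover have "mon ` {S \<in> Fin. cf S v \<noteq> 0} \<subseteq> {b. representation (mon ` Fin) v b \<noteq> 0}"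
    by (auto simp: cf_def)
  moreover have "inj_on mon {S \<in> Fin. cf S v \<noteq> 0}"
    using basis_facts(1) by (rule inj_on_subset) auto
  ultimately show ?thesis by (meson finite_imageD finite_subset)
qed

lemma mon_induct:
  assumes "subspace P" "\<And>S. S \<in> Fin \<Longrightarrow> mon S \<in> P"
  shows "v \<in> P"
  using span_minimal[of "mon ` Fin" P] assms basis_facts(3) by blast

lemma cf_eq_zeroD: "(\<And>S. S \<in> Fin \<Longrightarrow> cf S v = 0) \<Longrightarrow> v = 0"
proof -
  assume *: "\<And>S. S \<in> Fin \<Longrightarrow> cf S v = 0"
  have "(\<Sum>b | representation (mon ` Fin) v b \<noteq> 0. representation (mon ` Fin) v b *s b) = v"
    by (rule sum_nonzero_representation_eq) (use basis_facts in auto)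
  moreover have "{b. representation (mon ` Fin) v b \<noteq> 0} = {}"
    using * representation_ne_zero[of "mon ` Fin" v] by (fastforce simp: cf_def)
  ultimately show "v = 0" by simp
qed

text \<open>The sign which \<open>mon_insert\<close> leaves open, recovered as a matrix
  coefficient.\<close>

definition eps :: "'a \<Rightarrow> nat \<Rightarrow> ('a \<times> nat) set \<Rightarrow> complex" where
  "eps \<alpha> p S = cf (insert (\<alpha>, p) S) (c \<alpha> p (mon S))"

lemma
  assumes "\<alpha> \<in> A" "p < 2 * n" "S \<in> Fin" "(\<alpha>, p) \<notin> S"
  shows c_mon: "c \<alpha> p (mon S) = eps \<alpha> p S *s mon (insert (\<alpha>, p) S)"
    and eps_sq: "eps \<alpha> p S * eps \<alpha> p S = 1"
    and eps_cnj: "cnj (eps \<alpha> p S) = eps \<alpha> p S"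
proof -
  have "c \<alpha> p (mon S) = mon (insert (\<alpha>, p) S) \<or> c \<alpha> p (mon S) = - mon (insert (\<alpha>, p) S)"
    using mon_insert assms by (auto simp: Fin_def M_def)
  then have "c \<alpha> p (mon S) = eps \<alpha> p S *s mon (insert (\<alpha>, p) S) \<and> eps \<alpha> p S * eps \<alpha> p S = 1 \<and> cnj (eps \<alpha> p S) = eps \<alpha> p S"
    using assms by (auto simp: eps_def cf_minus cf_mon)
  then show "c \<alpha> p (mon S) = eps \<alpha> p S *s mon (insert (\<alpha>, p) S)" "eps \<alpha> p S * eps \<alpha> p S = 1"
    "cnj (eps \<alpha> p S) = eps \<alpha> p S" by auto
qed

lemma mon_insert_eq:
  "\<alpha> \<in> A \<Longrightarrow> p < 2 * n \<Longrightarrow> S \<in> Fin \<Longrightarrow> (\<alpha>, p) \<notin> S \<Longrightarrow> mon (insert (\<alpha>, p) S) = eps \<alpha> p S *s c \<alpha> p (mon S)"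
  by (simp add: c_mon eps_sq)

lemma c_sq: "\<alpha> \<in> A \<Longrightarrow> p < 2 * n \<Longrightarrow> c \<alpha> p (c \<alpha> p v) = 0"
  by (rule double_eq_zero, rule cc)

lemma c_mon_0:
  assumes "\<alpha> \<in> A" "p < 2 * n" "S \<in> Fin" "(\<alpha>, p) \<in> S"
  shows "c \<alpha> p (mon S) = 0"
proof -
  have "mon (insert (\<alpha>, p) (S - {(\<alpha>, p)})) = eps \<alpha> p (S - {(\<alpha>, p)}) *s c \<alpha> p (mon (S - {(\<alpha>, p)}))"
    by (rule mon_insert_eq) (use assms Fin_Diff in auto)
  then show ?thesis using assms by (simp add: insert_absorb c_scale c_sq)
qed

lemma d_mon_0:
  assumes "\<alpha> \<in> A" "p < 2 * n" "S \<in> Fin" "(\<alpha>, p) \<notin> S"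
  shows "d \<alpha> p (mon S) = 0"
proof -
  have "finite S" using assms by (simp add: Fin_def)
  then show ?thesis using assms(3,4)
  proof (induction S)
    case empty then show ?case using assms by (simp add: mon_empty d_vac)
  next
    case (insert x S)
    obtain \<beta> q where x: "x = (\<beta>, q)" by force
    with insert have *: "\<beta> \<in> A" "q < 2 * n" "S \<in> Fin" "(\<beta>, q) \<notin> S" by auto
    then show ?case
      using insert assms by (auto simp: x mon_insert_eq d_scale dc)
  qed
qed

lemma d_mon:
  assumes "\<alpha> \<in> A" "p < 2 * n" "S \<in> Fin" "(\<alpha>, p) \<notin> S"
  shows "d \<alpha> p (mon (insert (\<alpha>, p) S)) = eps \<alpha> p S *s mon S"
  using assms by (simp add: mon_insert_eq d_scale dc d_mon_0)

subsection \<open>The inner product\<close>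

text \<open>The Hermitian form, antilinear on the left, in which the monomials are orthonormal.
  Restricting to the support of v makes the sum finite.\<close>

definition ip :: "'v \<Rightarrow> 'v \<Rightarrow> complex" where
  "ip u v = (\<Sum>S\<in>{S \<in> Fin. cf S v \<noteq> 0}. cnj (cf S u) * cf S v)"

lemma ip_superset:
  "finite F \<Longrightarrow> {S \<in> Fin. cf S v \<noteq> 0} \<subseteq> F \<Longrightarrow> F \<subseteq> Fin \<Longrightarrow> ip u v = (\<Sum>S\<in>F. cnj (cf S u) * cf S v)"
  unfolding ip_def by (rule sum.mono_neutral_left) auto

lemma ip_commute: "ip u v = cnj (ip v u)"
proof -
  let ?F = "{S \<in> Fin. cf S v \<noteq> 0} \<union> {S \<in> Fin. cf S u \<noteq> 0}"
  have F: "finite ?F" "?F \<subseteq> Fin" using finite_supp by auto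
  show ?thesis
    by (subst (1 2) ip_superset[where F="?F"]) (use F in \<open>auto simp: mult.commute\<close>)
qed

lemma ip_add_left: "ip (u + w) v = ip u v + ip w v"
  and ip_scale_left: "ip (k *s u) v = cnj k * ip u v"
  and ip_zero_left [simp]: "ip 0 v = 0"
  by (auto simp: ip_def cf_add cf_scale algebra_simps sum.distrib sum_distrib_left)

lemma ip_add_right: "ip v (u + w) = ip v u + ip v w"
  and ip_scale_right: "ip v (k *s u) = k * ip v u"
  and ip_zero_right [simp]: "ip v 0 = 0"
  using ip_commute[of v "u + w"] ip_commute[of v "k *s u"] ip_commute[of v u] ip_commute[of v w]
    ip_commute[of v 0] ip_add_left[of u w v] ip_scale_left[of k u v] by simp_all

lemma ip_sum_right: "ip v (sum g J) = (\<Sum>j\<in>J. ip v (g j))"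
  by (induction J rule: infinite_finite_induct) (auto simp: ip_add_right)

lemma ip_mon_left: "S \<in> Fin \<Longrightarrow> ip (mon S) v = cf S v"
proof -
  assume S: "S \<in> Fin"
  let ?F = "insert S {S \<in> Fin. cf S v \<noteq> 0}"
  have "ip (mon S) v = (\<Sum>S'\<in>?F. cnj (cf S' (mon S)) * cf S' v)"
    by (rule ip_superset) (use S finite_supp in auto)
  also have "\<dots> = (\<Sum>S'\<in>?F. if S' = S then cf S v else 0)"
    by (rule sum.cong) (use S in \<open>auto simp: cf_mon split: if_splits\<close>)
  also have "\<dots> = cf S v" using finite_supp[of v] by (subst sum.delta) auto
  finally show ?thesis .
qed

lemma ip_mon: "S \<in> Fin \<Longrightarrow> S' \<in> Fin \<Longrightarrow> ip (mon S) (mon S') = (if S = S' then 1 else 0)"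
  by (simp add: ip_mon_left cf_mon)

text \<open>On monomials, c and d insert and remove an index with the same real sign
  \<open>eps\<close>, so their matrices are transposes of each other.\<close>

lemma ip_c_left:
  assumes "\<alpha> \<in> A" "p < 2 * n"
  shows "ip (c \<alpha> p u) v = ip u (d \<alpha> p v)"
proof -
  let ?\<mu> = "(\<alpha>, p)"
  have basis: "ip (c \<alpha> p (mon S)) (mon S') = ip (mon S) (d \<alpha> p (mon S'))"
    if S: "S \<in> Fin" and S': "S' \<in> Fin" for S S'
  proof (cases "?\<mu> \<in> S'")
    case True
    then obtain S'' where S'': "S' = insert ?\<mu> S''" "?\<mu> \<notin> S''" by (meson mk_disjoint_insert)
    show ?thesis
    proof (cases "?\<mu> \<in> S")
      case True
      then have "S \<noteq> S''" using S'' by auto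
      then show ?thesis using True S S' S'' assms by (simp add: c_mon_0 d_mon ip_scale_right ip_mon)
    next
      case False
      then have "insert ?\<mu> S = S' \<longleftrightarrow> S = S''" using S'' by auto
      with False show ?thesis using S S' S'' assms
        by (auto simp: c_mon d_mon ip_scale_right ip_scale_left ip_mon eps_cnj)
    qed
  next
    case False
    then show ?thesis using S S' assms
      by (cases "?\<mu> \<in> S") (auto simp: c_mon_0 c_mon d_mon_0 ip_scale_left ip_mon)
  qed
  have 1: "ip (c \<alpha> p (mon S)) v = ip (mon S) (d \<alpha> p v)" if S: "S \<in> Fin" for S v
  proof -
    have "v \<in> {v. ip (c \<alpha> p (mon S)) v = ip (mon S) (d \<alpha> p v)}"
      by (rule mon_induct)
        (auto simp: subspace_def ip_add_right ip_scale_right d_add d_scale basis S)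
    then show ?thesis by simp
  qed
  have "u \<in> {u. ip (c \<alpha> p u) v = ip u (d \<alpha> p v)}"
    by (rule mon_induct) (auto simp: subspace_def ip_add_left ip_scale_left c_add c_scale 1)
  then show ?thesis by simp
qed

lemma ip_c_right: "\<alpha> \<in> A \<Longrightarrow> p < 2 * n \<Longrightarrow> ip u (c \<alpha> p v) = ip (d \<alpha> p u) v"
  using ip_c_left[of \<alpha> p v u] ip_commute[of u "c \<alpha> p v"] ip_commute[of "d \<alpha> p u" v] by simp

lemma ip_self: "ip v v = of_real (\<Sum>S\<in>{S \<in> Fin. cf S v \<noteq> 0}. (cmod (cf S v))\<^sup>2)"
  unfolding ip_def of_real_sum by (rule sum.cong, simp, subst complex_norm_square, simp)

lemma ip_self_nonneg: "Re (ip v v) \<ge> 0"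
  by (simp add: ip_self sum_nonneg)

lemma ip_self_eq_0: "Re (ip v v) = 0 \<Longrightarrow> v = 0"
proof -
  assume "Re (ip v v) = 0"
  then have "(\<Sum>S\<in>{S \<in> Fin. cf S v \<noteq> 0}. (cmod (cf S v))\<^sup>2) = 0"
    by (simp add: ip_self)
  then have "\<forall>S\<in>{S \<in> Fin. cf S v \<noteq> 0}. (cmod (cf S v))\<^sup>2 = 0"
    using finite_supp[of v] by (subst (asm) sum_nonneg_eq_0_iff) auto
  then show "v = 0" by (intro cf_eq_zeroD) auto
qed

end

lemma (in vector_space) span_linear_image:
  assumes "v \<in> span B" "Vector_Spaces.linear scale scale f" "subspace W" "\<And>x. x \<in> B \<Longrightarrow> f x \<in> W"
  shows "f v \<in> W"
proof -
  interpret f: Vector_Spaces.linear scale scale f by fact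
  have "span B \<subseteq> {x. f x \<in> W}"
    by (rule span_minimal) (use assms f.subspace_linear_preimage in auto)
  with assms(1) show ?thesis by auto
qed

section \<open>Quadratic invariants, the action of gl(2n) and a Casimir identity\<close>

context fermi_fock
begin

definition Om :: "'a \<Rightarrow> 'a \<Rightarrow> 'v \<Rightarrow> 'v" where
  "Om \<alpha> \<beta> v = (\<Sum>p<2*n. sg n p *s c \<alpha> p (c \<beta> (dual n p) v))"

definition De :: "'a \<Rightarrow> 'a \<Rightarrow> 'v \<Rightarrow> 'v" where
  "De \<alpha> \<beta> v = (\<Sum>p<2*n. sg n p *s d \<beta> (dual n p) (d \<alpha> p v))"

text \<open>The action of the matrix unit \<open>E\<^sub>r\<^sub>p\<close> of \<open>gl(2n)\<close> on the modes with indices in \<open>A0\<close>.\<close>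

definition eop :: "'a set \<Rightarrow> nat \<Rightarrow> nat \<Rightarrow> 'v \<Rightarrow> 'v" where
  "eop A0 r p v = (\<Sum>\<alpha>\<in>A0. c \<alpha> r (d \<alpha> p v))"

text \<open>Write E(r,p) for the matrix units. The elements E(r,p) - sg p sg r E(dual p, dual r)
  span sp(2n), so these are the vectors annihilated by sp(2n). The set \<open>A0\<close> is meant to
  be finite, so that \<open>eop\<close> is a genuine sum over its modes.\<close>

definition invs :: "'a set \<Rightarrow> 'v set" where
  "invs A0 = {v. \<forall>p<2*n. \<forall>r<2*n. eop A0 r p v = (sg n p * sg n r) *s eop A0 (dual n p) (dual n r) v}"

lemma invsD: "v \<in> invs A0 \<Longrightarrow> p < 2 * n \<Longrightarrow> r < 2 * n \<Longrightarrow>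
    eop A0 r p v = (sg n p * sg n r) *s eop A0 (dual n p) (dual n r) v"
  unfolding invs_def by blast

lemma lin_comp: "lin f \<Longrightarrow> lin g \<Longrightarrow> lin (\<lambda>x. f (g x))"
  using Vector_Spaces.linear_compose[of scale scale g scale f] by (simp add: o_def)

lemma Om_linear: "lin (Om \<alpha> \<beta>)"
  unfolding Om_def[abs_def]
  by (intro VV.linear_compose_sum ballI VV.linear_compose_scale_right lin_comp[OF c_linear] c_linear)

lemma De_linear: "lin (De \<alpha> \<beta>)"
  unfolding De_def[abs_def]
  by (intro VV.linear_compose_sum ballI VV.linear_compose_scale_right lin_comp[OF d_linear] d_linear)

lemma eop_linear: "lin (eop A0 r p)"
  unfolding eop_def[abs_def]
  by (intro VV.linear_compose_sum ballI lin_comp[OF c_linear] d_linear)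

lemma Om_add: "Om \<alpha> \<beta> (x + y) = Om \<alpha> \<beta> x + Om \<alpha> \<beta> y"
  and Om_diff: "Om \<alpha> \<beta> (x - y) = Om \<alpha> \<beta> x - Om \<alpha> \<beta> y"
  and Om_scale: "Om \<alpha> \<beta> (k *s x) = k *s Om \<alpha> \<beta> x"
  and Om_sum: "Om \<alpha> \<beta> (sum g J) = (\<Sum>j\<in>J. Om \<alpha> \<beta> (g j))"
  and Om_zero [simp]: "Om \<alpha> \<beta> 0 = 0"
proof -
  interpret L: Vector_Spaces.linear scale scale "Om \<alpha> \<beta>" by (rule Om_linear)
  show "Om \<alpha> \<beta> (x + y) = Om \<alpha> \<beta> x + Om \<alpha> \<beta> y" by (rule L.add)
  show "Om \<alpha> \<beta> (x - y) = Om \<alpha> \<beta> x - Om \<alpha> \<beta> y" by (rule L.diff)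
  show "Om \<alpha> \<beta> (k *s x) = k *s Om \<alpha> \<beta> x" by (rule L.scale)
  show "Om \<alpha> \<beta> (sum g J) = (\<Sum>j\<in>J. Om \<alpha> \<beta> (g j))" by (rule L.sum)
  show "Om \<alpha> \<beta> 0 = 0" by (rule L.zero)
qed

text \<open>Reindexing by \<open>dual\<close> changes \<open>sg\<close>, and exchanging two creation
  operators changes the sign once more.\<close>

lemma Om_sym:
  assumes "\<alpha> \<in> A" "\<beta> \<in> A"
  shows "Om \<alpha> \<beta> v = Om \<beta> \<alpha> v"
proof -
  have "Om \<alpha> \<beta> v = (\<Sum>p<2*n. sg n (dual n p) *s c \<alpha> (dual n p) (c \<beta> (dual n (dual n p)) v))"
    unfolding Om_def using sum_dual[of "\<lambda>p. sg n p *s c \<alpha> p (c \<beta> (dual n p) v)" n] by simp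
  also have "\<dots> = Om \<beta> \<alpha> v"
    unfolding Om_def by (rule sum.cong) (auto simp: assms cc[of \<alpha> \<beta>])
  finally show ?thesis .
qed

lemma c_Om:
  assumes "\<alpha> \<in> A" "\<beta> \<in> A" "\<gamma> \<in> A" "p < 2 * n"
  shows "c \<gamma> p (Om \<alpha> \<beta> v) = Om \<alpha> \<beta> (c \<gamma> p v)"
  unfolding Om_def c_sum c_scale
  by (rule sum.cong) (use assms in \<open>auto simp: cc[of \<gamma> \<alpha>] cc[of \<gamma> \<beta>] c_minus\<close>)

lemma Om_commute:
  assumes "\<alpha> \<in> A" "\<beta> \<in> A" "\<gamma> \<in> A" "\<delta> \<in> A"
  shows "Om \<alpha> \<beta> (Om \<gamma> \<delta> v) = Om \<gamma> \<delta> (Om \<alpha> \<beta> v)"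
proof -
  have "Om \<alpha> \<beta> (Om \<gamma> \<delta> v) = (\<Sum>p<2*n. sg n p *s c \<alpha> p (c \<beta> (dual n p) (Om \<gamma> \<delta> v)))"
    by (rule Om_def)
  also have "\<dots> = (\<Sum>p<2*n. sg n p *s Om \<gamma> \<delta> (c \<alpha> p (c \<beta> (dual n p) v)))"
    by (rule sum.cong) (auto simp: c_Om assms)
  also have "\<dots> = Om \<gamma> \<delta> (Om \<alpha> \<beta> v)"
    by (simp add: Om_def[of \<alpha>] Om_sum Om_scale)
  finally show ?thesis .
qed

lemma eop_c:
  assumes "finite A0" "A0 \<subseteq> A" "\<alpha> \<in> A0" "r < 2 * n" "p < 2 * n" "q < 2 * n"
  shows "eop A0 r p (c \<alpha> q v) = c \<alpha> q (eop A0 r p v) + (if p = q then c \<alpha> r v else 0)"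
proof -
  have *: "c \<beta> r (d \<beta> p (c \<alpha> q v)) = c \<alpha> q (c \<beta> r (d \<beta> p v)) + (if \<beta> = \<alpha> then if p = q then c \<alpha> r v else 0 else 0)"
    if "\<beta> \<in> A0" for \<beta>
    using that assms by (auto simp: dc c_diff cc[of \<beta> \<alpha>] subset_eq)
  have "eop A0 r p (c \<alpha> q v) = (\<Sum>\<beta>\<in>A0. c \<alpha> q (c \<beta> r (d \<beta> p v)) + (if \<beta> = \<alpha> then if p = q then c \<alpha> r v else 0 else 0))"
    unfolding eop_def using * by (rule sum.cong[OF refl])
  also have "\<dots> = c \<alpha> q (eop A0 r p v) + (if p = q then c \<alpha> r v else 0)"
    using assms unfolding eop_def c_sum sum.distrib sum.delta[OF assms(1)] by simp
  finally show ?thesis .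
qed

lemma eop_d:
  assumes "finite A0" "A0 \<subseteq> A" "\<alpha> \<in> A0" "r < 2 * n" "p < 2 * n" "q < 2 * n"
  shows "eop A0 r p (d \<alpha> q v) = d \<alpha> q (eop A0 r p v) - (if q = r then d \<alpha> p v else 0)"
proof -
  have *: "c \<beta> r (d \<beta> p (d \<alpha> q v)) = d \<alpha> q (c \<beta> r (d \<beta> p v)) - (if \<beta> = \<alpha> then if q = r then d \<alpha> p v else 0 else 0)"
    if "\<beta> \<in> A0" for \<beta>
    using that assms by (auto simp: dc[of \<alpha> \<beta> q r] c_minus dd[of \<beta> \<alpha>] subset_eq)
  have "eop A0 r p (d \<alpha> q v) = (\<Sum>\<beta>\<in>A0. d \<alpha> q (c \<beta> r (d \<beta> p v)) - (if \<beta> = \<alpha> then if q = r then d \<alpha> p v else 0 else 0))"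
    unfolding eop_def using * by (rule sum.cong[OF refl])
  also have "\<dots> = d \<alpha> q (eop A0 r p v) - (if q = r then d \<alpha> p v else 0)"
    using assms unfolding eop_def d_sum sum_subtractf sum.delta[OF assms(1)] by simp
  finally show ?thesis .
qed

lemma eop_add: "eop A0 r p (x + y) = eop A0 r p x + eop A0 r p y"
  and eop_scale: "eop A0 r p (k *s x) = k *s eop A0 r p x"
  and eop_sum: "eop A0 r p (sum g J) = (\<Sum>j\<in>J. eop A0 r p (g j))"
  and eop_zero [simp]: "eop A0 r p 0 = 0"
proof -
  interpret L: Vector_Spaces.linear scale scale "eop A0 r p" by (rule eop_linear)
  show "eop A0 r p (x + y) = eop A0 r p x + eop A0 r p y" by (rule L.add)
  show "eop A0 r p (k *s x) = k *s eop A0 r p x" by (rule L.scale)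
  show "eop A0 r p (sum g J) = (\<Sum>j\<in>J. eop A0 r p (g j))" by (rule L.sum)
  show "eop A0 r p 0 = 0" by (rule L.zero)
qed

lemma eop_Om:
  assumes A0: "finite A0" "A0 \<subseteq> A" "\<alpha> \<in> A0" "\<beta> \<in> A0" "r < 2 * n" "p < 2 * n"
  shows "eop A0 r p (Om \<alpha> \<beta> v) = Om \<alpha> \<beta> (eop A0 r p v)
     + sg n p *s (c \<alpha> r (c \<beta> (dual n p) v) - c \<alpha> (dual n p) (c \<beta> r v))"
proof -
  have "eop A0 r p (Om \<alpha> \<beta> v) = (\<Sum>q<2*n. sg n q *s c \<alpha> q (c \<beta> (dual n q) (eop A0 r p v))
      + (if q = p then sg n p *s c \<alpha> r (c \<beta> (dual n p) v) else 0)
      + (if q = dual n p then - sg n p *s c \<alpha> (dual n p) (c \<beta> r v) else 0))"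
    unfolding Om_def eop_sum eop_scale
    by (rule sum.cong) (use A0 in \<open>auto simp: eop_c c_add scale_right_distrib dual_eq_iff dual_neq dual_neq[symmetric]\<close>)
  then show ?thesis
    using A0 by (simp add: sum.distrib Om_def scale_right_diff_distrib)
qed

lemma eop_De:
  assumes A0: "finite A0" "A0 \<subseteq> A" "\<alpha> \<in> A0" "\<beta> \<in> A0" "r < 2 * n" "p < 2 * n"
  shows "eop A0 r p (De \<alpha> \<beta> v) = De \<alpha> \<beta> (eop A0 r p v)
     - sg n r *s (d \<beta> (dual n r) (d \<alpha> p v) - d \<beta> p (d \<alpha> (dual n r) v))"
proof -
  have "eop A0 r p (De \<alpha> \<beta> v) = (\<Sum>q<2*n. sg n q *s d \<beta> (dual n q) (d \<alpha> q (eop A0 r p v))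
      - (if q = r then sg n r *s d \<beta> (dual n r) (d \<alpha> p v) else 0)
      - (if q = dual n r then - sg n r *s d \<beta> p (d \<alpha> (dual n r) v) else 0))"
    unfolding De_def eop_sum eop_scale
    by (rule sum.cong) (use A0 in \<open>auto simp: eop_d d_diff scale_right_diff_distrib dual_eq_iff dual_neq dual_neq[symmetric]\<close>)
  then show ?thesis
    using A0 by (simp add: sum_subtractf De_def scale_right_diff_distrib)
qed

lemma subspace_invs: "subspace (invs A0)"
proof (rule subspaceI)
  show "0 \<in> invs A0" by (simp add: invs_def)
next
  fix x y assume xy: "x \<in> invs A0" "y \<in> invs A0"
  have "eop A0 r p (x + y) = (sg n p * sg n r) *s eop A0 (dual n p) (dual n r) (x + y)"
    if "p < 2 * n" "r < 2 * n" for p r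
    unfolding eop_add invsD[OF xy(1) that] invsD[OF xy(2) that] by (rule scale_right_distrib[symmetric])
  then show "x + y \<in> invs A0" unfolding invs_def by blast
next
  fix k x assume x: "x \<in> invs A0"
  have "eop A0 r p (k *s x) = (sg n p * sg n r) *s eop A0 (dual n p) (dual n r) (k *s x)"
    if "p < 2 * n" "r < 2 * n" for p r
    unfolding eop_scale invsD[OF x that] by (rule scale_left_commute)
  then show "k *s x \<in> invs A0" unfolding invs_def by blast
qed

lemma invs_Om:
  assumes A0: "finite A0" "A0 \<subseteq> A" "\<alpha> \<in> A0" "\<beta> \<in> A0" and v: "v \<in> invs A0"
  shows "Om \<alpha> \<beta> v \<in> invs A0"
  unfolding invs_def
proof (intro CollectI allI impI)
  fix p r assume pr: "p < 2 * n" "r < 2 * n"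
  have "eop A0 r p v = (sg n p * sg n r) *s eop A0 (dual n p) (dual n r) v"
    by (rule invsD[OF v pr])
  then show "eop A0 r p (Om \<alpha> \<beta> v) = (sg n p * sg n r) *s eop A0 (dual n p) (dual n r) (Om \<alpha> \<beta> v)"
    using pr by (simp add: eop_Om[OF A0] Om_scale scale_right_distrib scale_right_diff_distrib mult.assoc)
qed

lemma invs_De:
  assumes A0: "finite A0" "A0 \<subseteq> A" "\<alpha> \<in> A0" "\<beta> \<in> A0" and v: "v \<in> invs A0"
  shows "De \<alpha> \<beta> v \<in> invs A0"
  unfolding invs_def
proof (intro CollectI allI impI)
  fix p r assume pr: "p < 2 * n" "r < 2 * n"
  interpret L: Vector_Spaces.linear scale scale "De \<alpha> \<beta>" by (rule De_linear)
  have "eop A0 r p v = (sg n p * sg n r) *s eop A0 (dual n p) (dual n r) v"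
    by (rule invsD[OF v pr])
  then show "eop A0 r p (De \<alpha> \<beta> v) = (sg n p * sg n r) *s eop A0 (dual n p) (dual n r) (De \<alpha> \<beta> v)"
    using pr by (simp add: eop_De[OF A0] L.scale scale_right_distrib scale_right_diff_distrib
        mult.assoc mult.commute[of "sg n p" "sg n r"])
qed

lemma eop_vac: "A0 \<subseteq> A \<Longrightarrow> p < 2 * n \<Longrightarrow> eop A0 r p vac = 0"
  unfolding eop_def by (rule sum.neutral) (auto simp: d_vac)

lemma invs_vac: "A0 \<subseteq> A \<Longrightarrow> vac \<in> invs A0"
  by (auto simp: invs_def eop_vac)

definition cas :: "'a set \<Rightarrow> 'v \<Rightarrow> 'v" where
  "cas A0 v = (\<Sum>\<alpha>\<in>A0. \<Sum>\<beta>\<in>A0. Om \<alpha> \<beta> (De \<alpha> \<beta> v))"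

text \<open>Reordering each quartic term groups it into two \<open>eop\<close> factors. The
  contractions produced on the way add up to the number operator.\<close>

lemma cas_eq:
  assumes A0: "finite A0" "A0 \<subseteq> A"
  shows "cas A0 v = (\<Sum>p<2*n. \<Sum>r<2*n. (sg n p * sg n r) *s eop A0 p r (eop A0 (dual n p) (dual n r) v))
     + (\<Sum>p<2*n. eop A0 p p v)"
proof -
  \<comment> \<open>The contraction needs r = \<open>dual n p\<close>, where sg p sg r = -1; so it
    enters \<open>cas\<close> with a plus sign.\<close>
  have swap: "c \<alpha> p (c \<beta> (dual n p) (d \<beta> (dual n r) (d \<alpha> r v)))
     = c \<alpha> p (d \<alpha> r (c \<beta> (dual n p) (d \<beta> (dual n r) v)))
       - (if \<beta> = \<alpha> then if r = dual n p then c \<alpha> p (d \<alpha> p v) else 0 else 0)"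
    if "\<alpha> \<in> A0" "\<beta> \<in> A0" "p < 2 * n" "r < 2 * n" for \<alpha> \<beta> p r
    using that A0(2) by (auto simp: dc[of \<alpha> \<beta>] c_add c_diff c_minus subset_eq dd[of \<alpha> \<beta> r "dual n r"])
  have "cas A0 v = (\<Sum>\<alpha>\<in>A0. \<Sum>\<beta>\<in>A0. \<Sum>p<2*n. \<Sum>r<2*n. (sg n p * sg n r) *s
      c \<alpha> p (c \<beta> (dual n p) (d \<beta> (dual n r) (d \<alpha> r v))))"
    by (simp add: cas_def Om_def De_def c_sum c_scale scale_sum_right)
  also have "\<dots> = (\<Sum>\<alpha>\<in>A0. \<Sum>\<beta>\<in>A0. \<Sum>p<2*n. \<Sum>r<2*n. (sg n p * sg n r) *s
      c \<alpha> p (d \<alpha> r (c \<beta> (dual n p) (d \<beta> (dual n r) v)))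
      + (if \<beta> = \<alpha> then if r = dual n p then c \<alpha> p (d \<alpha> p v) else 0 else 0))"
    by (intro sum.cong refl) (auto simp: swap scale_right_diff_distrib)
  also have "\<dots> = (\<Sum>\<alpha>\<in>A0. \<Sum>\<beta>\<in>A0. \<Sum>p<2*n. \<Sum>r<2*n. (sg n p * sg n r) *s
      c \<alpha> p (d \<alpha> r (c \<beta> (dual n p) (d \<beta> (dual n r) v))))
      + (\<Sum>\<alpha>\<in>A0. \<Sum>\<beta>\<in>A0. \<Sum>p<2*n. \<Sum>r<2*n. if \<beta> = \<alpha> then if r = dual n p then c \<alpha> p (d \<alpha> p v) else 0 else 0)"
    by (simp only: sum.distrib)
  also have "(\<Sum>\<alpha>\<in>A0. \<Sum>\<beta>\<in>A0. \<Sum>p<2*n. \<Sum>r<2*n. if \<beta> = \<alpha> then if r = dual n p then c \<alpha> p (d \<alpha> p v) else 0 else 0)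
     = (\<Sum>\<alpha>\<in>A0. \<Sum>p<2*n. c \<alpha> p (d \<alpha> p v))"
  proof (intro sum.cong refl)
    fix \<alpha> assume \<alpha>: "\<alpha> \<in> A0"
    have "(\<Sum>\<beta>\<in>A0. \<Sum>p<2*n. \<Sum>r<2*n. if \<beta> = \<alpha> then if r = dual n p then c \<alpha> p (d \<alpha> p v) else 0 else 0)
      = (\<Sum>\<beta>\<in>A0. if \<beta> = \<alpha> then \<Sum>p<2*n. c \<alpha> p (d \<alpha> p v) else 0)"
      by (rule sum.cong) auto
    then show "(\<Sum>\<beta>\<in>A0. \<Sum>p<2*n. \<Sum>r<2*n. if \<beta> = \<alpha> then if r = dual n p then c \<alpha> p (d \<alpha> p v) else 0 else 0)
      = (\<Sum>p<2*n. c \<alpha> p (d \<alpha> p v))" using \<alpha> A0 by simp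
  qed
  also have "(\<Sum>\<alpha>\<in>A0. \<Sum>p<2*n. c \<alpha> p (d \<alpha> p v)) = (\<Sum>p<2*n. eop A0 p p v)"
    unfolding eop_def by (rule sum.swap)
  also have "(\<Sum>\<alpha>\<in>A0. \<Sum>\<beta>\<in>A0. \<Sum>p<2*n. \<Sum>r<2*n. (sg n p * sg n r) *s
      c \<alpha> p (d \<alpha> r (c \<beta> (dual n p) (d \<beta> (dual n r) v))))
    = (\<Sum>p<2*n. \<Sum>r<2*n. \<Sum>\<alpha>\<in>A0. \<Sum>\<beta>\<in>A0. (sg n p * sg n r) *s
      c \<alpha> p (d \<alpha> r (c \<beta> (dual n p) (d \<beta> (dual n r) v))))"
    by (subst (2) sum.swap, subst (3) sum.swap, subst (1) sum.swap, subst (2) sum.swap, rule refl)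
  also have "\<dots> = (\<Sum>p<2*n. \<Sum>r<2*n. (sg n p * sg n r) *s eop A0 p r (eop A0 (dual n p) (dual n r) v))"
    by (simp add: eop_def c_sum d_sum scale_sum_right)
  finally show ?thesis .
qed

text \<open>Invariance converts the inner factor to E(r,p), the adjoint of the outer factor E(p,r).
  The first sum thus becomes a sum of positive operators.\<close>

lemma cas_inv:
  assumes "finite A0" "A0 \<subseteq> A" "v \<in> invs A0"
  shows "cas A0 v = (\<Sum>p<2*n. \<Sum>r<2*n. eop A0 p r (eop A0 r p v)) + (\<Sum>p<2*n. eop A0 p p v)"
proof -
  have "(sg n p * sg n r) *s eop A0 (dual n p) (dual n r) v = eop A0 r p v" if "p < 2*n" "r < 2*n" for p r
    by (rule invsD[OF assms(3) that, symmetric])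
  then have "(sg n p * sg n r) *s eop A0 p r (eop A0 (dual n p) (dual n r) v) = eop A0 p r (eop A0 r p v)"
    if "p < 2*n" "r < 2*n" for p r
    using that by (simp only: eop_scale[symmetric])
  then show ?thesis by (simp add: cas_eq[OF assms(1,2)])
qed

section \<open>Positivity, the degree filtration and the first fundamental theorem\<close>

lemma ip_eop:
  assumes "A0 \<subseteq> A" "p < 2 * n" "r < 2 * n"
  shows "ip u (eop A0 p r v) = ip (eop A0 r p u) v"
proof -
  have "ip u (eop A0 p r v) = (\<Sum>\<alpha>\<in>A0. ip u (c \<alpha> p (d \<alpha> r v)))"
    by (simp add: eop_def ip_sum_right)
  also have "\<dots> = (\<Sum>\<alpha>\<in>A0. ip (c \<alpha> r (d \<alpha> p u)) v)"
    by (rule sum.cong) (use assms in \<open>auto simp: ip_c_right ip_c_left subset_eq\<close>)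
  also have "\<dots> = ip (eop A0 r p u) v"
    by (subst (1 2) ip_commute) (simp add: eop_def ip_sum_right)
  finally show ?thesis .
qed

text \<open>The strict bound makes \<open>fil A0 0\<close> zero, so lowering the degree with
  truncated subtraction remains correct down to k = 0.\<close>

definition fil :: "'a set \<Rightarrow> nat \<Rightarrow> 'v set" where
  "fil A0 k = span (mon ` {S. S \<subseteq> A0 \<times> {..<2 * n} \<and> card S < k})"

lemma fil_subspace: "subspace (fil A0 k)"
  by (simp add: fil_def)

lemma fil_mono: "A0 \<subseteq> A1 \<Longrightarrow> k \<le> l \<Longrightarrow> fil A0 k \<subseteq> fil A1 l"
  unfolding fil_def by (rule span_mono, rule image_mono) auto

lemma fil_0 [simp]: "fil A0 0 = {0}"
  by (simp add: fil_def)

lemma sub_Fin: "finite A0 \<Longrightarrow> A0 \<subseteq> A \<Longrightarrow> S \<subseteq> A0 \<times> {..<2 * n} \<Longrightarrow> S \<in> Fin"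
  by (auto simp: Fin_def M_def intro: finite_subset[of S "A0 \<times> {..<2 * n}"])

lemma d_fil:
  assumes A0: "finite A0" "A0 \<subseteq> A" and \<alpha>: "\<alpha> \<in> A0" "p < 2 * n" and v: "v \<in> fil A0 k"
  shows "d \<alpha> p v \<in> fil A0 (k - 1)"
  using v[unfolded fil_def] d_linear fil_subspace
proof (rule span_linear_image)
  fix x assume "x \<in> mon ` {S. S \<subseteq> A0 \<times> {..<2 * n} \<and> card S < k}"
  then obtain S where S: "x = mon S" "S \<subseteq> A0 \<times> {..<2 * n}" "card S < k" by auto
  have fS: "S \<in> Fin" using A0 S(2) by (rule sub_Fin)
  show "d \<alpha> p x \<in> fil A0 (k - 1)"
  proof (cases "(\<alpha>, p) \<in> S")
    case True
    then obtain S' where S': "S = insert (\<alpha>, p) S'" "(\<alpha>, p) \<notin> S'" by (meson mk_disjoint_insert)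
    then have f: "finite S'" "S' \<in> Fin" using fS by (auto simp: Fin_def)
    have "mon S' \<in> fil A0 (k - 1)"
      unfolding fil_def using S S' f by (intro span_base imageI) auto
    then show ?thesis using S S' f A0 \<alpha> by (auto simp: d_mon subset_eq intro: span_scale simp: fil_def)
  next
    case False
    then show ?thesis using S fS A0 \<alpha> subspace_0[OF fil_subspace] by (auto simp: d_mon_0 subset_eq)
  qed
qed

lemma c_fil:
  assumes A0: "finite A0" "A0 \<subseteq> A" and \<alpha>: "\<alpha> \<in> A0" "p < 2 * n" and v: "v \<in> fil A0 k"
  shows "c \<alpha> p v \<in> fil A0 (k + 1)"
  using v[unfolded fil_def] c_linear fil_subspace
proof (rule span_linear_image)
  fix x assume "x \<in> mon ` {S. S \<subseteq> A0 \<times> {..<2 * n} \<and> card S < k}"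
  then obtain S where S: "x = mon S" "S \<subseteq> A0 \<times> {..<2 * n}" "card S < k" by auto
  have fS: "S \<in> Fin" using A0 S(2) by (rule sub_Fin)
  show "c \<alpha> p x \<in> fil A0 (k + 1)"
  proof (cases "(\<alpha>, p) \<in> S")
    case False
    have "mon (insert (\<alpha>, p) S) \<in> fil A0 (k + 1)"
      unfolding fil_def using S \<alpha> fS False by (intro span_base imageI) (auto simp: Fin_def)
    then show ?thesis using S fS A0 \<alpha> False by (auto simp: c_mon subset_eq fil_def intro: span_scale)
  next
    case True
    then show ?thesis using S fS A0 \<alpha> subspace_0[OF fil_subspace] by (auto simp: c_mon_0 subset_eq)
  qed
qed

lemma De_fil:
  assumes "finite A0" "A0 \<subseteq> A" "\<alpha> \<in> A0" "\<beta> \<in> A0" "v \<in> fil A0 k"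
  shows "De \<alpha> \<beta> v \<in> fil A0 (k - 2)"
proof -
  have "d \<beta> (dual n p) (d \<alpha> p v) \<in> fil A0 (k - 2)" if "p < 2 * n" for p
    using d_fil[OF assms(1,2,4) dual_less d_fil[OF assms(1,2,3) _ assms(5)], OF that that]
    by (simp only: diff_diff_left one_add_one)
  then show ?thesis unfolding De_def by (intro subspace_sum subspace_scale fil_subspace) auto
qed

lemma Om_fil:
  assumes "finite A0" "A0 \<subseteq> A" "\<alpha> \<in> A0" "\<beta> \<in> A0" "v \<in> fil A0 k"
  shows "Om \<alpha> \<beta> v \<in> fil A0 (k + 2)"
proof -
  have "c \<alpha> p (c \<beta> (dual n p) v) \<in> fil A0 (k + 2)" if "p < 2 * n" for p
    using c_fil[OF assms(1,2,3) that c_fil[OF assms(1,2,4) dual_less[OF that] assms(5)]]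
    by (simp only: add.assoc one_add_one)
  then show ?thesis unfolding Om_def by (intro subspace_sum subspace_scale fil_subspace) auto
qed

lemma cas_fil:
  assumes "finite A0" "A0 \<subseteq> A" "v \<in> fil A0 k"
  shows "cas A0 v \<in> fil A0 k"
proof -
  have "Om \<alpha> \<beta> (De \<alpha> \<beta> v) \<in> fil A0 k" if "\<alpha> \<in> A0" "\<beta> \<in> A0" for \<alpha> \<beta>
  proof (cases "k \<ge> 2")
    case True
    then show ?thesis using Om_fil[OF assms(1,2) that De_fil[OF assms(1,2) that assms(3)]]
      by (simp only: le_add_diff_inverse2)
  next
    case False
    then show ?thesis using De_fil[OF assms(1,2) that assms(3)] by (simp add: fil_subspace subspace_0)
  qed
  then show ?thesis unfolding cas_def by (intro subspace_sum fil_subspace) auto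
qed

lemma cas_linear: "lin (cas A0)"
  unfolding cas_def[abs_def]
  by (intro VV.linear_compose_sum ballI lin_comp[OF Om_linear] De_linear)

lemma cf_fil_0: "finite A0 \<Longrightarrow> A0 \<subseteq> A \<Longrightarrow> v \<in> fil A0 k \<Longrightarrow> S \<in> Fin \<Longrightarrow> \<not> S \<subseteq> A0 \<times> {..<2 * n} \<Longrightarrow> cf S v = 0"
proof -
  assume a: "finite A0" "A0 \<subseteq> A" "v \<in> fil A0 k" "S \<in> Fin" "\<not> S \<subseteq> A0 \<times> {..<2 * n}"
  have "fil A0 k \<subseteq> {v. cf S v = 0}"
    unfolding fil_def
    by (rule span_minimal) (use a in \<open>auto simp: subspace_def cf_add cf_scale cf_mon sub_Fin split: if_splits\<close>)
  with a show ?thesis by auto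
qed

text \<open>A coefficient at a nonempty S is an inner product with some c applied to a smaller
  monomial; moving c across turns it into d applied to v.\<close>

lemma d_zero_imp:
  assumes A0: "finite A0" "A0 \<subseteq> A" and v: "v \<in> fil A0 k"
    and d: "\<And>\<alpha> p. \<alpha> \<in> A0 \<Longrightarrow> p < 2 * n \<Longrightarrow> d \<alpha> p v = 0" and 0: "cf {} v = 0"
  shows "v = 0"
proof (rule cf_eq_zeroD)
  fix S assume S: "S \<in> Fin"
  show "cf S v = 0"
  proof (cases "S \<subseteq> A0 \<times> {..<2 * n} \<and> S \<noteq> {}")
    case True
    then obtain \<alpha> p S' where S': "S = insert (\<alpha>, p) S'" "(\<alpha>, p) \<notin> S'" "\<alpha> \<in> A0" "p < 2 * n"
      by (metis ex_in_conv insert_Diff mem_Sigma_iff lessThan_iff subset_eq surj_pair Diff_iff insertI1)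
    then have f: "S' \<in> Fin" "\<alpha> \<in> A" using S A0 by (auto simp: Fin_def)
    have "cf S v = ip (mon S) v" using S by (simp add: ip_mon_left)
    also have "\<dots> = 0"
      using S' f d by (simp add: mon_insert_eq ip_scale_left ip_c_left)
    finally show ?thesis .
  next
    case False
    then show ?thesis using cf_fil_0[OF A0 v S] 0 by auto
  qed
qed

text \<open>\<open>cas\<close> kills the vacuum; adding the projection onto the vacuum line makes
  the operator injective on invariants.\<close>

definition cas' :: "'a set \<Rightarrow> 'v \<Rightarrow> 'v" where
  "cas' A0 v = cas A0 v + cf {} v *s vac"

text \<open>\<open>ip v (cas' A0 v)\<close> is a sum of squares, among them those of all d applied
  to v and of the vacuum coefficient of v; hence all of these vanish.\<close>

lemma cas'_eq_0:
  assumes A0: "finite A0" "A0 \<subseteq> A" and v: "v \<in> fil A0 k" "v \<in> invs A0" and 0: "cas' A0 v = 0"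
  shows "v = 0"
proof -
  have vac: "ip v vac = cnj (cf {} v)"
    using ip_commute[of v vac] ip_mon_left[of "{}" v] by (simp add: mon_empty)
  have eop: "ip v (eop A0 p p v) = (\<Sum>\<alpha>\<in>A0. ip (d \<alpha> p v) (d \<alpha> p v))" if "p < 2 * n" for p
    unfolding eop_def ip_sum_right by (rule sum.cong) (use that A0 in \<open>auto simp: ip_c_right subset_eq\<close>)
  have eop': "ip v (eop A0 p r (eop A0 r p v)) = ip (eop A0 r p v) (eop A0 r p v)" if "p < 2 * n" "r < 2 * n" for p r
    using that A0 by (simp add: ip_eop)
  have "0 = ip v (cas' A0 v)" using 0 by simp
  also have "\<dots> = (\<Sum>p<2*n. \<Sum>r<2*n. ip (eop A0 r p v) (eop A0 r p v))
      + (\<Sum>p<2*n. \<Sum>\<alpha>\<in>A0. ip (d \<alpha> p v) (d \<alpha> p v)) + cf {} v * cnj (cf {} v)"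
    using A0 by (simp add: cas'_def cas_inv[OF A0 v(2)] ip_add_right ip_scale_right ip_sum_right vac eop eop')
  also have "cf {} v * cnj (cf {} v) = of_real ((cmod (cf {} v))\<^sup>2)"
    by (rule complex_norm_square[symmetric])
  finally have eq: "0 = (\<Sum>p<2*n. \<Sum>r<2*n. ip (eop A0 r p v) (eop A0 r p v))
      + (\<Sum>p<2*n. \<Sum>\<alpha>\<in>A0. ip (d \<alpha> p v) (d \<alpha> p v)) + complex_of_real ((cmod (cf {} v))\<^sup>2)" .
  from arg_cong[OF eq, of Re] have "(\<Sum>p<2*n. \<Sum>r<2*n. Re (ip (eop A0 r p v) (eop A0 r p v)))
      + (\<Sum>p<2*n. \<Sum>\<alpha>\<in>A0. Re (ip (d \<alpha> p v) (d \<alpha> p v))) + (cmod (cf {} v))\<^sup>2 = 0"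
    by simp
  moreover have "(\<Sum>p<2*n. \<Sum>r<2*n. Re (ip (eop A0 r p v) (eop A0 r p v))) \<ge> 0"
    and nn: "(\<Sum>p<2*n. \<Sum>\<alpha>\<in>A0. Re (ip (d \<alpha> p v) (d \<alpha> p v))) \<ge> 0"
    by (intro sum_nonneg ip_self_nonneg)+
  ultimately have 1: "(\<Sum>p<2*n. \<Sum>\<alpha>\<in>A0. Re (ip (d \<alpha> p v) (d \<alpha> p v))) = 0" and 2: "(cmod (cf {} v))\<^sup>2 = 0"
    by (smt (verit) zero_le_power2)+
  show ?thesis
  proof (rule d_zero_imp[OF A0 v(1)])
    show "cf {} v = 0" using 2 by simp
    fix \<alpha> p assume "\<alpha> \<in> A0" "p < 2 * n"
    then have "Re (ip (d \<alpha> p v) (d \<alpha> p v)) = 0"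
      using 1 A0 by (simp add: sum_nonneg_eq_0_iff sum_nonneg ip_self_nonneg)
    then show "d \<alpha> p v = 0" by (rule ip_self_eq_0)
  qed
qed

definition OmL :: "('a \<times> 'a) list \<Rightarrow> 'v \<Rightarrow> 'v" where
  "OmL l v = foldr (\<lambda>b. Om (fst b) (snd b)) l v"

lemma OmL_simps [simp]: "OmL [] v = v" "OmL (b # l) v = Om (fst b) (snd b) (OmL l v)"
  "OmL (l @ l') v = OmL l (OmL l' v)"
  by (auto simp: OmL_def)

text \<open>On invariants, \<open>cas\<close> is the sum of a nonnegative operator and of the number operator; so
  every invariant of positive degree is a combination of products \<open>\<Omega> \<Delta> v\<close>.\<close>

theorem first_fundamental_theorem:
  assumes A0: "finite A0" "A0 \<subseteq> A" and v: "v \<in> fil A0 k" "v \<in> invs A0"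
  shows "v \<in> span {OmL l vac | l. set l \<subseteq> A0 \<times> A0}"
  using v
proof (induction k arbitrary: v rule: less_induct)
  case (less k)
  show ?case
  proof (cases "k = 0")
    case True
    then show ?thesis using less.prems by (simp add: span_zero)
  next
    case False
    let ?W = "fil A0 k \<inter> invs A0"
    have vac: "vac \<in> fil A0 k"
      unfolding fil_def using False by (intro span_base image_eqI[of _ _ "{}"]) (auto simp: mon_empty)
    have cf_lin: "lin (\<lambda>v. cf {} v *s vac)"
      by (simp add: Vector_Spaces.linear_iff vector_space_axioms cf_add cf_scale scale_left_distrib)
    \<comment> \<open>Injectivity on a finite-dimensional space gives a preimage u of v. Then v is a
      combination of the vacuum and of terms \<open>Om\<close> applied to \<open>De\<close> of u,
      and \<open>De\<close> lowers the degree by two.\<close>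
    have "cas' A0 ` ?W = ?W"
    proof (rule injective_endo_surj)
      show "finite (mon ` {S. S \<subseteq> A0 \<times> {..<2 * n} \<and> card S < k})"
        by (rule finite_imageI, rule finite_subset[of _ "Pow (A0 \<times> {..<2 * n})"]) (use A0 in auto)
      show "subspace ?W" by (intro subspace_inter fil_subspace subspace_invs)
      show "?W \<subseteq> span (mon ` {S. S \<subseteq> A0 \<times> {..<2 * n} \<and> card S < k})" by (auto simp: fil_def)
      show "lin (cas' A0)" unfolding cas'_def[abs_def]
        by (intro VV.linear_compose_add cas_linear cf_lin)
      have "cas A0 v \<in> invs A0" if "v \<in> invs A0" for v
        unfolding cas_def by (intro subspace_sum subspace_invs invs_Om[OF A0] invs_De[OF A0] that)
      then show "cas' A0 ` ?W \<subseteq> ?W"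
        unfolding cas'_def using vac A0
        by (auto intro!: subspace_add subspace_scale fil_subspace subspace_invs cas_fil invs_vac)
      show "v = 0" if "v \<in> ?W" "cas' A0 v = 0" for v
        using cas'_eq_0[OF A0] that by blast
    qed
    then obtain u where u: "u \<in> fil A0 k" "u \<in> invs A0" "v = cas' A0 u"
      using less.prems by blast
    let ?R = "span {OmL l vac | l. set l \<subseteq> A0 \<times> A0}"
    have "Om \<alpha> \<beta> (De \<alpha> \<beta> u) \<in> ?R" if ab: "\<alpha> \<in> A0" "\<beta> \<in> A0" for \<alpha> \<beta>
    proof -
      have "De \<alpha> \<beta> u \<in> ?R"
        using less.IH[of "k - 2" "De \<alpha> \<beta> u"] De_fil[OF A0 ab u(1)] invs_De[OF A0 ab u(2)] False by simp
      then show ?thesis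
      proof (rule span_linear_image[OF _ Om_linear subspace_span])
        fix x assume "x \<in> {OmL l vac | l. set l \<subseteq> A0 \<times> A0}"
        then obtain l where "x = OmL l vac" "set l \<subseteq> A0 \<times> A0" by blast
        then have "Om \<alpha> \<beta> x = OmL ((\<alpha>, \<beta>) # l) vac" "set ((\<alpha>, \<beta>) # l) \<subseteq> A0 \<times> A0" using ab by auto
        then show "Om \<alpha> \<beta> x \<in> ?R" by (intro span_base) blast
      qed
    qed
    moreover have "vac \<in> ?R" by (intro span_base) (auto intro!: exI[of _ "[]"])
    ultimately show ?thesis unfolding u(3) cas'_def cas_def
      by (intro span_add span_scale span_sum) auto
  qed
qed

lemma fil_exhaust: "\<exists>A0 k. finite A0 \<and> A0 \<subseteq> A \<and> v \<in> fil A0 k"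
proof -
  have "v \<in> {v. \<exists>A0 k. finite A0 \<and> A0 \<subseteq> A \<and> v \<in> fil A0 k}"
  proof (rule mon_induct)
    show "subspace {v. \<exists>A0 k. finite A0 \<and> A0 \<subseteq> A \<and> v \<in> fil A0 k}"
    proof (rule subspaceI)
      show "0 \<in> {v. \<exists>A0 k. finite A0 \<and> A0 \<subseteq> A \<and> v \<in> fil A0 k}"
        using subspace_0[OF fil_subspace[of "{}" 0]] by blast
      fix x y assume "x \<in> {v. \<exists>A0 k. finite A0 \<and> A0 \<subseteq> A \<and> v \<in> fil A0 k}" "y \<in> {v. \<exists>A0 k. finite A0 \<and> A0 \<subseteq> A \<and> v \<in> fil A0 k}"
      then obtain A0 k A1 l where *: "finite A0" "A0 \<subseteq> A" "x \<in> fil A0 k" "finite A1" "A1 \<subseteq> A" "y \<in> fil A1 l" by blast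
      have "x \<in> fil (A0 \<union> A1) (max k l)" "y \<in> fil (A0 \<union> A1) (max k l)"
        using fil_mono[of A0 "A0 \<union> A1" k "max k l"] fil_mono[of A1 "A0 \<union> A1" l "max k l"] * by auto
      then have "x + y \<in> fil (A0 \<union> A1) (max k l)" by (intro subspace_add fil_subspace)
      then show "x + y \<in> {v. \<exists>A0 k. finite A0 \<and> A0 \<subseteq> A \<and> v \<in> fil A0 k}" using * by blast
    next
      fix k x assume "x \<in> {v. \<exists>A0 k. finite A0 \<and> A0 \<subseteq> A \<and> v \<in> fil A0 k}"
      then show "k *s x \<in> {v. \<exists>A0 k. finite A0 \<and> A0 \<subseteq> A \<and> v \<in> fil A0 k}"
        using subspace_scale[OF fil_subspace] by blast
    qed
    fix S assume S: "S \<in> Fin"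
    have "mon S \<in> fil (fst ` S) (Suc (card S))"
      unfolding fil_def using S by (intro span_base imageI) (force simp: Fin_def M_def)
    moreover have "finite (fst ` S)" "fst ` S \<subseteq> A" using S by (auto simp: Fin_def M_def)
    ultimately show "mon S \<in> {v. \<exists>A0 k. finite A0 \<and> A0 \<subseteq> A \<and> v \<in> fil A0 k}"
      by blast
  qed
  then show ?thesis by simp
qed

end

context fermi_fock
begin

subsection \<open>Vanishing of long products in one colour\<close>

lemma c_word_repeat:
  assumes "\<alpha> \<in> A" "y < 2 * n" "set ys \<subseteq> {..<2 * n}"
  shows "c \<alpha> y (foldr (c \<alpha>) ys (c \<alpha> y u)) = 0"
  using assms(3) by (induction ys) (auto simp: assms c_sq cc[of \<alpha> \<alpha> y])

lemma c_word_zero: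
  assumes "\<alpha> \<in> A" "set ps \<subseteq> {..<2 * n}" "length ps > 2 * n"
  shows "foldr (c \<alpha>) ps w = 0"
proof -
  have "\<not> distinct ps"
    using assms card_mono[of "{..<2 * n}" "set ps"] by (auto dest: distinct_card)
  then obtain xs ys zs y where ps: "ps = xs @ [y] @ ys @ [y] @ zs"
    using not_distinct_decomp by blast
  have "foldr (c \<alpha>) xs 0 = 0" by (induction xs) auto
  then show ?thesis using c_word_repeat[of \<alpha> y ys "foldr (c \<alpha>) zs w"] assms by (simp add: ps)
qed

definition cwords :: "'a \<Rightarrow> nat \<Rightarrow> 'v set" where
  "cwords \<alpha> k = span {foldr (c \<alpha>) ps w | ps w. length ps = k \<and> set ps \<subseteq> {..<2 * n}}"

lemma Om_cwords:
  assumes "v \<in> cwords \<alpha> k"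
  shows "Om \<alpha> \<alpha> v \<in> cwords \<alpha> (k + 2)"
  using assms[unfolded cwords_def] Om_linear
proof (rule span_linear_image)
  show "subspace (cwords \<alpha> (k + 2))" by (simp add: cwords_def)
  fix x assume "x \<in> {foldr (c \<alpha>) ps w | ps w. length ps = k \<and> set ps \<subseteq> {..<2 * n}}"
  then obtain ps w where x: "x = foldr (c \<alpha>) ps w" "length ps = k" "set ps \<subseteq> {..<2 * n}" by blast
  have "c \<alpha> p (c \<alpha> (dual n p) x) \<in> {foldr (c \<alpha>) ps w | ps w. length ps = k + 2 \<and> set ps \<subseteq> {..<2 * n}}"
    if "p < 2 * n" for p
    using x that by (intro CollectI exI[of _ "p # dual n p # ps"] exI[of _ w]) auto
  then show "Om \<alpha> \<alpha> x \<in> cwords \<alpha> (k + 2)"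
    unfolding Om_def cwords_def by (intro span_sum span_scale span_base) auto
qed

text \<open>The product contains 2n + 1 creation operators of the single mode \<alpha>, which has
  only 2n different ones, and these anticommute and square to zero.\<close>

lemma Om_pow_zero:
  assumes "\<alpha> \<in> A"
  shows "(Om \<alpha> \<alpha> ^^ n) (Om \<alpha> \<beta> v) = 0"
proof -
  have "c \<alpha> p u \<in> cwords \<alpha> 1" if "p < 2 * n" for p u
    unfolding cwords_def by (rule span_base, rule CollectI, rule exI[of _ "[p]"]) (use that in auto)
  then have 1: "Om \<alpha> \<beta> v \<in> cwords \<alpha> 1"
    unfolding Om_def by (auto simp: cwords_def intro!: span_sum span_scale)
  have "(Om \<alpha> \<alpha> ^^ j) (Om \<alpha> \<beta> v) \<in> cwords \<alpha> (2 * j + 1)" for j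
  proof (induction j)
    case (Suc j)
    then show ?case using Om_cwords[OF Suc] by (simp add: numeral_2_eq_2)
  qed (use 1 in simp)
  from this[of n] have "(Om \<alpha> \<alpha> ^^ n) (Om \<alpha> \<beta> v) \<in> span {0}"
    unfolding cwords_def by (rule subsetD[OF span_mono, rotated]) (auto simp: c_word_zero[OF assms])
  then show ?thesis by simp
qed

subsection \<open>Functionals dual to the monomials of low degree\<close>

lemma cf_c: "\<alpha> \<in> A \<Longrightarrow> p < 2 * n \<Longrightarrow> cf {} (c \<alpha> p v) = 0"
  using ip_mon_left[of "{}" "c \<alpha> p v"] by (simp add: mon_empty ip_c_right d_vac)

text \<open>
  The \<open>s\<close>-th pair of \<open>l\<close> is tested on the hyperbolic plane of \<open>i + s\<close> and \<open>i + s + n\<close> only. The planes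
  are different as long as \<open>i + length l \<le> n\<close>, and then each factor of a monomial is hit by one test.
\<close>

definition AA :: "nat \<Rightarrow> 'a \<times> 'a \<Rightarrow> 'v \<Rightarrow> 'v" where
  "AA i b v = d (snd b) (i + n) (d (fst b) i v)"

fun Fn :: "nat \<Rightarrow> ('a \<times> 'a) list \<Rightarrow> 'v \<Rightarrow> complex" where
  "Fn i [] v = cf {} v"
| "Fn i (b # l) v = Fn (Suc i) l (AA i b v)"

lemma AA_add: "AA i b (x + y) = AA i b x + AA i b y"
  and AA_scale: "AA i b (k *s x) = k *s AA i b x"
  and AA_zero [simp]: "AA i b 0 = 0"
  by (simp_all add: AA_def d_add d_scale)

lemma Fn_add: "Fn i l (x + y) = Fn i l x + Fn i l y"
  by (induction l arbitrary: i x y) (auto simp: cf_add AA_add)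

lemma Fn_scale: "Fn i l (k *s x) = k * Fn i l x"
  by (induction l arbitrary: i x) (auto simp: cf_scale AA_scale)

lemma Fn_zero [simp]: "Fn i l 0 = 0"
  by (induction l arbitrary: i) auto

lemma Fn_sum: "Fn i l (sum g J) = (\<Sum>j\<in>J. Fn i l (g j))"
  by (induction J rule: infinite_finite_induct) (auto simp: Fn_add)

lemma OmL_add: "OmL l (x + y) = OmL l x + OmL l y"
  and OmL_scale: "OmL l (k *s x) = k *s OmL l x"
  and OmL_zero [simp]: "OmL l 0 = 0"
  by (induction l) (auto simp: Om_add Om_scale)

lemma c_OmL: "set l \<subseteq> A \<times> A \<Longrightarrow> \<gamma> \<in> A \<Longrightarrow> p < 2 * n \<Longrightarrow> c \<gamma> p (OmL l v) = OmL l (c \<gamma> p v)"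
  by (induction l) (auto simp: c_Om)

text \<open>The tests from i on use other planes, so the creation operator passes through all of
  them and meets the vacuum functional.\<close>

lemma Fn_c:
  assumes "set l \<subseteq> A \<times> A" "i + length l \<le> n" "\<alpha> \<in> A" "j < i" "p = j \<or> p = j + n"
  shows "Fn i l (c \<alpha> p v) = 0"
  using assms
proof (induction l arbitrary: i v)
  case Nil
  then show ?case by (auto intro!: cf_c)
next
  case (Cons b l)
  have "AA i b (c \<alpha> p v) = c \<alpha> p (AA i b v)"
    using Cons.prems by (auto simp: AA_def dc c_minus d_minus)
  then show ?case using Cons by simp
qed

lemma d_Om:
  assumes "\<alpha> \<in> A" "\<gamma> \<in> A" "\<delta> \<in> A" "q < 2 * n"
  shows "d \<alpha> q (Om \<gamma> \<delta> w) = Om \<gamma> \<delta> (d \<alpha> q w) + sg n q *s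
     ((if \<alpha> = \<gamma> then c \<delta> (dual n q) w else 0) + (if \<alpha> = \<delta> then c \<gamma> (dual n q) w else 0))"
proof -
  have "d \<alpha> q (Om \<gamma> \<delta> w) = (\<Sum>p<2*n. sg n p *s c \<gamma> p (c \<delta> (dual n p) (d \<alpha> q w))
     + (if p = q then if \<alpha> = \<gamma> then sg n q *s c \<delta> (dual n q) w else 0 else 0)
     + (if p = dual n q then if \<alpha> = \<delta> then sg n q *s c \<gamma> (dual n q) w else 0 else 0))"
    unfolding Om_def d_sum d_scale
    by (rule sum.cong) (use assms in \<open>auto simp: dc c_diff scale_right_diff_distrib scale_right_distrib
          dual_eq_iff dual_neq dual_neq[symmetric]\<close>)
  then show ?thesis
    using assms by (simp add: sum.distrib Om_def scale_right_distrib)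
qed

text \<open>Counts the orientations in which the test b contracts both ends of b'; it is 2 when b =
  b' has two equal components.\<close>

definition hits :: "'a \<times> 'a \<Rightarrow> 'a \<times> 'a \<Rightarrow> nat" where
  "hits b b' = (if b = b' then 1 else 0) + (if b = (snd b', fst b') then 1 else 0)"

abbreviation ups :: "'a \<times> 'a \<Rightarrow> 'a set" where "ups b \<equiv> {fst b, snd b}"

text \<open>The factors \<open>Om\<close> are symmetric and commute, so a monomial depends only on
  this multiset of unordered pairs.\<close>

abbreviation pm :: "('a \<times> 'a) list \<Rightarrow> 'a set multiset" where "pm l \<equiv> mset (map ups l)"

lemma hits_nonzero: "hits b b' \<noteq> 0 \<longleftrightarrow> ups b = ups b'"
  by (cases b; cases b') (auto simp: hits_def doubleton_eq_iff)

text \<open>The two annihilators of a test either both hit this factor, or both pass it. If only one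
  hits, a creation operator in the plane of i is left over, and \<open>Fn_c\<close> kills that
  term.\<close>

lemma Fn_AA_Om:
  assumes l: "set l \<subseteq> A \<times> A" "Suc i + length l \<le> n" and cs: "set cs \<subseteq> A \<times> A"
    and b: "b \<in> A \<times> A" "b' \<in> A \<times> A"
  shows "Fn (Suc i) l (OmL cs (AA i b (Om (fst b') (snd b') w)))
    = of_nat (hits b b') * Fn (Suc i) l (OmL cs w) + Fn (Suc i) l (OmL (cs @ [b']) (AA i b w))"
proof -
  obtain \<alpha> \<beta> \<gamma> \<delta> where bb: "b = (\<alpha>, \<beta>)" "b' = (\<gamma>, \<delta>)" by (metis surj_pair)
  have mem: "\<alpha> \<in> A" "\<beta> \<in> A" "\<gamma> \<in> A" "\<delta> \<in> A" using b bb by auto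
  have i: "i < 2 * n" "i + n < 2 * n" "dual n i = i + n" "dual n (i + n) = i" "sg n i = 1" "sg n (i + n) = - 1"
    using l by (auto simp: dual_def sg_def)
  have z: "Fn (Suc i) l (OmL cs (c \<mu> p u)) = 0" if "\<mu> \<in> A" "p = i \<or> p = i + n" for \<mu> p u
  proof -
    have "p < 2 * n" using that i by auto
    then have "OmL cs (c \<mu> p u) = c \<mu> p (OmL cs u)" using c_OmL[OF cs] that by simp
    then show ?thesis using Fn_c[OF l, of \<mu> i p] that by simp
  qed
  have "AA i b (Om \<gamma> \<delta> w) = Om \<gamma> \<delta> (AA i b w) + of_nat (hits b b') *s w
     + (- 1) *s (if \<beta> = \<gamma> then c \<delta> i (d \<alpha> i w) else 0) + (- 1) *s (if \<beta> = \<delta> then c \<gamma> i (d \<alpha> i w) else 0)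
     + (- 1) *s (if \<alpha> = \<gamma> then c \<delta> (i + n) (d \<beta> (i + n) w) else 0)
     + (- 1) *s (if \<alpha> = \<delta> then c \<gamma> (i + n) (d \<beta> (i + n) w) else 0)"
    using mem i scale_left_distrib[of 1 1 w]
    by (auto simp: AA_def bb d_Om d_add d_minus dc hits_def)
  moreover have zz: "Fn (Suc i) l (OmL cs (if P then c \<mu> p u else 0)) = 0" if "\<mu> \<in> A" "p = i \<or> p = i + n" for P \<mu> p u
    using z[OF that] by simp
  ultimately show ?thesis
    unfolding bb fst_conv snd_conv OmL_simps
    by (simp only: Fn_add Fn_scale OmL_add OmL_scale mult_zero_right add_0_right add_0_left OmL_simps fst_conv snd_conv
        zz[OF mem(3) disjI1[OF refl]] zz[OF mem(4) disjI1[OF refl]] zz[OF mem(3) disjI2[OF refl]] zz[OF mem(4) disjI2[OF refl]]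
        add.commute)
qed

text \<open>The value counts ways of matching tests with factors. Being a natural number, it leaves
  no room for cancellation: it is nonzero as soon as one matching exists.\<close>

lemma Fn_OmL:
  assumes "set l \<subseteq> A \<times> A" "i + length l \<le> n" "set \<nu> \<subseteq> A \<times> A"
  shows "\<exists>N. Fn i l (OmL \<nu> vac) = of_nat N \<and> (N \<noteq> 0 \<longleftrightarrow> pm l = pm \<nu>)"
  using assms
proof (induction l arbitrary: i \<nu>)
  case Nil
  show ?case
  proof (cases \<nu>)
    case Nil
    then show ?thesis using cf_mon[of "{}" "{}"] by (auto simp: mon_empty intro!: exI[of _ 1])
  next
    case (Cons b \<nu>')
    have "cf {} (OmL \<nu> vac) = 0"
      using Nil.prems Cons by (auto simp: Om_def cf_sum cf_scale cf_c)
    then show ?thesis using Cons by (intro exI[of _ 0]) simp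
  qed
next
  case (Cons b l)
  have l: "set l \<subseteq> A \<times> A" "Suc i + length l \<le> n" "b \<in> A \<times> A" using Cons.prems by auto
  \<comment> \<open>In this inner induction \<open>cs\<close> collects the factors that the current
    test has already passed.\<close>
  have "\<exists>N. Fn (Suc i) l (OmL cs (AA i b (OmL \<nu> vac))) = of_nat N \<and>
     (N \<noteq> 0 \<longleftrightarrow> ups b \<in># pm \<nu> \<and> pm l = pm cs + pm \<nu> - {#ups b#})" if "set cs \<subseteq> A \<times> A" "set \<nu> \<subseteq> A \<times> A" for cs \<nu>
    using that
  proof (induction \<nu> arbitrary: cs)
    case Nil
    have "AA i b vac = 0" using l by (auto simp: AA_def d_vac)
    then show ?case by (intro exI[of _ 0]) simp
  next
    case (Cons b' \<nu>)
    obtain N1 where N1: "Fn (Suc i) l (OmL (cs @ \<nu>) vac) = of_nat N1" "N1 \<noteq> 0 \<longleftrightarrow> pm l = pm (cs @ \<nu>)"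
      using \<open>\<And>i \<nu>. set l \<subseteq> A \<times> A \<Longrightarrow> i + length l \<le> n \<Longrightarrow> set \<nu> \<subseteq> A \<times> A \<Longrightarrow> _\<close>[of "Suc i" "cs @ \<nu>"] l Cons.prems by auto
    obtain N2 where N2: "Fn (Suc i) l (OmL (cs @ [b']) (AA i b (OmL \<nu> vac))) = of_nat N2"
      "N2 \<noteq> 0 \<longleftrightarrow> ups b \<in># pm \<nu> \<and> pm l = pm (cs @ [b']) + pm \<nu> - {#ups b#}"
      using Cons.IH[of "cs @ [b']"] Cons.prems by auto
    have "Fn (Suc i) l (OmL cs (AA i b (OmL (b' # \<nu>) vac))) = of_nat (hits b b' * N1 + N2)"
      using Fn_AA_Om[OF l(1,2) Cons.prems(1) l(3), of b' "OmL \<nu> vac"] Cons.prems N1(1) N2(1) by simp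
    moreover have "hits b b' * N1 + N2 \<noteq> 0 \<longleftrightarrow> ups b \<in># pm (b' # \<nu>) \<and> pm l = pm cs + pm (b' # \<nu>) - {#ups b#}"
    proof (cases "ups b = ups b'")
      case True
      then show ?thesis using N1(2) N2(2) hits_nonzero[of b b'] by auto
    next
      case False
      then show ?thesis using N2(2) hits_nonzero[of b b'] by auto
    qed
    ultimately show ?case by blast
  qed
  from this[of "[]" \<nu>] obtain N where N: "Fn i (b # l) (OmL \<nu> vac) = of_nat N"
    "N \<noteq> 0 \<longleftrightarrow> ups b \<in># pm \<nu> \<and> pm l = pm \<nu> - {#ups b#}"
    using Cons.prems by auto
  have "x \<in># D \<and> C = D - {#x#} \<longleftrightarrow> add_mset x C = D" for x C and D :: "'a set multiset"
    by auto
  from this[of "ups b" "pm \<nu>" "pm l"]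
  have iff: "(ups b \<in># pm \<nu> \<and> pm l = pm \<nu> - {#ups b#}) = (pm (b # l) = pm \<nu>)"
    by (simp only: list.map mset.simps)
  show ?case by (rule exI[of _ N], rule conjI[OF N(1)], rule trans[OF N(2) iff])
qed

lemma Fn_single:
  assumes "b \<in> A \<times> A" "b' \<in> A \<times> A" "n \<ge> 1"
  shows "Fn 0 [b] (Om (fst b') (snd b') vac) = of_nat (hits b b')"
proof -
  have "fst b \<in> A" using assms(1) by auto
  then have "d (fst b) 0 vac = 0" using assms(3) by (simp add: d_vac)
  then have AA: "AA 0 b vac = 0" by (simp add: AA_def)
  have cf: "cf {} vac = 1" using cf_mon[of "{}" "{}"] by (simp add: mon_empty)
  have "Fn (Suc 0) [] (OmL [] (AA 0 b (Om (fst b') (snd b') vac)))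
    = of_nat (hits b b') * Fn (Suc 0) [] (OmL [] vac) + Fn (Suc 0) [] (OmL ([] @ [b']) (AA 0 b vac))"
    by (rule Fn_AA_Om) (use assms in auto)
  then show ?thesis by (simp add: AA cf)
qed

subsection \<open>From one-parameter groups to derivations\<close>

text \<open>For a polynomial p(t) of degree at most K+1, the combination p(2t) - 2^(K+1) p(t) has no
  top term and multiplies the i-th coefficient by the nonzero number 2^i - 2^(K+1).\<close>

lemma poly_vanish:
  assumes "\<And>t::complex. (\<Sum>i\<le>K. t ^ i *s u i) = 0" "i \<le> K"
  shows "u i = 0"
  using assms
proof (induction K arbitrary: u i)
  case 0
  then show ?case using "0.prems"(1)[of 1] by simp
next
  case (Suc K)
  have IH: "(2 ^ i - 2 ^ Suc K) *s u i = 0" if "i \<le> K" for i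
  proof (rule Suc.IH[OF _ that])
    fix t :: complex
    have "(\<Sum>i\<le>Suc K. ((2 * t) ^ i - 2 ^ Suc K * t ^ i) *s u i)
      = (\<Sum>i\<le>Suc K. (2 * t) ^ i *s u i) - 2 ^ Suc K *s (\<Sum>i\<le>Suc K. t ^ i *s u i)"
      by (simp only: scale_left_diff_distrib sum_subtractf scale_sum_right scale_scale)
    also have "\<dots> = 0" unfolding Suc.prems(1) by simp
    finally have "(\<Sum>i\<le>K. ((2 * t) ^ i - 2 ^ Suc K * t ^ i) *s u i) = 0"
      by (simp add: power_mult_distrib)
    then show "(\<Sum>i\<le>K. t ^ i *s ((2 ^ i - 2 ^ Suc K) *s u i)) = 0"
      by (simp add: power_mult_distrib algebra_simps)
  qed
  have "u i = 0" if "i \<le> K" for i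
  proof -
    have "(2::nat) ^ i \<noteq> 2 ^ Suc K" using that by (metis Suc_n_not_le_n one_less_numeral_iff power_inject_exp semiring_norm(76))
    then have "(2 ^ i - 2 ^ Suc K :: complex) \<noteq> 0" by (metis of_nat_eq_iff of_nat_numeral of_nat_power right_minus_eq)
    then show ?thesis using IH[OF that] scale_eq_0_iff by blast
  qed
  moreover have "u (Suc K) = 0"
    using Suc.prems(1)[of 1] calculation by simp
  ultimately show ?case using Suc.prems(2) le_SucE by blast
qed

text \<open>The operators act on creation operators by 1 + tX, so every orbit is polynomial in t and
  its linear coefficient is the derivation defined by X. For a fixed vector all coefficients of
  positive degree vanish.\<close>

lemma fixed_imp_derivation_zero:
  fixes \<rho> :: "complex \<Rightarrow> 'v \<Rightarrow> 'v" and X :: "nat \<Rightarrow> nat \<Rightarrow> complex"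
  assumes A0: "finite A0" "A0 \<subseteq> A"
    and lin: "\<And>t. lin (\<rho> t)" and vac: "\<And>t. \<rho> t vac = vac"
    and c: "\<And>t \<alpha> q v. \<alpha> \<in> A0 \<Longrightarrow> q < 2 * n \<Longrightarrow>
      \<rho> t (c \<alpha> q v) = c \<alpha> q (\<rho> t v) + t *s (\<Sum>s<2*n. X s q *s c \<alpha> s (\<rho> t v))"
    and v: "v \<in> fil A0 k" and fixd: "\<And>t. \<rho> t v = v"
  shows "(\<Sum>q<2*n. \<Sum>s<2*n. X s q *s eop A0 s q v) = 0"
proof -
  define eX where "eX = (\<lambda>v. \<Sum>q<2*n. \<Sum>s<2*n. X s q *s eop A0 s q v)"
  have eX_add: "eX (x + y) = eX x + eX y" for x y
    by (simp add: eX_def eop_add scale_right_distrib sum.distrib)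
  have eX_scale: "eX (a *s x) = a *s eX x" for a x
    by (simp add: eX_def eop_scale scale_sum_right mult.commute)
  have eX_c: "eX (c \<alpha> q v) = c \<alpha> q (eX v) + (\<Sum>s<2*n. X s q *s c \<alpha> s v)" if "\<alpha> \<in> A0" "q < 2 * n" for \<alpha> q v
  proof -
    have "eX (c \<alpha> q v) = (\<Sum>q'<2*n. (\<Sum>s<2*n. X s q' *s c \<alpha> q (eop A0 s q' v))
       + (if q' = q then \<Sum>s<2*n. X s q *s c \<alpha> s v else 0))"
      unfolding eX_def by (rule sum.cong) (use that A0 in \<open>auto simp: eop_c scale_right_distrib sum.distrib\<close>)
    then show ?thesis using that by (simp add: sum.distrib eX_def c_sum c_scale)
  qed
  \<comment> \<open>Polynomial orbits with prescribed constant and linear coefficients. Requiring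
    zeros beyond K gives u 1 its meaning also for K = 0.\<close>
  define good where "good = (\<lambda>v. \<exists>K u. (\<forall>i>K. u i = 0) \<and> u 0 = v \<and> u 1 = eX v \<and> (\<forall>t. \<rho> t v = (\<Sum>i\<le>K. t ^ i *s u i)))"
  have goodI: "good v" if "\<And>i. i > K \<Longrightarrow> u i = 0" "u 0 = v" "u 1 = eX v" "\<And>t. \<rho> t v = (\<Sum>i\<le>K. t ^ i *s u i)" for K u v
    using that unfolding good_def by blast
  have good_mon: "good (mon S)" if "finite S" "S \<subseteq> A0 \<times> {..<2 * n}" for S
    using that
  proof (induction S)
    case empty
    have "eX vac = 0" using A0 by (simp add: eX_def eop_vac)
    then show ?case by (intro goodI[where K=0 and u="\<lambda>i. if i = 0 then vac else 0"]) (auto simp: mon_empty vac)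
  next
    case (insert x S)
    obtain \<alpha> q where x: "x = (\<alpha>, q)" by force
    have \<alpha>: "\<alpha> \<in> A0" "q < 2 * n" "\<alpha> \<in> A" and S: "S \<in> Fin" using insert x A0 by (auto intro: sub_Fin)
    obtain K u where u: "\<And>i. i > K \<Longrightarrow> u i = 0" "u 0 = mon S" "u 1 = eX (mon S)"
      "\<And>t. \<rho> t (mon S) = (\<Sum>i\<le>K. t ^ i *s u i)" using insert unfolding good_def by auto
    let ?e = "eps \<alpha> q S"
    \<comment> \<open>The coefficients of the summand with the extra factor t, hence shifted by
      one.\<close>
    define w where "w = (\<lambda>i. case i of 0 \<Rightarrow> 0 | Suc j \<Rightarrow> (\<Sum>s<2*n. X s q *s c \<alpha> s (u j)))"
    have w: "w 0 = 0" "w (Suc j) = (\<Sum>s<2*n. X s q *s c \<alpha> s (u j))" for j by (auto simp: w_def)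
    have mi: "mon (insert x S) = ?e *s c \<alpha> q (mon S)"
      using mon_insert_eq[of \<alpha> q S] insert x \<alpha> S by simp
    show ?case
    proof (rule goodI[where K="Suc K" and u="\<lambda>i. ?e *s (c \<alpha> q (u i) + w i)"])
      show "?e *s (c \<alpha> q (u i) + w i) = 0" if "i > Suc K" for i
        using that u(1) by (cases i) (auto simp: w)
      show "?e *s (c \<alpha> q (u 0) + w 0) = mon (insert x S)" by (simp add: u(2) w mi)
      show "?e *s (c \<alpha> q (u 1) + w 1) = eX (mon (insert x S))"
        using \<alpha> by (simp add: u(2) u(3)[simplified] w(2)[of 0, simplified] mi eX_scale eX_c[simplified])
      fix t
      interpret R: Vector_Spaces.linear scale scale "\<rho> t" by (rule lin)
      have "(\<Sum>i\<le>Suc K. t ^ i *s w i) = t *s (\<Sum>s<2*n. X s q *s c \<alpha> s (\<rho> t (mon S)))"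
      proof -
        have "(\<Sum>i\<le>Suc K. t ^ i *s w i) = (\<Sum>i\<le>K. t ^ Suc i *s w (Suc i))"
          by (subst sum.atMost_Suc_shift) (simp add: w)
        also have "\<dots> = (\<Sum>s<2*n. \<Sum>i\<le>K. t ^ Suc i *s X s q *s c \<alpha> s (u i))"
          unfolding w(2) scale_sum_right by (rule sum.swap)
        also have "\<dots> = t *s (\<Sum>s<2*n. X s q *s c \<alpha> s (\<rho> t (mon S)))"
          by (simp add: u(4) c_sum c_scale scale_sum_right ac_simps)
        finally show ?thesis .
      qed
      moreover have "(\<Sum>i\<le>Suc K. t ^ i *s c \<alpha> q (u i)) = c \<alpha> q (\<rho> t (mon S))"
        by (simp add: u(1,4) c_sum c_scale)
      ultimately show "\<rho> t (mon (insert x S)) = (\<Sum>i\<le>Suc K. t ^ i *s ?e *s (c \<alpha> q (u i) + w i))"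
        using c[OF \<alpha>(1,2), of t "mon S"]
        by (simp only: mi R.scale scale_right_distrib sum.distrib scale_left_commute[of _ ?e] scale_sum_right[symmetric])
    qed
  qed
  have "fil A0 k \<subseteq> Collect good"
    unfolding fil_def
  proof (rule span_minimal)
    show "mon ` {S. S \<subseteq> A0 \<times> {..<2 * n} \<and> card S < k} \<subseteq> Collect good"
      using good_mon[OF finite_subset[of _ "A0 \<times> {..<2 * n}"]] A0 by blast
    show "subspace (Collect good)"
    proof (rule subspaceI)
      have "eX 0 = 0" using eX_scale[of 0 0] by simp
      moreover have "\<rho> t 0 = 0" for t using VV.linear_0[OF lin] .
      ultimately show "0 \<in> Collect good"
        by (auto intro!: goodI[where K=0 and u="\<lambda>i. 0"])
    next
      fix x y assume "x \<in> Collect good" "y \<in> Collect good"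
      then obtain K u L w where u: "\<And>i. i > K \<Longrightarrow> u i = 0" "u 0 = x" "u 1 = eX x" "\<And>t. \<rho> t x = (\<Sum>i\<le>K. t ^ i *s u i)"
        and w: "\<And>i. i > L \<Longrightarrow> w i = 0" "w 0 = y" "w 1 = eX y" "\<And>t. \<rho> t y = (\<Sum>i\<le>L. t ^ i *s w i)"
        unfolding good_def by auto
      have "good (x + y)"
      proof (rule goodI[where K="max K L" and u="\<lambda>i. u i + w i"])
        fix t
        interpret R: Vector_Spaces.linear scale scale "\<rho> t" by (rule lin)
        have "(\<Sum>i\<le>K. t ^ i *s u i) = (\<Sum>i\<le>max K L. t ^ i *s u i)"
          by (rule sum.mono_neutral_left) (auto simp: u(1))
        moreover have "(\<Sum>i\<le>L. t ^ i *s w i) = (\<Sum>i\<le>max K L. t ^ i *s w i)"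
          by (rule sum.mono_neutral_left) (auto simp: w(1))
        ultimately show "\<rho> t (x + y) = (\<Sum>i\<le>max K L. t ^ i *s (u i + w i))"
          by (simp add: R.add u(4) w(4) scale_right_distrib sum.distrib)
      qed (simp_all add: u[simplified] w[simplified] eX_add)
      then show "x + y \<in> Collect good" by simp
    next
      fix a x assume "x \<in> Collect good"
      then obtain K u where u: "\<And>i. i > K \<Longrightarrow> u i = 0" "u 0 = x" "u 1 = eX x" "\<And>t. \<rho> t x = (\<Sum>i\<le>K. t ^ i *s u i)"
        unfolding good_def by auto
      have "good (a *s x)"
      proof (rule goodI[where K=K and u="\<lambda>i. a *s u i"])
        fix t
        interpret R: Vector_Spaces.linear scale scale "\<rho> t" by (rule lin)
        show "\<rho> t (a *s x) = (\<Sum>i\<le>K. t ^ i *s a *s u i)"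
          by (simp add: R.scale u(4) scale_sum_right mult.commute)
      qed (simp_all add: u[simplified] eX_scale)
      then show "a *s x \<in> Collect good" by simp
    qed
  qed
  then have "good v" using v by blast
  then obtain K u where u: "\<And>i. i > K \<Longrightarrow> u i = 0" "u 0 = v" "u 1 = eX v" "\<And>t. \<rho> t v = (\<Sum>i\<le>K. t ^ i *s u i)"
    unfolding good_def by auto
  have "(\<Sum>i\<le>K. t ^ i *s (if i = 0 then 0 else u i)) = 0" for t
  proof -
    have "v = (\<Sum>i\<le>K. t ^ i *s u i)" by (rule trans[OF fixd[symmetric] u(4)])
    also have "\<dots> = (\<Sum>i\<le>K. (if i = 0 then v else 0) + t ^ i *s (if i = 0 then 0 else u i))"
      by (rule sum.cong) (auto simp: u(2))
    also have "\<dots> = v + (\<Sum>i\<le>K. t ^ i *s (if i = 0 then 0 else u i))"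
      by (simp add: sum.distrib)
    finally show ?thesis by simp
  qed
  from poly_vanish[OF this, of 1] have "u 1 = 0" using u(1)[of 1] by (cases "1 \<le> K") auto
  then show ?thesis by (simp add: u(3)[simplified] eX_def)
qed

end

section \<open>The symplectic fermion algebra as a Fock space\<close>

lemma distinct_count_list: "distinct l \<longleftrightarrow> (\<forall>x. count_list l x \<le> 1)"
proof (induction l)
  case (Cons a l)
  have "(\<forall>x. count_list (a # l) x \<le> 1) \<longleftrightarrow> count_list l a = 0 \<and> (\<forall>x. count_list l x \<le> 1)"
  proof
    assume *: "\<forall>x. count_list (a # l) x \<le> 1"
    have "count_list l a = 0" using *[rule_format, of a] by simp
    moreover have "count_list l x \<le> 1" for x using *[rule_format, of x] by (simp split: if_splits)
    ultimately show "count_list l a = 0 \<and> (\<forall>x. count_list l x \<le> 1)" by blast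
  qed auto
  then show ?case using Cons by (auto simp: count_list_0_iff)
qed simp

text \<open>Every mode of index -2-j is, up to a factorial, the mode of index -1 of a derivative. So
  the commutator formula writes the commutator as the (-1)-mode of a single vector, and evaluation
  on the vacuum identifies that vector.\<close>

lemma (in vertex_superalgebra) left_symmetric:
  assumes a: "a \<in> grade V 0" and b: "b \<in> grade V 0"
  shows "nprod V a (- 1) (nprod V b (- 1) v) - nprod V b (- 1) (nprod V a (- 1) v)
    = nprod V (nprod V a (- 1) b - nprod V b (- 1) a) (- 1) v"
proof -
  obtain N0 where N0: "\<And>N r s v. N \<ge> N0 \<Longrightarrow>
    nprod V a r (nprod V b s v) - smult V (koszul_sign 0 0) (nprod V b s (nprod V a r v))
      = (\<Sum>j<N. smult V (of_int r gchoose j) (nprod V (nprod V a (int j) b) (r + s - int j) v))"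
    using commutator_formula[OF a b] by blast
  define z where "z = (\<Sum>j<N0. smult V ((- 1 gchoose j) / fact (Suc j)) ((T ^^ Suc j) (nprod V a (int j) b)))"
  have *: "nprod V a (- 1) (nprod V b (- 1) v) - nprod V b (- 1) (nprod V a (- 1) v) = nprod V z (- 1) v" for v
  proof -
    have "nprod V ((T ^^ Suc j) (nprod V a (int j) b)) (- 1) v = smult V (fact (Suc j)) (nprod V (nprod V a (int j) b) (- 2 - int j) v)" for j
      using T_funpow_left[of "Suc j" "nprod V a (int j) b" 0 v] by simp
    then have "nprod V z (- 1) v = (\<Sum>j<N0. smult V (- 1 gchoose j) (nprod V (nprod V a (int j) b) (- 2 - int j) v))"
      unfolding z_def nprod_sum_left nprod_scale_left by (simp del: fact_Suc)
    then show ?thesis using N0[of N0 "- 1" "- 1" v] by (simp add: koszul_sign_def)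
  qed
  from *[of "vac V"] have "z = nprod V a (- 1) b - nprod V b (- 1) a" by (simp add: vac_creation)
  with * show ?thesis by simp
qed

context symplectic_fermion_algebra
begin

abbreviation "sb \<equiv> symp_basis n e f"

text \<open>The mode \<open>(j, k)\<close> stands for the \<open>k\<close>-th derivative in the copy \<open>j\<close>.\<close>

definition cr :: "nat \<times> nat \<Rightarrow> nat \<Rightarrow> 'v \<Rightarrow> 'v" where
  "cr \<alpha> p v = nprod V ((T ^^ snd \<alpha>) (sb (fst \<alpha>) p)) (- 1) v"

text \<open>Normalised to be dual to \<open>cr\<close>: for derivative order k the commutator
  contributes k + 1, the derivative in \<open>cr\<close> contributes k!, and the sign is that of
  \<open>sg n (dual n p)\<close>.\<close>

definition an :: "nat \<times> nat \<Rightarrow> nat \<Rightarrow> 'v \<Rightarrow> 'v" where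
  "an \<alpha> p v = smult V (- sg n p / fact (Suc (snd \<alpha>))) (nprod V (sb (fst \<alpha>) (dual n p)) (int (Suc (snd \<alpha>))) v)"

definition modes :: "(nat \<times> nat) set" where
  "modes = {1..m} \<times> UNIV"

lemma modes_iff [simp]: "\<alpha> \<in> modes \<longleftrightarrow> fst \<alpha> \<in> {1..m}"
  by (cases \<alpha>) (auto simp: modes_def)

lemma sb_odd: "j \<in> {1..m} \<Longrightarrow> p < 2 * n \<Longrightarrow> sb j p \<in> grade V 1"
  by (auto simp: symp_basis_def intro!: odd_e odd_f)

lemma sb_ope:
  assumes "j \<in> {1..m}" "k \<in> {1..m}" "p < 2 * n" "q < 2 * n" "r \<ge> 0"
  shows "nprod V (sb j p) r (sb k q) = (if r = 1 \<and> j = k \<and> q = dual n p then smult V (sg n p) (vac V) else 0)"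
  using assms
  by (auto simp: symp_basis_def dual_def sg_def ope_ee ope_ff ope_ef ope_fe)

lemma sb_commutator:
  assumes "j \<in> {1..m}" "k \<in> {1..m}" "p < 2 * n" "q < 2 * n"
  shows "nprod V (sb j p) r (nprod V (sb k q) s v) + nprod V (sb k q) s (nprod V (sb j p) r v)
    = (if r + s = 0 \<and> j = k \<and> q = dual n p then smult V (of_int r * sg n p) v else 0)"
proof -
  obtain N0 where N0: "\<And>N r s v. N \<ge> N0 \<Longrightarrow>
    nprod V (sb j p) r (nprod V (sb k q) s v) - smult V (koszul_sign 1 1) (nprod V (sb k q) s (nprod V (sb j p) r v))
      = (\<Sum>i<N. smult V (of_int r gchoose i) (nprod V (nprod V (sb j p) (int i) (sb k q)) (r + s - int i) v))"
    using commutator_formula[OF sb_odd[of j p] sb_odd[of k q]] assms by blast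
  \<comment> \<open>Only i = 1, the double pole, contributes; the length 2 ensures that it occurs in
    the sum.\<close>
  let ?N = "max N0 2"
  have "(\<Sum>i<?N. smult V (of_int r gchoose i) (nprod V (nprod V (sb j p) (int i) (sb k q)) (r + s - int i) v))
    = (\<Sum>i<?N. if i = 1 then (if r + s = 0 \<and> j = k \<and> q = dual n p then smult V (of_int r * sg n p) v else 0) else 0)"
    by (rule sum.cong) (use assms in \<open>auto simp: sb_ope nprod_scale_left vac_left\<close>)
  then show ?thesis using N0[of ?N r s v] by (simp add: koszul_sign_def)
qed

lemma cr_eq: "cr \<alpha> p v = smult V (fact (snd \<alpha>)) (nprod V (sb (fst \<alpha>) p) (- 1 - int (snd \<alpha>)) v)"
  using T_funpow_left[of "snd \<alpha>" "sb (fst \<alpha>) p" 0 v] by (simp add: cr_def)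

lemma cr_cr:
  assumes "\<alpha> \<in> modes" "\<beta> \<in> modes" "p < 2 * n" "q < 2 * n"
  shows "cr \<alpha> p (cr \<beta> q v) = - cr \<beta> q (cr \<alpha> p v)"
proof -
  have "nprod V (sb (fst \<alpha>) p) (- 1 - int (snd \<alpha>)) (nprod V (sb (fst \<beta>) q) (- 1 - int (snd \<beta>)) v)
    = - nprod V (sb (fst \<beta>) q) (- 1 - int (snd \<beta>)) (nprod V (sb (fst \<alpha>) p) (- 1 - int (snd \<alpha>)) v)"
    using sb_commutator[of "fst \<alpha>" "fst \<beta>" p q "- 1 - int (snd \<alpha>)" "- 1 - int (snd \<beta>)" v] assms
    by (simp add: eq_neg_iff_add_eq_0)
  then show ?thesis by (simp add: cr_eq nprod_scale_right mult.commute)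
qed

lemma an_an:
  assumes "\<alpha> \<in> modes" "\<beta> \<in> modes" "p < 2 * n" "q < 2 * n"
  shows "an \<alpha> p (an \<beta> q v) = - an \<beta> q (an \<alpha> p v)"
proof -
  have "nprod V (sb (fst \<alpha>) (dual n p)) (int (Suc (snd \<alpha>))) (nprod V (sb (fst \<beta>) (dual n q)) (int (Suc (snd \<beta>))) v)
    = - nprod V (sb (fst \<beta>) (dual n q)) (int (Suc (snd \<beta>))) (nprod V (sb (fst \<alpha>) (dual n p)) (int (Suc (snd \<alpha>))) v)"
    using sb_commutator[of "fst \<alpha>" "fst \<beta>" "dual n p" "dual n q" "int (Suc (snd \<alpha>))" "int (Suc (snd \<beta>))" v] assms
    by (simp add: eq_neg_iff_add_eq_0)
  then show ?thesis
    unfolding an_def nprod_scale_right by (simp only: scale_minus_right scale_scale mult.commute)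
qed

lemma sb_cr:
  assumes "j \<in> {1..m}" "\<beta> \<in> modes" "p < 2 * n" "q < 2 * n"
  shows "nprod V (sb j p) (int r) (cr \<beta> q v) = (if r = Suc (snd \<beta>) \<and> j = fst \<beta> \<and> q = dual n p
     then smult V (fact r * sg n p) v else 0) - cr \<beta> q (nprod V (sb j p) (int r) v)"
proof -
  have h: "nprod V (sb j p) (int r) (nprod V (sb (fst \<beta>) q) (- 1 - int (snd \<beta>)) v) = (if r = Suc (snd \<beta>) \<and> j = fst \<beta> \<and> q = dual n p
     then smult V (of_nat r * sg n p) v else 0) - nprod V (sb (fst \<beta>) q) (- 1 - int (snd \<beta>)) (nprod V (sb j p) (int r) v)"
    using sb_commutator[of j "fst \<beta>" p q "int r" "- 1 - int (snd \<beta>)" v] assms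
    by (simp add: eq_diff_eq)
  show ?thesis
    unfolding cr_eq nprod_scale_right h by (auto simp: scale_right_diff_distrib algebra_simps)
qed

lemma an_cr:
  assumes "\<alpha> \<in> modes" "\<beta> \<in> modes" "p < 2 * n" "q < 2 * n"
  shows "an \<alpha> p (cr \<beta> q v) = (if \<alpha> = \<beta> \<and> p = q then v else 0) - cr \<beta> q (an \<alpha> p v)"
proof -
  have scale: "cr \<beta> q (smult V k w) = smult V k (cr \<beta> q w)" for k w by (simp add: cr_def nprod_scale_right)
  have "(Suc (snd \<alpha>) = Suc (snd \<beta>) \<and> fst \<alpha> = fst \<beta> \<and> q = dual n (dual n p)) \<longleftrightarrow> \<alpha> = \<beta> \<and> p = q"
    using assms by (auto simp: prod_eq_iff)
  then have "nprod V (sb (fst \<alpha>) (dual n p)) (int (Suc (snd \<alpha>))) (cr \<beta> q v) =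
    (if \<alpha> = \<beta> \<and> p = q then smult V (fact (Suc (snd \<alpha>)) * sg n (dual n p)) v else 0)
     - cr \<beta> q (nprod V (sb (fst \<alpha>) (dual n p)) (int (Suc (snd \<alpha>))) v)"
    using sb_cr[of "fst \<alpha>" \<beta> "dual n p" q "Suc (snd \<alpha>)" v] assms by simp
  moreover have "sg n p * sg n (dual n p) = - 1"
    using assms(3) by simp
  ultimately show ?thesis
    unfolding an_def scale
    by (auto simp: scale_right_diff_distrib simp del: fact_Suc of_nat_Suc)
qed

text \<open>In \<open>pbw_index\<close> the order of the derivative is the last component of an index.\<close>

definition md :: "(nat \<times> nat) \<times> nat \<Rightarrow> (nat \<times> nat) \<times> nat" where
  "md \<mu> = ((fst (fst \<mu>), snd \<mu>), snd (fst \<mu>))"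

lemma md_md [simp]: "md (md \<mu>) = \<mu>"
  by (simp add: md_def)

lemma inj_md: "inj_on md S"
  by (rule inj_on_inverseI[of _ md]) simp

definition crs :: "((nat \<times> nat) \<times> nat) list \<Rightarrow> 'v" where
  "crs is = foldr (\<lambda>i. cr (fst (md i)) (snd (md i))) is (vac V)"

definition mon :: "((nat \<times> nat) \<times> nat) set \<Rightarrow> 'v" where
  "mon S = crs (sorted_list_of_set (md ` S))"

lemma crs_insort:
  assumes "set (x # is) \<subseteq> md ` (modes \<times> {..<2 * n})"
  shows "crs (x # is) = crs (insort x is) \<or> crs (x # is) = - crs (insort x is)"
  using assms
proof (induction "is")
  case (Cons y "is")
  obtain \<alpha> p \<beta> q where xy: "md x = (\<alpha>, p)" "md y = (\<beta>, q)" "\<alpha> \<in> modes" "\<beta> \<in> modes" "p < 2 * n" "q < 2 * n"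
    using Cons.prems by (auto simp del: modes_iff)
  have "crs (x # y # is) = - cr \<beta> q (crs (x # is))"
    using xy by (simp add: crs_def cr_cr[of \<alpha> \<beta>])
  moreover have "cr \<beta> q (- w) = - cr \<beta> q w" for w by (simp add: cr_def nprod_minus_right)
  moreover have "crs (x # is) = crs (insort x is) \<or> crs (x # is) = - crs (insort x is)"
    using Cons by auto
  ultimately show ?case using xy by (auto simp: crs_def)
qed auto

lemma wick_eq: "wick V a = nprod V a (- 1)"
  by (simp add: wick_def fun_eq_iff)

lemma pbw_eq: "pbw_monomial V (\<lambda>(j, p). sb j p) is = crs is"
  by (simp add: pbw_monomial_def wick_list_def crs_def foldr_map wick_eq cr_def[abs_def] md_def o_def case_prod_unfold)

text \<open>All generators are odd, so no factor repeats and a sorted index list is just a finite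
  set.\<close>

lemma pbw_index_eq:
  "pbw_index V ({1..m} \<times> {..<2 * n}) (\<lambda>(j, p). sb j p) =
     (\<lambda>S. sorted_list_of_set (md ` S)) ` {S. finite S \<and> S \<subseteq> modes \<times> {..<2 * n}}" (is "?L = ?R")
proof
  show "?L \<subseteq> ?R"
  proof
    fix l assume l: "l \<in> ?L"
    have cnt: "count_list l \<mu> \<le> 1" for \<mu>
    proof (cases "\<mu> \<in> set l")
      case True
      obtain j p k where \<mu>: "\<mu> = ((j, p), k)" by (metis surj_pair)
      have "(j, p) \<in> {1..m} \<times> {..<2 * n}" using True l \<mu> by (force simp: pbw_index_def)
      then have "sb j p \<in> grade V 1" by (auto intro: sb_odd)
      then show ?thesis using l \<mu> by (auto simp: pbw_index_def)
    qed (simp add: count_notin)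
    have "distinct l" unfolding distinct_count_list by (rule allI, rule cnt)
    then have "l = sorted_list_of_set (set l)" using l by (simp add: pbw_index_def sorted_list_of_set.idem_if_sorted_distinct)
    moreover have "set l = md ` md ` set l" by (simp add: image_image)
    moreover have "md ` set l \<subseteq> modes \<times> {..<2 * n}" using l by (force simp: pbw_index_def md_def)
    ultimately show "l \<in> ?R" by (intro image_eqI[of _ _ "md ` set l"]) auto
  qed
  show "?R \<subseteq> ?L"
  proof
    fix l assume "l \<in> ?R"
    then obtain S where S: "l = sorted_list_of_set (md ` S)" "finite S" "S \<subseteq> modes \<times> {..<2 * n}" by blast
    then have "distinct l" "sorted l" "set l = md ` S" by auto
    moreover have "count_list l \<mu> \<le> 1" for \<mu> using \<open>distinct l\<close> unfolding distinct_count_list by blast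
    ultimately show "l \<in> ?L" using S(3) by (force simp: pbw_index_def md_def)
  qed
qed

sublocale F: fermi_fock "smult V" modes n cr an "vac V" mon
proof (intro fermi_fock.intro fermi_fock_axioms.intro)
  show "vector_space (smult V)" by (rule vector_space_axioms)
  show "lin (cr \<alpha> p)" for \<alpha> p by (simp add: cr_def[abs_def] nprod_linear_right)
  show "lin (an \<alpha> p)" for \<alpha> p unfolding an_def[abs_def]
    by (intro VV.linear_compose_scale_right nprod_linear_right)
  show "an \<alpha> p (vac V) = 0" if "\<alpha> \<in> modes" "p < 2 * n" for \<alpha> p
    by (simp add: an_def vac_right)
  show "mon {} = vac V" by (simp add: mon_def crs_def)
  show "cr \<alpha> p (mon S) = mon (insert (\<alpha>, p) S) \<or> cr \<alpha> p (mon S) = - mon (insert (\<alpha>, p) S)"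
    if "\<alpha> \<in> modes" "p < 2 * n" "finite S" "S \<subseteq> modes \<times> {..<2 * n}" "(\<alpha>, p) \<notin> S" for \<alpha> p S
  proof -
    let ?l = "sorted_list_of_set (md ` S)"
    have nin: "md (\<alpha>, p) \<notin> md ` S" using that(5) by (metis imageE md_md)
    have "cr \<alpha> p (mon S) = crs (md (\<alpha>, p) # ?l)" by (simp add: mon_def crs_def)
    moreover have "mon (insert (\<alpha>, p) S) = crs (insort (md (\<alpha>, p)) ?l)"
      using that nin by (simp add: mon_def)
    moreover have "set (md (\<alpha>, p) # ?l) \<subseteq> md ` (modes \<times> {..<2 * n})"
      using that by (auto simp del: modes_iff)
    ultimately show ?thesis using crs_insort by metis
  qed
  have fr: "inj_on crs (pbw_index V ({1..m} \<times> {..<2 * n}) (\<lambda>(j, p). sb j p))"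
    "independent (crs ` pbw_index V ({1..m} \<times> {..<2 * n}) (\<lambda>(j, p). sb j p))"
    "span (crs ` pbw_index V ({1..m} \<times> {..<2 * n}) (\<lambda>(j, p). sb j p)) = UNIV"
    using free by (auto simp: freely_generated_def pbw_eq[abs_def])
  let ?F = "{S. finite S \<and> S \<subseteq> modes \<times> {..<2 * n}}"
  have "mon ` ?F = crs ` pbw_index V ({1..m} \<times> {..<2 * n}) (\<lambda>(j, p). sb j p)"
    by (simp only: pbw_index_eq image_image mon_def[abs_def])
  then show "independent (mon ` ?F)" "span (mon ` ?F) = UNIV" using fr by auto
  have "inj_on (\<lambda>S. sorted_list_of_set (md ` S)) ?F"
  proof (rule inj_onI)
    fix S S' assume "S \<in> ?F" "S' \<in> ?F" "sorted_list_of_set (md ` S) = sorted_list_of_set (md ` S')"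
    then have "md ` S = md ` S'" by (metis (no_types, lifting) finite_imageI mem_Collect_eq set_sorted_list_of_set)
    then show "S = S'" using inj_on_image_eq_iff[OF inj_md] by blast
  qed
  then show "inj_on mon ?F"
    using comp_inj_on[OF _ fr(1)[unfolded pbw_index_eq]] by (simp add: mon_def[abs_def] o_def)
qed (rule cr_cr an_an an_cr; assumption)+

abbreviation "Om \<equiv> F.Om"

subsection \<open>Translation and Wick multiplication by quadratic invariants\<close>

definition up :: "nat \<times> nat \<Rightarrow> nat \<times> nat" where
  "up \<alpha> = (fst \<alpha>, Suc (snd \<alpha>))"

lemma T_cr: "T (cr \<alpha> p v) = cr (up \<alpha>) p v + cr \<alpha> p (T v)"
proof -
  have "nprod V (T ((T ^^ snd \<alpha>) (sb (fst \<alpha>) p))) (- 1) v = nprod V ((T ^^ snd \<alpha>) (sb (fst \<alpha>) p)) (- 2) v"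
    by (simp add: nprod_T_left)
  then show ?thesis by (simp add: cr_def up_def T_nprod)
qed

lemma T_Om: "T (Om \<alpha> \<beta> v) = Om (up \<alpha>) \<beta> v + Om \<alpha> (up \<beta>) v + Om \<alpha> \<beta> (T v)"
  by (simp add: F.Om_def T_sum T_scale T_cr F.c_add scale_right_distrib sum.distrib)

definition qd :: "(nat \<times> nat) \<times> (nat \<times> nat) \<Rightarrow> 'v" where
  "qd b = Om (fst b) (snd b) (vac V)"

definition Lq :: "(nat \<times> nat) \<times> (nat \<times> nat) \<Rightarrow> 'v \<Rightarrow> 'v" where
  "Lq b v = nprod V (qd b) (- 1) v"

lemma cr_vac: "cr \<alpha> p (vac V) = (T ^^ snd \<alpha>) (sb (fst \<alpha>) p)"
  by (simp add: cr_def vac_creation)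

lemma wick_cr:
  "wick V ((T ^^ a) (sb j p)) ((T ^^ b) (sb k q)) = cr (j, a) p (cr (k, b) q (vac V))"
  unfolding cr_vac unfolding cr_def wick_def by simp

lemma sb_e: "p < n \<Longrightarrow> sb j p = e (Suc p) j"
  and sb_f: "sb j (n + p) = f (Suc p) j"
  by (simp_all add: symp_basis_def)

text \<open>The indices below n give the first Wick product of each summand. For the others,
  \<open>sg\<close> = -1 cancels against exchanging the two creation operators, which gives the
  second.\<close>

lemma omega_eq:
  assumes "j \<in> {1..m}" "k \<in> {1..m}"
  shows "omega V n e f j k a b = smult V (1 / 2) (qd ((j, a), (k, b)))"
proof -
  let ?g = "\<lambda>p. smult V (sg n p) (cr (j, a) p (cr (k, b) (dual n p) (vac V)))"
  have "qd ((j, a), (k, b)) = (\<Sum>p<n. ?g p) + (\<Sum>p<n. ?g (n + p))"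
    using sum.nat_group[of ?g n 2] sum.atLeastLessThan_concat[of 0 n "2 * n" ?g]
      sum.shift_bounds_nat_ivl[of ?g 0 n n]
    by (simp add: qd_def F.Om_def atLeast0LessThan add.commute mult_2)
  also have "(\<Sum>p<n. ?g (n + p)) = (\<Sum>p<n. cr (k, b) p (cr (j, a) (n + p) (vac V)))"
    by (rule sum.cong) (use assms in \<open>auto simp: sg_def dual_def cr_cr[of "(j, a)" "(k, b)"]\<close>)
  also have "(\<Sum>p<n. ?g p) + \<dots> = (\<Sum>p<n. ?g p + cr (k, b) p (cr (j, a) (n + p) (vac V)))"
    by (simp add: sum.distrib)
  also have "\<dots> = (\<Sum>i = 1..n. wick V ((T ^^ a) (e i j)) ((T ^^ b) (f i k))
               + wick V ((T ^^ b) (e i k)) ((T ^^ a) (f i j)))"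
    by (rule sum.reindex_bij_witness[of _ "\<lambda>i. i - 1" "\<lambda>p. p + 1"])
      (auto simp: sg_def dual_def wick_cr add.commute[of _ n] simp flip: sb_e sb_f)
  finally show ?thesis by (simp add: omega_def)
qed

lemma T_funpow_grade: "a \<in> grade V p \<Longrightarrow> (T ^^ k) a \<in> grade V p"
  by (induction k) (auto intro: T_grade)

lemma qd_even:
  assumes "b \<in> modes \<times> modes"
  shows "qd b \<in> grade V 0"
proof -
  have odd: "(T ^^ snd \<alpha>) (sb (fst \<alpha>) p) \<in> grade V 1" if "\<alpha> \<in> modes" "p < 2 * n" for \<alpha> p
    using that sb_odd T_funpow_grade by auto
  have "cr (fst b) p (cr (snd b) (dual n p) (vac V)) \<in> grade V (1 + 1)" if "p < 2 * n" for p
    unfolding cr_vac[of "snd b"] unfolding cr_def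
    by (rule nprod_grade; rule odd) (use assms that in auto)
  then show ?thesis unfolding qd_def F.Om_def
    by (intro subspace_sum subspace_scale grade_subspace) auto
qed

lemma sb_qd:
  assumes "g \<in> {1..m}" "j \<in> {1..m}" "k \<in> {1..m}" "r < 2 * n"
  shows "nprod V (sb g r) (int i) (qd ((j, a), (k, b)))
    = (if i = Suc a then if g = j then smult V (- fact (Suc a)) ((T ^^ b) (sb k r)) else 0 else 0)
    + (if i = Suc b then if g = k then smult V (- fact (Suc b)) ((T ^^ a) (sb j r)) else 0 else 0)"
proof -
  let ?h1 = "if i = Suc a then if g = j then smult V (- fact (Suc a)) ((T ^^ b) (sb k r)) else 0 else 0"
  let ?h2 = "if i = Suc b then if g = k then smult V (- fact (Suc b)) ((T ^^ a) (sb j r)) else 0 else 0"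
  have "nprod V (sb g r) (int i) (qd ((j, a), (k, b))) =
    (\<Sum>p<2*n. (if p = dual n r then ?h1 else 0) + (if p = r then ?h2 else 0))"
    unfolding qd_def F.Om_def nprod_sum_right nprod_scale_right fst_conv snd_conv
  proof (rule sum.cong[OF refl])
    fix p assume "p \<in> {..<2 * n}"
    then have p: "p < 2 * n" by simp
    have h: "nprod V (sb g r) (int i) (cr (j, a) p (cr (k, b) (dual n p) (vac V)))
     = (if i = Suc a \<and> g = j \<and> p = dual n r then smult V (fact i * sg n r) (cr (k, b) (dual n p) (vac V)) else 0)
       - (if i = Suc b \<and> g = k \<and> dual n p = dual n r then smult V (fact i * sg n r) (cr (j, a) p (vac V)) else 0)"
      using assms p by (simp add: sb_cr vac_right F.c_diff F.c_scale)
    have dd: "dual n p = dual n r \<longleftrightarrow> p = r" using p assms(4) by (metis dual_dual)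
    show "smult V (sg n p) (nprod V (sb g r) (int i) (cr (j, a) p (cr (k, b) (dual n p) (vac V))))
      = (if p = dual n r then ?h1 else 0) + (if p = r then ?h2 else 0)"
      unfolding h using assms p by (auto simp: dd cr_vac dual_neq dual_neq[symmetric] scale_right_diff_distrib algebra_simps simp del: fact_Suc)
  qed
  also have "\<dots> = ?h1 + ?h2"
    using assms(4) by (simp add: sum.distrib)
  finally show ?thesis .
qed

text \<open>The coefficient with which a Wick correction moves derivatives; its sign depends on a
  alone. It is what remains of the binomial coefficient and the factorials in
  \<open>mode_coefficient\<close>.\<close>

definition kp :: "nat \<Rightarrow> nat \<Rightarrow> complex" where
  "kp a l = (- 1) ^ a / of_nat (l + a + 2)"

lemma mode_coefficient:
  assumes "r < 2 * n"
  shows "smult V (fact l * (of_int (- 1 - int l) gchoose Suc a) * - fact (Suc a))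
      (nprod V ((T ^^ b) (sb k r)) (- 1 - int (l + a + 2)) v)
    = smult V (kp a l) (cr (k, a + b + l + 2) r v)"
proof -
  have "nprod V ((T ^^ b) (sb k r)) (- 1 - int (l + a + 2)) v
    = smult V (1 / fact (l + a + 2)) (cr (k, a + b + l + 2) r v)"
  proof -
    define N where "N = a + b + l + 2"
    have N: "l + a + 2 + b = N" "- 1 - int (l + a + 2) - int b = - 1 - int N" by (simp_all add: N_def)
    show ?thesis unfolding T_funpow_left cr_eq N N_def[symmetric] by simp
  qed
  moreover have "fact l * (of_int (- 1 - int l) gchoose Suc a) * - fact (Suc a) * (1 / fact (l + a + 2)) = kp a l"
  proof -
    have "(of_int (- 1 - int l) gchoose Suc a :: complex) = (- (of_nat (Suc l)) gchoose Suc a)"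
      by (simp add: add.commute)
    also have "\<dots> = (- 1) ^ Suc a * (of_nat (Suc l) + of_nat (Suc a) - 1 gchoose Suc a)"
      by (rule gbinomial_minus)
    also have "of_nat (Suc l) + of_nat (Suc a) - 1 = (of_nat (l + a + 1) :: complex)" by simp
    also have "(of_nat (l + a + 1) gchoose Suc a) = (of_nat ((l + a + 1) choose Suc a) :: complex)"
      by (rule binomial_gbinomial[symmetric])
    also have "\<dots> = fact (l + a + 1) / (fact (Suc a) * fact l)"
      using binomial_fact[of "Suc a" "l + a + 1", where ?'a=complex] by simp
    finally have "(of_int (- 1 - int l) gchoose Suc a :: complex) = (- 1) ^ Suc a * (fact (l + a + 1) / (fact (Suc a) * fact l))" .
    moreover have "fact (l + a + 2) = of_nat (l + a + 2) * (fact (l + a + 1) :: complex)"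
      by (simp add: eval_nat_numeral)
    moreover have "fact (Suc a) \<noteq> (0::complex)" "fact l \<noteq> (0::complex)" "fact (l + a + 1) \<noteq> (0::complex)"
      by (rule fact_nonzero)+
    ultimately show ?thesis
      by (simp add: kp_def divide_simps del: fact_Suc of_nat_Suc of_nat_add) (simp add: mult_ac)
  qed
  ultimately show ?thesis by simp
qed

text \<open>The field of a basis vector has with this quadratic only the poles of orders a + 2 and b
  + 2. Each contracts one end and leaves one creation operator, in the colour of the other end and
  of derivative order l + a + b + 2.\<close>

lemma Lq_cr:
  assumes "g \<in> {1..m}" "j \<in> {1..m}" "k \<in> {1..m}" "r < 2 * n"
  shows "Lq ((j, a), (k, b)) (cr (g, l) r v) = cr (g, l) r (Lq ((j, a), (k, b)) v)
     - (if g = j then smult V (kp a l) (cr (k, a + b + l + 2) r v) else 0)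
     - (if g = k then smult V (kp b l) (cr (j, a + b + l + 2) r v) else 0)"
proof -
  let ?q = "qd ((j, a), (k, b))"
  have q: "?q \<in> grade V 0" by (rule qd_even) (use assms in auto)
  obtain N0 where N0: "\<And>N s t v. N \<ge> N0 \<Longrightarrow>
    nprod V (sb g r) s (nprod V ?q t v) - smult V (koszul_sign 1 0) (nprod V ?q t (nprod V (sb g r) s v))
      = (\<Sum>i<N. smult V (of_int s gchoose i) (nprod V (nprod V (sb g r) (int i) ?q) (s + t - int i) v))"
    using commutator_formula[OF sb_odd[OF assms(1,4)] q] by blast
  let ?N = "max N0 (a + b + 2)" and ?s = "- 1 - int l"
  let ?h1 = "if g = j then smult V (kp a l) (cr (k, a + b + l + 2) r v) else 0"
  let ?h2 = "if g = k then smult V (kp b l) (cr (j, a + b + l + 2) r v) else 0"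
  have "smult V (fact l) (\<Sum>i<?N. smult V (of_int ?s gchoose i) (nprod V (nprod V (sb g r) (int i) ?q) (?s + - 1 - int i) v))
    = (\<Sum>i<?N. (if i = Suc a then ?h1 else 0) + (if i = Suc b then ?h2 else 0))"
    unfolding scale_sum_right
  proof (rule sum.cong[OF refl])
    fix i
    have s: "- 2 - int l - int (Suc x) = - 1 - int (Suc (Suc (l + x)))" for x by simp
    have "smult V (fact l) (smult V (of_int ?s gchoose i) (nprod V (if i = Suc a then if g = j then smult V (- fact (Suc a)) ((T ^^ b) (sb k r)) else 0 else 0) (?s + - 1 - int i) v))
      = (if i = Suc a then ?h1 else 0)"
      using mode_coefficient[OF assms(4), of l a b k v]
      by (auto simp: s nprod_scale_left nprod_minus_left mult.assoc simp del: fact_Suc of_nat_Suc)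
    moreover have "smult V (fact l) (smult V (of_int ?s gchoose i) (nprod V (if i = Suc b then if g = k then smult V (- fact (Suc b)) ((T ^^ a) (sb j r)) else 0 else 0) (?s + - 1 - int i) v))
      = (if i = Suc b then ?h2 else 0)"
      using mode_coefficient[OF assms(4), of l b a j v, unfolded add.commute[of b a]]
      by (auto simp: s nprod_scale_left nprod_minus_left mult.assoc simp del: fact_Suc of_nat_Suc)
    ultimately show "smult V (fact l) (smult V (of_int ?s gchoose i) (nprod V (nprod V (sb g r) (int i) ?q) (?s + - 1 - int i) v))
       = (if i = Suc a then ?h1 else 0) + (if i = Suc b then ?h2 else 0)"
      by (simp only: sb_qd[OF assms] nprod_add_left scale_right_distrib)
  qed
  also have "\<dots> = ?h1 + ?h2"
  proof -
    have "Suc a < ?N" "Suc b < ?N" by auto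
    then show ?thesis by (simp only: sum.distrib sum.delta finite_lessThan lessThan_iff if_True)
  qed
  finally have "smult V (fact l) (nprod V (sb g r) ?s (nprod V ?q (- 1) v) - nprod V ?q (- 1) (nprod V (sb g r) ?s v)) = ?h1 + ?h2"
    using N0[of ?N ?s "- 1" v] by (simp add: koszul_sign_def)
  then have "cr (g, l) r (nprod V ?q (- 1) v) - nprod V ?q (- 1) (cr (g, l) r v) = ?h1 + ?h2"
    by (simp add: cr_eq nprod_scale_right scale_right_diff_distrib)
  then show ?thesis unfolding Lq_def by (simp add: algebra_simps)
qed

lemma Lq_vac [simp]: "Lq b (vac V) = qd b"
  by (simp add: Lq_def vac_creation)

lemma Lq_linear: "lin (Lq b)"
  by (simp add: Lq_def[abs_def] nprod_linear_right)

lemma Lq_Om: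
  assumes "g \<in> {1..m}" "g' \<in> {1..m}" "j \<in> {1..m}" "k \<in> {1..m}"
  shows "Lq ((j, a), (k, b)) (Om (g, l) (g', l') v) = Om (g, l) (g', l') (Lq ((j, a), (k, b)) v)
     - (if g = j then smult V (kp a l) (Om (k, a + b + l + 2) (g', l') v) else 0)
     - (if g = k then smult V (kp b l) (Om (j, a + b + l + 2) (g', l') v) else 0)
     - (if g' = j then smult V (kp a l') (Om (g, l) (k, a + b + l' + 2) v) else 0)
     - (if g' = k then smult V (kp b l') (Om (g, l) (j, a + b + l' + 2) v) else 0)"
proof -
  have "Lq ((j, a), (k, b)) (Om (g, l) (g', l') v) =
    (\<Sum>p<2*n. smult V (sg n p) (cr (g, l) p (cr (g', l') (dual n p) (Lq ((j, a), (k, b)) v)))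
     - (if g = j then smult V (kp a l) (smult V (sg n p) (cr (k, a + b + l + 2) p (cr (g', l') (dual n p) v))) else 0)
     - (if g = k then smult V (kp b l) (smult V (sg n p) (cr (j, a + b + l + 2) p (cr (g', l') (dual n p) v))) else 0)
     - (if g' = j then smult V (kp a l') (smult V (sg n p) (cr (g, l) p (cr (k, a + b + l' + 2) (dual n p) v))) else 0)
     - (if g' = k then smult V (kp b l') (smult V (sg n p) (cr (g, l) p (cr (j, a + b + l' + 2) (dual n p) v))) else 0))"
    unfolding F.Om_def VV.linear_sum[OF Lq_linear] VV.linear_scale[OF Lq_linear]
  proof (rule sum.cong[OF refl])
    fix p assume "p \<in> {..<2 * n}"
    then have p: "p < 2 * n" "dual n p < 2 * n" by auto
    show "smult V (sg n p) (Lq ((j, a), k, b) (cr (g, l) p (cr (g', l') (dual n p) v))) =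
      smult V (sg n p) (cr (g, l) p (cr (g', l') (dual n p) (Lq ((j, a), (k, b)) v)))
     - (if g = j then smult V (kp a l) (smult V (sg n p) (cr (k, a + b + l + 2) p (cr (g', l') (dual n p) v))) else 0)
     - (if g = k then smult V (kp b l) (smult V (sg n p) (cr (j, a + b + l + 2) p (cr (g', l') (dual n p) v))) else 0)
     - (if g' = j then smult V (kp a l') (smult V (sg n p) (cr (g, l) p (cr (k, a + b + l' + 2) (dual n p) v))) else 0)
     - (if g' = k then smult V (kp b l') (smult V (sg n p) (cr (g, l) p (cr (j, a + b + l' + 2) (dual n p) v))) else 0)"
      using Lq_cr[OF assms(1,3,4) p(1), of a b l "cr (g', l') (dual n p) v"]
        Lq_cr[OF assms(2,3,4) p(2), of a b l' v]
      by (auto simp: F.c_diff F.c_scale scale_right_diff_distrib scale_left_commute[of _ "sg n p"] mult.commute)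
  qed
  also have "\<dots> = Om (g, l) (g', l') (Lq ((j, a), (k, b)) v)
     - (if g = j then smult V (kp a l) (Om (k, a + b + l + 2) (g', l') v) else 0)
     - (if g = k then smult V (kp b l) (Om (j, a + b + l + 2) (g', l') v) else 0)
     - (if g' = j then smult V (kp a l') (Om (g, l) (k, a + b + l' + 2) v) else 0)
     - (if g' = k then smult V (kp b l') (Om (g, l) (j, a + b + l' + 2) v) else 0)"
    by (simp add: sum_subtractf F.Om_def scale_sum_right del: scale_scale)
  finally show ?thesis .
qed

end

section \<open>Invariants of the symplectic group\<close>

text \<open>Transvections provide only the off-diagonal relations. The diagonal part of sp(2n) is
  obtained from commutators of opposite root vectors.\<close>

lemma (in fermi_fock) invsI:
  assumes A0: "finite A0" "A0 \<subseteq> A"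
    and v: "\<And>p r. p < 2 * n \<Longrightarrow> r < 2 * n \<Longrightarrow> r \<noteq> p \<Longrightarrow>
      eop A0 r p v = (sg n p * sg n r) *s eop A0 (dual n p) (dual n r) v"
  shows "v \<in> invs A0"
proof -
  have "eop A0 p p v = eop A0 (dual n p) (dual n p) v" if p: "p < 2 * n" for p
  proof -
    let ?q = "dual n p"
    \<comment> \<open>For the pair r, \<open>dual n r\<close> the hypothesis reads x = -x.\<close>
    have zero: "eop A0 r (dual n r) v = 0" if "r < 2 * n" for r
    proof -
      have "eop A0 r (dual n r) v = - eop A0 r (dual n r) v"
        using v[of "dual n r" r] that dual_neq[OF that] by (auto simp: )
      then show ?thesis by (rule double_eq_zero)
    qed
    \<comment> \<open>Computing E(p,q) E(q,p) v, with q = \<open>dual n p\<close>, also from the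
      commutation rules gives the difference of the two diagonal terms.\<close>
    have "0 = eop A0 p ?q (eop A0 ?q p v)" using zero[of ?q] p by simp
    also have "\<dots> = (\<Sum>\<alpha>\<in>A0. eop A0 p ?q (c \<alpha> ?q (d \<alpha> p v)))"
      by (simp add: eop_def[of A0 ?q p] eop_sum)
    also have "\<dots> = (\<Sum>\<alpha>\<in>A0. c \<alpha> p (d \<alpha> p v) - c \<alpha> ?q (d \<alpha> ?q v))"
      by (rule sum.cong) (use A0 p zero[OF p] in \<open>auto simp: eop_c eop_d c_minus\<close>)
    also have "\<dots> = eop A0 p p v - eop A0 ?q ?q v"
      by (simp add: sum_subtractf eop_def)
    finally show ?thesis by simp
  qed
  note diag = this
  have "eop A0 r p v = (sg n p * sg n r) *s eop A0 (dual n p) (dual n r) v"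
    if pr: "p < 2 * n" "r < 2 * n" for p r
  proof (cases "r = p")
    case True
    show ?thesis unfolding True sg_sq scale_one by (rule diag[OF pr(1)])
  next
    case False
    then show ?thesis by (rule v[OF pr])
  qed
  then show ?thesis unfolding invs_def by (intro CollectI allI impI)
qed

lemma symp_form_entry:
  "a < 2 * n \<Longrightarrow> b < 2 * n \<Longrightarrow> symp_form n $$ (a, b) = (if b = dual n a then sg n a else 0)"
  unfolding symp_form_def by (auto simp: dual_def sg_def)

lemma Sp_iff:
  "g \<in> carrier (Sp n) \<longleftrightarrow> g \<in> carrier_mat (2 * n) (2 * n) \<and>
    (\<forall>a<2*n. \<forall>b<2*n. (\<Sum>s<2*n. sg n s * g $$ (s, a) * g $$ (dual n s, b)) = (if b = dual n a then sg n a else 0))"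
proof (cases "g \<in> carrier_mat (2 * n) (2 * n)")
  case g: True
  note J = symp_form_carrier[of n]
  have entry: "(transpose_mat g * symp_form n * g) $$ (a, b) = (\<Sum>s<2*n. sg n s * g $$ (s, a) * g $$ (dual n s, b))"
    if ab: "a < 2 * n" "b < 2 * n" for a b
  proof -
    have 1: "(transpose_mat g * symp_form n) $$ (a, u) = sg n (dual n u) * g $$ (dual n u, a)" if u: "u < 2 * n" for u
    proof -
      have "(transpose_mat g * symp_form n) $$ (a, u) = (\<Sum>s<2*n. g $$ (s, a) * symp_form n $$ (s, u))"
        using g J ab u by (simp add: scalar_prod_def atLeast0LessThan)
      also have "\<dots> = (\<Sum>s<2*n. if s = dual n u then sg n (dual n u) * g $$ (dual n u, a) else 0)"
        by (rule sum.cong) (use u in \<open>auto simp: symp_form_entry\<close>)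
      also have "\<dots> = sg n (dual n u) * g $$ (dual n u, a)" using u by simp
      finally show ?thesis .
    qed
    have "(transpose_mat g * symp_form n * g) $$ (a, b)
      = (\<Sum>u<2*n. (transpose_mat g * symp_form n) $$ (a, u) * g $$ (u, b))"
    proof -
      define B where "B = transpose_mat g * symp_form n"
      have "B \<in> carrier_mat (2 * n) (2 * n)" using g J by (simp add: B_def)
      then show ?thesis using g ab unfolding B_def[symmetric] by (simp add: scalar_prod_def atLeast0LessThan)
    qed
    also have "\<dots> = (\<Sum>u<2*n. sg n (dual n u) * g $$ (dual n u, a) * g $$ (dual n (dual n u), b))"
      by (rule sum.cong) (auto simp: 1)
    also have "\<dots> = (\<Sum>s<2*n. sg n s * g $$ (s, a) * g $$ (dual n s, b))"
      by (rule sum_dual)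
    finally show ?thesis .
  qed
  have "B = symp_form n \<longleftrightarrow> (\<forall>a<2*n. \<forall>b<2*n. B $$ (a, b) = symp_form n $$ (a, b))"
    if "B \<in> carrier_mat (2 * n) (2 * n)" for B
    using that J by auto
  from this[of "transpose_mat g * symp_form n * g"]
  have "transpose_mat g * symp_form n * g = symp_form n \<longleftrightarrow>
    (\<forall>a<2*n. \<forall>b<2*n. (transpose_mat g * symp_form n * g) $$ (a, b) = symp_form n $$ (a, b))"
    using g J by simp
  also have "\<dots> \<longleftrightarrow> (\<forall>a<2*n. \<forall>b<2*n. (\<Sum>s<2*n. sg n s * g $$ (s, a) * g $$ (dual n s, b)) = (if b = dual n a then sg n a else 0))"
    by (intro all_cong1 imp_cong[OF refl]) (simp only: entry symp_form_entry)
  finally show ?thesis using g by (simp add: Sp_def)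
qed (simp add: Sp_def)

text \<open>Invariance of \<open>Om\<close> sums over the second index of both entries of g, whereas
  the definition of \<open>Sp\<close> sums over the first.\<close>

lemma Sp_transpose:
  assumes "g \<in> carrier (Sp n)"
  shows "transpose_mat g \<in> carrier (Sp n)"
proof -
  let ?N = "2 * n" and ?J = "symp_form n"
  note J = symp_form_carrier[of n]
  have g: "g \<in> carrier_mat ?N ?N" and gJ: "transpose_mat g * ?J * g = ?J"
    using assms by (auto simp: Sp_def)
  define h where "h = - ?J * transpose_mat g * ?J"
  have gt: "transpose_mat g \<in> carrier_mat ?N ?N" and mJ: "- ?J \<in> carrier_mat ?N ?N" and h: "h \<in> carrier_mat ?N ?N"
    using g J by (auto simp: h_def)
  have "h * g = - ?J * (transpose_mat g * ?J * g)"
    unfolding h_def using g gt J mJ by (simp add: assoc_mult_mat[of _ ?N ?N _ ?N _ ?N])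
  then have "h * g = 1\<^sub>m ?N" by (simp add: gJ symp_form_square)
  then have gh: "g * h = 1\<^sub>m ?N" using mat_mult_left_right_inverse[OF h g] by simp
  have JJ: "?J * - ?J = 1\<^sub>m ?N"
    using mat_mult_left_right_inverse[OF mJ J] symp_form_square by simp
  have "h * - ?J = - ?J * transpose_mat g * (?J * - ?J)"
    unfolding h_def using g gt J mJ by (simp add: assoc_mult_mat[of _ ?N ?N _ ?N _ ?N])
  then have hJ: "h * - ?J = - ?J * transpose_mat g" using JJ gt mJ by simp
  have "g * (h * - ?J) = - ?J"
    using gh g h mJ by (simp flip: assoc_mult_mat[of _ ?N ?N _ ?N _ ?N])
  then have "g * (- ?J * transpose_mat g) = - ?J" by (simp add: hJ)
  moreover have "g * (- ?J * transpose_mat g) = - (g * ?J * transpose_mat g)"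
    using g gt J by (simp add: assoc_mult_mat[of _ ?N ?N _ ?N _ ?N])
  ultimately have "g * ?J * transpose_mat g = ?J"
    by (metis uminus_uminus_mat)
  then show ?thesis using gt g by (simp add: Sp_def)
qed

locale sp_action = symplectic_fermion_algebra +
  fixes \<rho> :: "complex mat \<Rightarrow> 'a \<Rightarrow> 'a"
  assumes acts: "Sp_acts V m n e f \<rho>"
begin

lemma
  assumes "g \<in> carrier (Sp n)"
  shows rho_linear: "lin (\<rho> g)"
    and rho_vac: "\<rho> g (vac V) = vac V"
    and rho_nprod: "\<rho> g (nprod V a r b) = nprod V (\<rho> g a) r (\<rho> g b)"
    and rho_sb: "j \<in> {1..m} \<Longrightarrow> p < 2 * n \<Longrightarrow> \<rho> g (sb j p) = (\<Sum>q<2*n. smult V (g $$ (q, p)) (sb j q))"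
proof -
  have va: "vertex_automorphism V (\<rho> g)"
    and sb: "\<forall>j\<in>{1..m}. \<forall>p<2 * n. \<rho> g (sb j p) = (\<Sum>q<2 * n. smult V (g $$ (q, p)) (sb j q))"
    using acts assms unfolding Sp_acts_def by blast+
  show "lin (\<rho> g)" "\<rho> g (vac V) = vac V" "\<rho> g (nprod V a r b) = nprod V (\<rho> g a) r (\<rho> g b)"
    using va unfolding vertex_automorphism_def by blast+
  show "j \<in> {1..m} \<Longrightarrow> p < 2 * n \<Longrightarrow> \<rho> g (sb j p) = (\<Sum>q<2*n. smult V (g $$ (q, p)) (sb j q))"
    using sb by blast
qed

lemma
  assumes "g \<in> carrier (Sp n)"
  shows rho_add: "\<rho> g (x + y) = \<rho> g x + \<rho> g y"
    and rho_scale: "\<rho> g (smult V k x) = smult V k (\<rho> g x)"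
    and rho_sum: "\<rho> g (sum w J) = (\<Sum>j\<in>J. \<rho> g (w j))"
    and rho_zero: "\<rho> g 0 = 0"
proof -
  interpret L: Vector_Spaces.linear "smult V" "smult V" "\<rho> g" by (rule rho_linear[OF assms])
  show "\<rho> g (x + y) = \<rho> g x + \<rho> g y" by (rule L.add)
  show "\<rho> g (smult V k x) = smult V k (\<rho> g x)" by (rule L.scale)
  show "\<rho> g (sum w J) = (\<Sum>j\<in>J. \<rho> g (w j))" by (rule L.sum)
  show "\<rho> g 0 = 0" by (rule L.zero)
qed

lemma rho_T: "g \<in> carrier (Sp n) \<Longrightarrow> \<rho> g ((T ^^ k) a) = (T ^^ k) (\<rho> g a)"
  by (induction k) (auto simp: transl_def rho_nprod rho_vac)

lemma T_funpow_sum: "(T ^^ k) (\<Sum>q\<in>J. smult V (w q) (u q)) = (\<Sum>q\<in>J. smult V (w q) ((T ^^ k) (u q)))"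
  by (induction k) (auto simp: T_sum T_scale)

lemma rho_cr:
  assumes "g \<in> carrier (Sp n)" "\<alpha> \<in> modes" "p < 2 * n"
  shows "\<rho> g (cr \<alpha> p v) = (\<Sum>q<2*n. smult V (g $$ (q, p)) (cr \<alpha> q (\<rho> g v)))"
  using assms by (simp add: cr_def rho_nprod rho_T rho_sb T_funpow_sum nprod_sum_left nprod_scale_left)

lemma rho_Om:
  assumes g: "g \<in> carrier (Sp n)" and ab: "\<alpha> \<in> modes" "\<beta> \<in> modes"
  shows "\<rho> g (Om \<alpha> \<beta> v) = Om \<alpha> \<beta> (\<rho> g v)"
proof -
  have inv: "(\<Sum>p<2*n. sg n p * g $$ (q, p) * g $$ (s, dual n p)) = (if s = dual n q then sg n q else 0)"
    if "q < 2 * n" "s < 2 * n" for q s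
  proof -
    have "g \<in> carrier_mat (2 * n) (2 * n)" using g by (simp add: Sp_def)
    then show ?thesis using Sp_transpose[OF g] that by (simp add: Sp_iff)
  qed
  let ?X = "\<lambda>q s. cr \<alpha> q (cr \<beta> s (\<rho> g v))"
  have "\<rho> g (Om \<alpha> \<beta> v) = (\<Sum>p<2*n. \<Sum>q<2*n. \<Sum>s<2*n. smult V (sg n p * g $$ (q, p) * g $$ (s, dual n p)) (?X q s))"
    using g ab
    by (simp add: F.Om_def rho_sum rho_scale rho_cr F.c_sum F.c_scale scale_sum_right mult.assoc mult.left_commute)
  also have "\<dots> = (\<Sum>q<2*n. \<Sum>s<2*n. \<Sum>p<2*n. smult V (sg n p * g $$ (q, p) * g $$ (s, dual n p)) (?X q s))"
    by (subst sum.swap, rule sum.cong[OF refl], rule sum.swap)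
  also have "\<dots> = (\<Sum>q<2*n. \<Sum>s<2*n. if s = dual n q then smult V (sg n q) (?X q (dual n q)) else 0)"
    by (intro sum.cong refl) (auto simp: inv simp flip: scale_sum_left)
  also have "\<dots> = Om \<alpha> \<beta> (\<rho> g v)"
    unfolding F.Om_def by (rule sum.cong) auto
  finally show ?thesis .
qed

lemma subspace_invariants: "subspace (Sp_invariants n \<rho>)"
  by (auto simp: subspace_def Sp_invariants_def rho_add rho_scale rho_zero)

lemma OmL_invariant: "set l \<subseteq> modes \<times> modes \<Longrightarrow> F.OmL l (vac V) \<in> Sp_invariants n \<rho>"
proof (induction l)
  case (Cons b l)
  then show ?case by (auto simp: Sp_invariants_def rho_Om simp del: modes_iff)
qed (simp add: Sp_invariants_def rho_vac)

lemma transvection_in_Sp: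
  fixes p r :: nat and t :: complex
  assumes pr: "p < 2 * n" "r < 2 * n" "r \<noteq> p"
  defines "X \<equiv> \<lambda>s q. (if s = r \<and> q = p then 1 else 0) - (if s = dual n p \<and> q = dual n r then sg n p * sg n r else 0)"
  shows "mat (2 * n) (2 * n) (\<lambda>(s, q). (if s = q then 1 else 0) + t * X s q) \<in> carrier (Sp n)"
proof -
  let ?G = "\<lambda>s q. (if s = q then 1 else 0) + t * X s q"
  have d: "dual n p \<noteq> p" "dual n r \<noteq> r" "dual n r \<noteq> dual n p"
    using pr dual_neq[of p n] dual_neq[of r n] dual_dual[of p n] dual_dual[of r n] by metis+
  have "(\<Sum>s<2*n. sg n s * ?G s a * ?G (dual n s) b) = (if b = dual n a then sg n a else 0)"
    if ab: "a < 2 * n" "b < 2 * n" for a b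
  proof -
    have supp: "s = r \<or> s = dual n p" if "X s q \<noteq> 0" for s q
      using that by (auto simp: X_def split: if_splits)
    have XX: "X s a * X (dual n s) b = 0" if "s < 2 * n" for s
    proof (rule ccontr)
      assume "X s a * X (dual n s) b \<noteq> 0"
      then have "s = r \<or> s = dual n p" "dual n s = r \<or> dual n s = dual n p" using supp by auto
      then show False using d pr dual_dual by metis
    qed
    have Xd: "sg n a * X (dual n a) b = - (if a = dual n r \<and> b = p then sg n r else 0) - (if a = p \<and> b = dual n r then sg n r else 0)"
      if "a < 2 * n" for a b
    proof -
      have "dual n a = r \<longleftrightarrow> a = dual n r" "dual n a = dual n p \<longleftrightarrow> a = p"
        using that pr dual_dual by metis+
      then have "X (dual n a) b = (if a = dual n r \<and> b = p then 1 else 0) - (if a = p \<and> b = dual n r then sg n p * sg n r else 0)"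
        by (simp only: X_def)
      moreover have "sg n a * (if a = dual n r \<and> b = p then 1 else 0) = - (if a = dual n r \<and> b = p then sg n r else 0)"
        using sg_dual[OF pr(2)] by simp
      moreover have "sg n a * (if a = p \<and> b = dual n r then sg n p * sg n r else 0) = (if a = p \<and> b = dual n r then sg n r else 0)"
        by simp
      ultimately show ?thesis by (simp only: right_diff_distrib)
    qed
    have X: "sg n a * X (dual n a) b = sg n b * X (dual n b) a"
      unfolding Xd[OF ab(1)] Xd[OF ab(2)] conj_commute[of "b = dual n r"] conj_commute[of "b = p"]
      by (simp only: diff_conv_add_uminus add.commute)
    have "(\<Sum>s<2*n. sg n s * ?G s a * ?G (dual n s) b)
      = (\<Sum>s<2*n. (if s = a then (if b = dual n a then sg n a else 0) + t * (sg n a * X (dual n a) b) else 0)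
         + (if s = dual n b then - t * (sg n b * X (dual n b) a) else 0))"
    proof (rule sum.cong[OF refl])
      fix s assume "s \<in> {..<2 * n}"
      then have s: "s < 2 * n" by simp
      have expand: "sg n s * (u + t * x) * (w + t * y)
        = sg n s * u * w + t * (sg n s * u * y) + t * (sg n s * w * x) + t * t * sg n s * (x * y)" for u w x y
        by (simp add: algebra_simps)
      have "dual n s = b \<longleftrightarrow> s = dual n b" using s ab by auto
      then show "sg n s * ?G s a * ?G (dual n s) b = (if s = a then (if b = dual n a then sg n a else 0) + t * (sg n a * X (dual n a) b) else 0)
         + (if s = dual n b then - t * (sg n b * X (dual n b) a) else 0)"
        unfolding expand XX[OF s] using s ab by auto
    qed
    also have "\<dots> = (if b = dual n a then sg n a else 0)"
      using ab X by (simp add: sum.distrib)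
    finally show ?thesis .
  qed
  then show ?thesis by (simp add: Sp_iff)
qed

theorem invariants_eq_span:
  "Sp_invariants n \<rho> = span {F.OmL l (vac V) | l. set l \<subseteq> modes \<times> modes}"
proof
  show "span {F.OmL l (vac V) | l. set l \<subseteq> modes \<times> modes} \<subseteq> Sp_invariants n \<rho>"
    by (rule span_minimal[OF _ subspace_invariants]) (auto intro: OmL_invariant simp del: modes_iff)
  show "Sp_invariants n \<rho> \<subseteq> span {F.OmL l (vac V) | l. set l \<subseteq> modes \<times> modes}"
  proof
    fix v assume v: "v \<in> Sp_invariants n \<rho>"
    obtain A0 k where A0: "finite A0" "A0 \<subseteq> modes" and vf: "v \<in> F.fil A0 k"
      using F.fil_exhaust by blast
    have "v \<in> F.invs A0"
    proof (rule F.invsI[OF A0])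
      fix p r assume pr: "p < 2 * n" "r < 2 * n" "r \<noteq> p"
      define X where "X = (\<lambda>s q. (if s = r \<and> q = p then 1 else 0) - (if s = dual n p \<and> q = dual n r then sg n p * sg n r else 0))"
      define G where "G = (\<lambda>t. mat (2 * n) (2 * n) (\<lambda>(s, q). (if s = q then 1 else 0) + t * X s q))"
      have G: "G t \<in> carrier (Sp n)" for t
        using transvection_in_Sp[OF pr, of t] by (simp add: G_def X_def)
      have "(\<Sum>q<2*n. \<Sum>s<2*n. smult V (X s q) (F.eop A0 s q v)) = 0"
      proof (rule F.fixed_imp_derivation_zero[OF A0, where \<rho>="\<lambda>t. \<rho> (G t)" and k=k])
        show "\<rho> (G t) (cr \<alpha> q u) = cr \<alpha> q (\<rho> (G t) u) + smult V t (\<Sum>s<2*n. smult V (X s q) (cr \<alpha> s (\<rho> (G t) u)))"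
          if "\<alpha> \<in> A0" "q < 2 * n" for t \<alpha> q u
        proof -
          have "\<alpha> \<in> modes" using that A0 by blast
          then have "\<rho> (G t) (cr \<alpha> q u) = (\<Sum>s<2*n. smult V (G t $$ (s, q)) (cr \<alpha> s (\<rho> (G t) u)))"
            using that by (intro rho_cr G)
          also have "\<dots> = (\<Sum>s<2*n. (if s = q then cr \<alpha> q (\<rho> (G t) u) else 0) + smult V t (smult V (X s q) (cr \<alpha> s (\<rho> (G t) u))))"
            by (rule sum.cong) (use that in \<open>auto simp: G_def scale_left_distrib\<close>)
          also have "\<dots> = cr \<alpha> q (\<rho> (G t) u) + smult V t (\<Sum>s<2*n. smult V (X s q) (cr \<alpha> s (\<rho> (G t) u)))"
            using that(2) by (simp add: sum.distrib scale_sum_right)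
          finally show ?thesis .
        qed
        show "\<rho> (G t) v = v" for t using v G by (auto simp: Sp_invariants_def)
      qed (use vf rho_linear[OF G] rho_vac[OF G] in auto)
      moreover have "(\<Sum>q<2*n. \<Sum>s<2*n. smult V (X s q) (F.eop A0 s q v))
        = (\<Sum>q<2*n. (if q = p then F.eop A0 r p v else 0)
            - (if q = dual n r then smult V (sg n p * sg n r) (F.eop A0 (dual n p) (dual n r) v) else 0))"
      proof (rule sum.cong[OF refl])
        fix q assume "q \<in> {..<2 * n}"
        have "(\<Sum>s<2*n. smult V (X s q) (F.eop A0 s q v)) = (\<Sum>s<2*n. (if s = r then if q = p then F.eop A0 r p v else 0 else 0)
          - (if s = dual n p then if q = dual n r then smult V (sg n p * sg n r) (F.eop A0 (dual n p) (dual n r) v) else 0 else 0))"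
          by (rule sum.cong) (auto simp: X_def scale_left_diff_distrib)
        then show "(\<Sum>s<2*n. smult V (X s q) (F.eop A0 s q v)) = (if q = p then F.eop A0 r p v else 0)
            - (if q = dual n r then smult V (sg n p * sg n r) (F.eop A0 (dual n p) (dual n r) v) else 0)"
          using pr by (simp add: sum_subtractf)
      qed
      ultimately show "F.eop A0 r p v = smult V (sg n p * sg n r) (F.eop A0 (dual n p) (dual n r) v)"
        using pr by (simp add: sum_subtractf)
    qed
    from F.first_fundamental_theorem[OF A0 vf this]
    show "v \<in> span {F.OmL l (vac V) | l. set l \<subseteq> modes \<times> modes}"
      using span_mono[of "{F.OmL l (vac V) | l. set l \<subseteq> A0 \<times> A0}" "{F.OmL l (vac V) | l. set l \<subseteq> modes \<times> modes}"] A0(2)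
      by blast
  qed
qed

end

section \<open>Strong generation\<close>

context vertex_superalgebra
begin

definition strong_span :: "'v set \<Rightarrow> 'v set" where
  "strong_span S = span {wick_list V (map (\<lambda>(a, k). (T ^^ k) a) as) | as :: ('v \<times> nat) list. fst ` set as \<subseteq> S}"

lemma strong_span_vac: "vac V \<in> strong_span S"
  unfolding strong_span_def by (rule span_base) (auto simp: wick_list_def intro!: exI[of _ "[]"])

lemma strong_span_wick:
  assumes "s \<in> S" "w \<in> strong_span S"
  shows "nprod V ((T ^^ k) s) (- 1) w \<in> strong_span S"
  using assms(2)[unfolded strong_span_def] nprod_linear_right
proof (rule span_linear_image)
  show "subspace (strong_span S)" by (simp add: strong_span_def)
  fix x assume "x \<in> {wick_list V (map (\<lambda>(a, k). (T ^^ k) a) as) | as :: ('v \<times> nat) list. fst ` set as \<subseteq> S}"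
  then obtain as where as: "x = wick_list V (map (\<lambda>(a, k). (T ^^ k) a) as)" "fst ` set as \<subseteq> S" by blast
  have "nprod V ((T ^^ k) s) (- 1) x = wick_list V (map (\<lambda>(a, k). (T ^^ k) a) ((s, k) # as))"
    by (simp add: as(1) wick_list_def wick_def)
  moreover have "fst ` set ((s, k) # as) \<subseteq> S" using as(2) assms(1) by simp
  ultimately show "nprod V ((T ^^ k) s) (- 1) x \<in> strong_span S"
    unfolding strong_span_def by (intro span_base) blast
qed

lemma T_wick: "T (nprod V a (- 1) b) = nprod V (T a) (- 1) b + nprod V a (- 1) (T b)"
  by (simp add: T_nprod nprod_T_left)

lemma strong_span_T:
  assumes "w \<in> strong_span S"
  shows "T w \<in> strong_span S"
  using assms[unfolded strong_span_def] T_linear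
proof (rule span_linear_image)
  show sub: "subspace (strong_span S)" by (simp add: strong_span_def)
  fix x assume "x \<in> {wick_list V (map (\<lambda>(a, k). (T ^^ k) a) as) | as :: ('v \<times> nat) list. fst ` set as \<subseteq> S}"
  then obtain as where as: "x = wick_list V (map (\<lambda>(a, k). (T ^^ k) a) as)" "fst ` set as \<subseteq> S" by blast
  have "wick_list V (map (\<lambda>(a, k). (T ^^ k) a) as) \<in> strong_span S \<and> T (wick_list V (map (\<lambda>(a, k). (T ^^ k) a) as)) \<in> strong_span S"
    using as(2)
  proof (induction as)
    case Nil
    then show ?case using strong_span_vac[of S] subspace_0[OF sub] by (simp add: wick_list_def)
  next
    case (Cons ak as)
    obtain a k where ak: "ak = (a, k)" by force
    let ?w = "wick_list V (map (\<lambda>(a, k). (T ^^ k) a) as)"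
    have IH: "?w \<in> strong_span S" "T ?w \<in> strong_span S" "a \<in> S" using Cons ak by auto
    have eq: "wick_list V (map (\<lambda>(a, k). (T ^^ k) a) (ak # as)) = nprod V ((T ^^ k) a) (- 1) ?w"
      by (simp add: ak wick_list_def wick_def)
    have "T (nprod V ((T ^^ k) a) (- 1) ?w) = nprod V ((T ^^ Suc k) a) (- 1) ?w + nprod V ((T ^^ k) a) (- 1) (T ?w)"
      by (simp add: T_wick)
    then show ?case unfolding eq
      using strong_span_wick[OF IH(3,1)] strong_span_wick[OF IH(3,2)] subspace_add[OF sub] by metis
  qed
  then show "T x \<in> strong_span S" by (simp add: as(1))
qed

end

text \<open>Meant for x a b a quadratic with derivative orders a and b: modulo total derivatives,
  moving one derivative to the other end costs a sign.\<close>

lemma (in vector_space) alternating_mod: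
  assumes W: "subspace W" and step: "\<And>a b. Suc (a + b) = N \<Longrightarrow> x (Suc a) b + x a (Suc b) \<in> W"
  shows "a + b = N \<Longrightarrow> x a b - scale ((- 1) ^ a) (x 0 N) \<in> W"
proof (induction a arbitrary: b)
  case 0
  then show ?case using W by (simp add: subspace_0)
next
  case (Suc a)
  have "x (Suc a) b + x a (Suc b) \<in> W" using step[of a b] Suc.prems by simp
  moreover have "x a (Suc b) - scale ((- 1) ^ a) (x 0 N) \<in> W" using Suc by simp
  ultimately have "(x (Suc a) b + x a (Suc b)) - (x a (Suc b) - scale ((- 1) ^ a) (x 0 N)) \<in> W"
    by (rule subspace_diff[OF W])
  then show ?case by (simp add: algebra_simps)
qed

lemma (in vector_space) subspace_scale_iff: "subspace W \<Longrightarrow> k \<noteq> 0 \<Longrightarrow> scale k x \<in> W \<longleftrightarrow> x \<in> W"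
  using subspace_scale[of W "scale k x" "inverse k"] subspace_scale[of W x k] by auto

context symplectic_fermion_algebra
begin

section \<open>Monomials in the quadratic invariants and their weights\<close>

abbreviation "AP \<equiv> modes \<times> modes"

definition mono :: "((nat \<times> nat) \<times> (nat \<times> nat)) list \<Rightarrow> 'v" where
  "mono l = F.OmL l (vac V)"

text \<open>The conformal weight of \<open>qd b\<close>: the k-th derivative of a basis vector has
  weight k + 1.\<close>

definition wt :: "(nat \<times> nat) \<times> (nat \<times> nat) \<Rightarrow> nat" where
  "wt b = snd (fst b) + snd (snd b) + 2"

definition wts :: "((nat \<times> nat) \<times> (nat \<times> nat)) list \<Rightarrow> nat" where
  "wts l = sum_list (map wt l)"

lemma wts_simps [simp]: "wts [] = 0" "wts (b # l) = wt b + wts l" "wts (l @ l') = wts l + wts l'"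
  by (auto simp: wts_def)

lemma wt_ge: "wt b \<ge> 2"
  by (simp add: wt_def)

lemma mono_simps [simp]: "mono [] = vac V" "mono (b # l) = Om (fst b) (snd b) (mono l)"
  by (auto simp: mono_def)

lemma mono_append: "mono (l @ l') = F.OmL l (mono l')"
  by (simp add: mono_def)

lemma mono_single: "mono [b] = qd b"
  by (simp add: qd_def)

lemma OmL_commute:
  assumes "set l \<subseteq> AP" "b \<in> AP"
  shows "Om (fst b) (snd b) (F.OmL l v) = F.OmL l (Om (fst b) (snd b) v)"
  using assms(1)
proof (induction l)
  case (Cons x l)
  have "Om (fst b) (snd b) (Om (fst x) (snd x) (F.OmL l v)) = Om (fst x) (snd x) (Om (fst b) (snd b) (F.OmL l v))"
    by (rule F.Om_commute) (use assms Cons in auto)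
  then show ?case using Cons by simp
qed simp

definition mono_space :: "nat \<Rightarrow> nat \<Rightarrow> 'v set" where
  "mono_space t h = span {mono l | l. set l \<subseteq> AP \<and> length l = t \<and> wts l = h}"

lemma mono_in_space: "set l \<subseteq> AP \<Longrightarrow> mono l \<in> mono_space (length l) (wts l)"
  unfolding mono_space_def by (rule span_base) blast

lemma mono_space_subspace: "subspace (mono_space t h)"
  by (simp add: mono_space_def)

lemma Om_mono_space:
  assumes "b \<in> AP" "v \<in> mono_space t h"
  shows "Om (fst b) (snd b) v \<in> mono_space (Suc t) (wt b + h)"
  using assms(2)[unfolded mono_space_def] F.Om_linear mono_space_subspace
proof (rule span_linear_image)
  fix x assume "x \<in> {mono l | l. set l \<subseteq> AP \<and> length l = t \<and> wts l = h}"
  then obtain l where "x = mono l" "set l \<subseteq> AP" "length l = t" "wts l = h" by blast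
  then show "Om (fst b) (snd b) x \<in> mono_space (Suc t) (wt b + h)"
    using mono_in_space[of "b # l"] assms(1) by simp
qed

lemma T_mono_space: "set l \<subseteq> AP \<Longrightarrow> T (mono l) \<in> mono_space (length l) (Suc (wts l))"
proof (induction l)
  case Nil
  then show ?case by (simp add: mono_space_subspace subspace_0)
next
  case (Cons b l)
  obtain \<alpha> \<beta> where b: "b = (\<alpha>, \<beta>)" by (cases b)
  have "mono ((up \<alpha>, \<beta>) # l) \<in> mono_space (Suc (length l)) (Suc (wt b + wts l))"
    using mono_in_space[of "(up \<alpha>, \<beta>) # l"] Cons.prems by (simp add: b up_def wt_def)
  moreover have "mono ((\<alpha>, up \<beta>) # l) \<in> mono_space (Suc (length l)) (Suc (wt b + wts l))"
    using mono_in_space[of "(\<alpha>, up \<beta>) # l"] Cons.prems by (simp add: b up_def wt_def)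
  moreover have "Om \<alpha> \<beta> (T (mono l)) \<in> mono_space (Suc (length l)) (Suc (wt b + wts l))"
    using Om_mono_space[of b "T (mono l)" "length l" "Suc (wts l)"] Cons by (simp add: b)
  ultimately show ?case
    by (simp add: b T_Om mono_space_subspace subspace_add)
qed

text \<open>The quantum correction to Wick multiplication. It raises derivatives in one factor at a time.\<close>

definition ED :: "(nat \<times> nat) \<times> (nat \<times> nat) \<Rightarrow> 'v \<Rightarrow> 'v" where
  "ED b v = Om (fst b) (snd b) v - Lq b v"

lemma ED_vac [simp]: "ED b (vac V) = 0"
  by (simp add: ED_def qd_def)

lemma ED_Om:
  assumes "g \<in> {1..m}" "g' \<in> {1..m}" "j \<in> {1..m}" "k \<in> {1..m}"
  shows "ED ((j, a), (k, b)) (Om (g, l) (g', l') v) = Om (g, l) (g', l') (ED ((j, a), (k, b)) v)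
     + (if g = j then smult V (kp a l) (Om (k, a + b + l + 2) (g', l') v) else 0)
     + (if g = k then smult V (kp b l) (Om (j, a + b + l + 2) (g', l') v) else 0)
     + (if g' = j then smult V (kp a l') (Om (g, l) (k, a + b + l' + 2) v) else 0)
     + (if g' = k then smult V (kp b l') (Om (g, l) (j, a + b + l' + 2) v) else 0)"
proof -
  have "Om (j, a) (k, b) (Om (g, l) (g', l') v) = Om (g, l) (g', l') (Om (j, a) (k, b) v)"
    by (rule F.Om_commute) (use assms in auto)
  then show ?thesis
    by (simp add: ED_def Lq_Om[OF assms] F.Om_diff algebra_simps)
qed

lemma ED_mono_space:
  assumes b: "b \<in> AP" and l: "set l \<subseteq> AP"
  shows "ED b (mono l) \<in> mono_space (length l) (wt b + wts l)"
  using l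
proof (induction l)
  case Nil
  then show ?case by (simp add: mono_space_subspace subspace_0)
next
  case (Cons c l)
  obtain j a k b' where bb: "b = ((j, a), (k, b'))" by (metis surj_pair)
  obtain g p g' p' where cc: "c = ((g, p), (g', p'))" by (metis surj_pair)
  have mem: "j \<in> {1..m}" "k \<in> {1..m}" "g \<in> {1..m}" "g' \<in> {1..m}" "set l \<subseteq> AP"
    using b Cons.prems by (auto simp: bb cc)
  let ?M = "mono_space (length (c # l)) (wt b + wts (c # l))"
  have 1: "Om (g, p) (g', p') (ED b (mono l)) \<in> ?M"
    using Om_mono_space[of c "ED b (mono l)" "length l" "wt b + wts l"] Cons by (simp add: cc add.left_commute)
  have 2: "Om \<gamma> \<delta> (mono l) \<in> ?M" if "\<gamma> \<in> modes" "\<delta> \<in> modes" "snd \<gamma> + snd \<delta> + 2 = a + b' + p + p' + 4" for \<gamma> \<delta>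
  proof -
    have "wts ((\<gamma>, \<delta>) # l) = wt b + wts (c # l)" using that(3) by (simp add: bb cc wt_def)
    then show ?thesis using mono_in_space[of "(\<gamma>, \<delta>) # l"] that(1,2) mem by (simp add: add.assoc)
  qed
  have 3: "(if P then smult V x (Om \<gamma> \<delta> (mono l)) else 0) \<in> ?M" if "\<gamma> \<in> modes" "\<delta> \<in> modes" "snd \<gamma> + snd \<delta> + 2 = a + b' + p + p' + 4" for \<gamma> \<delta> x P
    using subspace_scale[OF mono_space_subspace 2[OF that]] subspace_0[OF mono_space_subspace] by (cases P) auto
  have "ED b (mono (c # l)) = Om (g, p) (g', p') (ED b (mono l))
     + (if g = j then smult V (kp a p) (Om (k, a + b' + p + 2) (g', p') (mono l)) else 0)
     + (if g = k then smult V (kp b' p) (Om (j, a + b' + p + 2) (g', p') (mono l)) else 0)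
     + (if g' = j then smult V (kp a p') (Om (g, p) (k, a + b' + p' + 2) (mono l)) else 0)
     + (if g' = k then smult V (kp b' p') (Om (g, p) (j, a + b' + p' + 2) (mono l)) else 0)"
    using ED_Om[OF mem(3,4,1,2)] by (simp add: bb cc)
  also have "\<dots> \<in> ?M"
    by (intro subspace_add mono_space_subspace 1 3) (use mem in auto)
  finally show ?case .
qed

section \<open>Positivity of the Wick corrections\<close>

definition raise :: "(nat \<times> nat) \<times> (nat \<times> nat) \<Rightarrow> nat \<times> nat \<Rightarrow> nat \<times> nat" where
  "raise g \<alpha> = (fst \<alpha>, snd \<alpha> + wt g)"

definition cone :: "'v set \<Rightarrow> bool" where
  "cone C \<longleftrightarrow> 0 \<in> C \<and> (\<forall>x\<in>C. \<forall>y\<in>C. x + y \<in> C) \<and> (\<forall>x\<in>C. \<forall>r\<ge>0. smult V (of_real r) x \<in> C)"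

text \<open>Even orders make the sign in \<open>kp\<close> positive, and then \<open>wt g\<close> is
  even too, so raising by it preserves parity.\<close>

definition even_quad :: "nat \<Rightarrow> (nat \<times> nat) \<times> (nat \<times> nat) \<Rightarrow> bool" where
  "even_quad j g \<longleftrightarrow> fst (fst g) = j \<and> fst (snd g) = j \<and> even (snd (fst g)) \<and> even (snd (snd g))"

lemma even_quad_AP: "even_quad j g \<Longrightarrow> j \<in> {1..m} \<Longrightarrow> g \<in> AP"
  by (simp add: even_quad_def mem_Times_iff)

text \<open>Both ends of g have colour j, so the two coefficients \<open>kp\<close> add up.\<close>

definition kr :: "(nat \<times> nat) \<times> (nat \<times> nat) \<Rightarrow> nat \<times> nat \<Rightarrow> real" where
  "kr g \<alpha> = 1 / real (snd \<alpha> + snd (fst g) + 2) + 1 / real (snd \<alpha> + snd (snd g) + 2)"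

lemma kr_pos: "kr g \<alpha> > 0"
  by (auto simp: kr_def intro!: add_pos_pos)

lemma ED_Om_even:
  assumes g: "even_quad j g" "j \<in> {1..m}" and ab: "\<alpha> \<in> modes" "\<beta> \<in> modes"
  shows "ED g (Om \<alpha> \<beta> v) = Om \<alpha> \<beta> (ED g v)
    + (if fst \<alpha> = j then smult V (of_real (kr g \<alpha>)) (Om (raise g \<alpha>) \<beta> v) else 0)
    + (if fst \<beta> = j then smult V (of_real (kr g \<beta>)) (Om \<alpha> (raise g \<beta>) v) else 0)"
proof -
  define a b where "a = snd (fst g)" and "b = snd (snd g)"
  then have gg: "g = ((j, a), (j, b))" "even a" "even b"
    using g by (auto simp: even_quad_def prod_eq_iff)
  obtain c l c' l' where cc: "\<alpha> = (c, l)" "\<beta> = (c', l')" by (cases \<alpha>, cases \<beta>)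
  have k: "smult V (of_real (kr g (x, y))) z = smult V (kp a y) z + smult V (kp b y) z" for x y z
    using gg by (simp add: kr_def kp_def flip: scale_left_distrib)
  have w: "a + b + x + 2 = x + wt g" for x by (simp add: gg wt_def)
  show ?thesis
    using ED_Om[of c c' j j a b l l' v, unfolded w] ab g(2) by (auto simp: cc gg(1)[symmetric] k raise_def)
qed

text \<open>\<open>ED g\<close> acts as a derivation that raises one index of colour j at a time
  with a positive coefficient. The list \<open>ps\<close> holds the factors already passed.\<close>

lemma ED_cone:
  assumes g: "even_quad j g" "j \<in> {1..m}" and C: "cone C"
    and ps: "set ps \<subseteq> AP" "set u \<subseteq> AP"
    and hit: "\<And>u1 \<alpha> \<beta> u2. u = u1 @ (\<alpha>, \<beta>) # u2 \<Longrightarrow> fst \<alpha> = j \<Longrightarrow> mono (ps @ u1 @ (raise g \<alpha>, \<beta>) # u2) \<in> C"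
      "\<And>u1 \<alpha> \<beta> u2. u = u1 @ (\<alpha>, \<beta>) # u2 \<Longrightarrow> fst \<beta> = j \<Longrightarrow> mono (ps @ u1 @ (\<alpha>, raise g \<beta>) # u2) \<in> C"
  shows "F.OmL ps (ED g (mono u)) \<in> C"
  using ps hit
proof (induction u arbitrary: ps)
  case Nil
  then show ?case using C by (simp add: cone_def)
next
  case (Cons b u)
  obtain \<alpha> \<beta> where b: "b = (\<alpha>, \<beta>)" by (cases b)
  have ab: "\<alpha> \<in> modes" "\<beta> \<in> modes" using Cons.prems b by auto
  have 1: "F.OmL (ps @ [b]) (ED g (mono u)) \<in> C"
  proof (rule Cons.IH)
    show "set (ps @ [b]) \<subseteq> AP" "set u \<subseteq> AP" using Cons.prems by auto
    show "mono ((ps @ [b]) @ u1 @ (raise g \<alpha>', \<beta>') # u2) \<in> C" if "u = u1 @ (\<alpha>', \<beta>') # u2" "fst \<alpha>' = j" for u1 \<alpha>' \<beta>' u2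
      using Cons.prems(3)[of "b # u1" \<alpha>' \<beta>' u2] that by simp
    show "mono ((ps @ [b]) @ u1 @ (\<alpha>', raise g \<beta>') # u2) \<in> C" if "u = u1 @ (\<alpha>', \<beta>') # u2" "fst \<beta>' = j" for u1 \<alpha>' \<beta>' u2
      using Cons.prems(4)[of "b # u1" \<alpha>' \<beta>' u2] that by simp
  qed
  have 2: "F.OmL ps (if fst \<alpha> = j then smult V (of_real (kr g \<alpha>)) (Om (raise g \<alpha>) \<beta> (mono u)) else 0) \<in> C"
    using Cons.prems(3)[of "[]" \<alpha> \<beta> u] C kr_pos[of g \<alpha>]
    by (auto simp: b mono_append F.OmL_scale cone_def less_imp_le)
  have 3: "F.OmL ps (if fst \<beta> = j then smult V (of_real (kr g \<beta>)) (Om \<alpha> (raise g \<beta>) (mono u)) else 0) \<in> C"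
    using Cons.prems(4)[of "[]" \<alpha> \<beta> u] C kr_pos[of g \<beta>]
    by (auto simp: b mono_append F.OmL_scale cone_def less_imp_le)
  have "F.OmL ps (ED g (mono (b # u))) = F.OmL (ps @ [b]) (ED g (mono u))
    + F.OmL ps (if fst \<alpha> = j then smult V (of_real (kr g \<alpha>)) (Om (raise g \<alpha>) \<beta> (mono u)) else 0)
    + F.OmL ps (if fst \<beta> = j then smult V (of_real (kr g \<beta>)) (Om \<alpha> (raise g \<beta>) (mono u)) else 0)"
    unfolding mono_simps b fst_conv snd_conv ED_Om_even[OF g ab] F.OmL_add by simp
  then show ?case using 1 2 3 C unfolding cone_def by metis
qed

lemma qd_sym: "b \<in> AP \<Longrightarrow> qd (snd b, fst b) = qd b"
  unfolding qd_def fst_conv snd_conv by (rule F.Om_sym) auto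

lemma Lq_sym: "b \<in> AP \<Longrightarrow> Lq (snd b, fst b) v = Lq b v"
  by (simp only: Lq_def qd_sym)

lemma T_qd: "T (qd (\<alpha>, \<beta>)) = qd (up \<alpha>, \<beta>) + qd (\<alpha>, up \<beta>)"
  by (simp add: qd_def T_Om)

lemma Lq_up: "Lq (up \<alpha>, \<beta>) w + Lq (\<alpha>, up \<beta>) w = T (Lq (\<alpha>, \<beta>) w) - Lq (\<alpha>, \<beta>) (T w)"
  unfolding Lq_def T_wick T_qd nprod_add_left by simp

end

text \<open>W abstracts the space strongly generated by the proposed generators: it contains the
  vacuum and is closed under T and under Wick multiplication by each of them from the left.\<close>

locale strong_closure = symplectic_fermion_algebra +
  fixes W :: "'a set"
  assumes W: "subspace W" and W_vac: "vac V \<in> W" and W_T: "w \<in> W \<Longrightarrow> T w \<in> W"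
    and W_same: "j \<in> {1..m} \<Longrightarrow> even s \<Longrightarrow> s < 2 * n \<Longrightarrow> w \<in> W \<Longrightarrow> Lq ((j, 0), (j, s)) w \<in> W"
    and W_diff: "j \<in> {1..m} \<Longrightarrow> k \<in> {1..m} \<Longrightarrow> j < k \<Longrightarrow> s < 2 * n \<Longrightarrow> w \<in> W \<Longrightarrow> Lq ((j, 0), (k, s)) w \<in> W"
begin

text \<open>For odd N alternation gives x N 0 = - x 0 N modulo W, which together with symmetry
  yields 2 x 0 N in W. This is why only even orders occur among the generators with j = k.\<close>

lemma symmetric_odd_mod:
  assumes "odd N" "x N 0 = x 0 N" "\<And>a b. Suc (a + b) = N \<Longrightarrow> x (Suc a) b + x a (Suc b) \<in> W"
  shows "x 0 N \<in> W"
proof -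
  have "x N 0 - smult V ((- 1) ^ N) (x 0 N) \<in> W" by (rule alternating_mod[where x=x, OF W assms(3)]) auto
  then have "smult V 2 (x 0 N) \<in> W" using assms(1,2) scale_left_distrib[of 1 1 "x 0 N"] by simp
  then show ?thesis using subspace_scale_iff[OF W] by simp
qed

lemma W_of_zero:
  assumes "\<And>a b. Suc (a + b) = N \<Longrightarrow> x (Suc a) b + x a (Suc b) \<in> W" "x 0 N \<in> W" "a + b = N"
  shows "x a b \<in> W"
proof -
  have "x a b - smult V ((- 1) ^ a) (x 0 N) \<in> W" by (rule alternating_mod[where x=x, OF W assms(1,3)])
  from subspace_add[OF W this subspace_scale[OF W assms(2), of "(- 1) ^ a"]] show ?thesis by simp
qed

text \<open>By \<open>Lq_up\<close>, moving a derivative between the two ends costs a commutator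
  with T, which preserves W by induction. So everything reduces to orders 0 and a + b with j <=
  k.\<close>

lemma low_Lq:
  assumes "j \<in> {1..m}" "k \<in> {1..m}" "a + b < 2 * n" "w \<in> W"
  shows "Lq ((j, a), (k, b)) w \<in> W"
  using assms
proof (induction "a + b" arbitrary: j k a b w rule: less_induct)
  case less
  let ?N = "a + b"
  have le: "Lq ((j, a'), (k, b')) w \<in> W" if jk: "j \<le> k" "j \<in> {1..m}" "k \<in> {1..m}" and ab': "a' + b' = ?N" and w: "w \<in> W" for j k a' b' w
  proof -
    define x where "x = (\<lambda>a b. Lq ((j, a), (k, b)) w)"
    have step: "x (Suc a) b + x a (Suc b) \<in> W" if "Suc (a + b) = ?N" for a b
      using Lq_up[of "(j, a)" "(k, b)" w] less.hyps[of a b] less.prems(3) that jk w W_T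
      by (auto simp: up_def x_def intro!: subspace_diff[OF W])
    have "x 0 ?N \<in> W"
    proof (cases "j = k \<and> odd ?N")
      case True
      then show ?thesis
        using Lq_sym[of "((j, 0), (j, ?N))" w] jk by (intro symmetric_odd_mod[where x=x] step) (auto simp: x_def)
    next
      case False
      then show ?thesis using W_same[of j ?N w] W_diff[of j k ?N w] jk w less.prems(3)
        by (cases "j = k") (auto simp: x_def)
    qed
    from W_of_zero[where x=x, OF step this ab'] show ?thesis by (simp add: x_def)
  qed
  show ?case
  proof (cases "j \<le> k")
    case True
    then show ?thesis using le[of j k a b w] less.prems by simp
  next
    case False
    then have "Lq ((k, b), (j, a)) w \<in> W" using le[of k j b a w] less.prems by simp
    then show ?thesis using Lq_sym[of "((j, a), (k, b))" w] less.prems by simp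
  qed
qed

text \<open>
  A factor \<open>\<Omega> (j, a) (k, c)\<close> with \<open>a + c \<ge> 2 * n\<close> is removed with the help of \<open>F.Om_pow_zero\<close>. Turning
  the factors \<open>\<Omega> (j, 0) (j, 0)\<close> of this relation into Wick products one at a time only produces
  corrections of positive sign. In the proof, \<open>K\<close> and \<open>Kp\<close> are the vectors which modulo \<open>W\<close> are
  nonnegative and positive multiples of \<open>x 0 ?N\<close>; so the relation shows \<open>0 \<in> Kp\<close>.
\<close>

theorem mono_in_W: "set l \<subseteq> AP \<Longrightarrow> mono l \<in> W"
\<comment> \<open>Lexicographic in weight, number of factors and weight of the first factor. The
  last component lets weight pass from the first factor to the others.\<close>
proof (induction l rule: wf_induct[where r="measures [wts, length, \<lambda>l. wt (hd l)]"])
  case 1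
  show ?case by simp
next
  case (2 l)
  have IH1: "mono l' \<in> W" if "set l' \<subseteq> AP" "wts l' < wts l" for l'
    using 2 that by simp
  have IH2: "mono l' \<in> W" if "set l' \<subseteq> AP" "wts l' = wts l" "length l' < length l" for l'
    using 2 that by simp
  have IH3: "mono l' \<in> W" if "set l' \<subseteq> AP" "wts l' = wts l" "length l' = length l" "wt (hd l') < wt (hd l)" for l'
    using 2 that by simp
  show ?case
  proof (cases l)
    case Nil
    then show ?thesis by (simp add: W_vac)
  next
    case l: (Cons b bs)
    obtain j a k c where b: "b = ((j, a), (k, c))" by (metis surj_pair)
    have mem: "j \<in> {1..m}" "k \<in> {1..m}" "set bs \<subseteq> AP" "b \<in> AP" using 2 by (auto simp: l b)
    have bsW: "mono bs \<in> W" using IH1[of bs] mem wt_ge[of b] by (simp add: l)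
    show ?thesis
    proof (cases "a + c < 2 * n")
      case True
      have "mono_space (length bs) (wt b + wts bs) \<subseteq> W"
        unfolding mono_space_def by (rule span_minimal[OF _ W]) (auto intro!: IH2 simp: l)
      then have "ED b (mono bs) \<in> W" using ED_mono_space[OF mem(4,3)] by blast
      moreover have "Lq b (mono bs) \<in> W" unfolding b by (rule low_Lq[OF mem(1,2) True bsW])
      ultimately have "ED b (mono bs) + Lq b (mono bs) \<in> W" by (rule subspace_add[OF W])
      then show ?thesis by (simp add: ED_def l)
    next
      case bad: False
      let ?N = "a + c"
      define x where "x = (\<lambda>a' c'. mono (((j, a'), (k, c')) # bs))"
      have step: "x (Suc a') c' + x a' (Suc c') \<in> W" if "Suc (a' + c') = ?N" for a' c'
      proof -
        let ?b = "((j, a'), (k, c'))"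
        have "T (mono (?b # bs)) \<in> W"
          using IH1[of "?b # bs"] mem that by (intro W_T) (auto simp: l b wt_def)
        moreover have "Om (j, a') (k, c') (T (mono bs)) \<in> W"
        proof (rule span_linear_image[OF T_mono_space[OF mem(3), unfolded mono_space_def] F.Om_linear W])
          fix y assume "y \<in> {mono l | l. set l \<subseteq> AP \<and> length l = length bs \<and> wts l = Suc (wts bs)}"
          then obtain l' where "y = mono l'" "set l' \<subseteq> AP" "length l' = length bs" "wts l' = Suc (wts bs)" by blast
          then show "Om (j, a') (k, c') y \<in> W"
            using IH3[of "?b # l'"] mem that by (simp add: l b wt_def)
        qed
        ultimately have "T (mono (?b # bs)) - Om (j, a') (k, c') (T (mono bs)) \<in> W" by (rule subspace_diff[OF W])
        then show ?thesis by (simp add: T_Om x_def up_def)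
      qed
      have "x 0 ?N \<in> W"
      proof (cases "j = k \<and> odd ?N")
        case True
        have "x ?N 0 = x 0 ?N"
          unfolding x_def mono_simps fst_conv snd_conv using True mem F.Om_sym[of "(j, ?N)" "(j, 0)" "mono bs"] by simp
        then show ?thesis using True step by (intro symmetric_odd_mod[where x=x]) auto
      next
        case False
        define K where "K = {v. \<exists>r\<ge>0. v - smult V (of_real r) (x 0 ?N) \<in> W}"
        define Kp where "Kp = {v. \<exists>r>0. v - smult V (of_real r) (x 0 ?N) \<in> W}"
        have WK: "v \<in> W \<Longrightarrow> v \<in> K" for v by (auto simp: K_def intro!: exI[of _ 0])
        have KpK: "v \<in> Kp \<Longrightarrow> v \<in> K" for v unfolding K_def Kp_def by (auto intro: less_imp_le)
        have K_add: "u + v \<in> K" if uv: "u \<in> K" "v \<in> K" for u v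
        proof -
          obtain r s where rs: "r \<ge> 0" "u - smult V (of_real r) (x 0 ?N) \<in> W" "s \<ge> 0" "v - smult V (of_real s) (x 0 ?N) \<in> W"
            using uv unfolding K_def by blast
          have "(u - smult V (of_real r) (x 0 ?N)) + (v - smult V (of_real s) (x 0 ?N)) \<in> W"
            by (rule subspace_add[OF W rs(2,4)])
          then have "u + v - smult V (of_real (r + s)) (x 0 ?N) \<in> W" by (simp add: scale_left_distrib algebra_simps)
          then show ?thesis using rs unfolding K_def by (intro CollectI exI[of _ "r + s"]) simp
        qed
        have Kp_add: "u + v \<in> Kp" if uv: "u \<in> Kp" "v \<in> K" for u v
        proof -
          obtain r s where rs: "r > 0" "u - smult V (of_real r) (x 0 ?N) \<in> W" "s \<ge> 0" "v - smult V (of_real s) (x 0 ?N) \<in> W"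
            using uv unfolding K_def Kp_def by blast
          have "(u - smult V (of_real r) (x 0 ?N)) + (v - smult V (of_real s) (x 0 ?N)) \<in> W"
            by (rule subspace_add[OF W rs(2,4)])
          then have "u + v - smult V (of_real (r + s)) (x 0 ?N) \<in> W" by (simp add: scale_left_distrib algebra_simps)
          then show ?thesis using rs unfolding Kp_def by (intro CollectI exI[of _ "r + s"]) simp
        qed
        have K_scale: "smult V (of_real t) u \<in> K" if u: "u \<in> K" "t \<ge> 0" for u t
        proof -
          obtain r where r: "r \<ge> 0" "u - smult V (of_real r) (x 0 ?N) \<in> W" using u unfolding K_def by blast
          from subspace_scale[OF W r(2), of "of_real t"]
          have "smult V (of_real t) u - smult V (of_real (t * r)) (x 0 ?N) \<in> W" by (simp add: scale_right_diff_distrib)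
          then show ?thesis using r u(2) unfolding K_def by (intro CollectI exI[of _ "t * r"]) simp
        qed
        have Kp_scale: "smult V (of_real t) u \<in> Kp" if u: "u \<in> Kp" "t > 0" for u t
        proof -
          obtain r where r: "r > 0" "u - smult V (of_real r) (x 0 ?N) \<in> W" using u unfolding Kp_def by blast
          from subspace_scale[OF W r(2), of "of_real t"]
          have "smult V (of_real t) u - smult V (of_real (t * r)) (x 0 ?N) \<in> W" by (simp add: scale_right_diff_distrib)
          then show ?thesis using r u(2) unfolding Kp_def by (intro CollectI exI[of _ "t * r"]) simp
        qed
        have K_cone: "cone K" unfolding cone_def using WK[OF subspace_0[OF W]] K_add K_scale by blast
        \<comment> \<open>\<open>gs\<close> are the factors still to be turned into Wick products,
          and \<open>bs'\<close> is \<open>bs\<close> after possible corrections. A correction on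
          \<open>bs\<close> makes it heavier and hence the first factor lighter in the end; if
          \<open>bs\<close> stays untouched, raising a' contributes with positive sign.\<close>
        have peel: "mono (((j, a'), (k, s')) # gs @ bs') \<in> K \<and> (bs' = bs \<longrightarrow> mono (((j, a'), (k, s')) # gs @ bs') \<in> Kp)"
          if "\<forall>g\<in>set gs. even_quad j g" "even a'" "j = k \<longrightarrow> even s'" "set bs' \<subseteq> AP" "length bs' = length bs"
            "bs' = bs \<or> wts bs' > wts bs" "wts gs \<le> 2 * n" "wts (((j, a'), (k, s')) # gs @ bs') = wts l"
          for gs a' s' bs'
          using that
        proof (induction "length gs" arbitrary: gs a' s' bs')
          case 0
          then have gs: "gs = []" by simp
          show ?case
          proof (cases "bs' = bs")
            case True
            then have N: "a' + s' = ?N" using 0 by (simp add: gs l b wt_def)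
            \<comment> \<open>Since a' is even, the sign is + and the multiple of x 0 N is
              1.\<close>
            have "x a' s' - smult V ((- 1) ^ a') (x 0 ?N) \<in> W" by (rule alternating_mod[where x=x, OF W step N])
            then have "mono (((j, a'), (k, s')) # gs @ bs') \<in> Kp"
              unfolding Kp_def using 0 True by (intro CollectI exI[of _ 1]) (simp add: gs x_def)
            then show ?thesis using KpK by blast
          next
            case False
            \<comment> \<open>With the total weight fixed, the first factor has become lighter, so
              the induction hypothesis applies.\<close>
            then have "wts bs' > wts bs" using 0 by blast
            then have "mono (((j, a'), (k, s')) # bs') \<in> W"
              using 0 mem by (intro IH3) (auto simp: gs l b wt_def)
            then show ?thesis using WK False by (simp add: gs)
          qed
        next
          case (Suc t)
          obtain g gs' where gs: "gs = g # gs'" "length gs' = t" using Suc.hyps(2) by (cases gs) auto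
          let ?q = "((j, a'), (k, s'))" and ?u = "gs' @ bs'"
          have g: "even_quad j g" using Suc.prems(1) gs by simp
          have gAP: "g \<in> AP" by (rule even_quad_AP[OF g mem(1)])
          have "set gs' \<subseteq> AP" using Suc.prems(1) gs even_quad_AP[OF _ mem(1)] by auto
          then have AP: "set ?u \<subseteq> AP" "?q \<in> AP" using Suc.prems(4) mem by auto
          have "mono (?q # gs @ bs') = Om (fst g) (snd g) (mono (?q # ?u))"
            using OmL_commute[of "[?q]" g "mono ?u"] AP gAP by (simp add: gs)
          also have "\<dots> = Lq g (mono (?q # ?u)) + (F.OmL [?q] (ED g (mono ?u))
            + ((smult V (of_real (kr g (j, a'))) (mono (((j, a' + wt g), (k, s')) # ?u)))
            + (if k = j then smult V (of_real (kr g (k, s'))) (mono (((j, a'), (k, s' + wt g)) # ?u)) else 0)))"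
            using ED_Om_even[OF g mem(1), of "(j, a')" "(k, s')" "mono ?u"] mem
            by (simp add: ED_def[of g "Om (j, a') (k, s') (mono ?u)"] raise_def algebra_simps)
          finally have eq: "mono (?q # gs @ bs') = \<dots>" .
          have wtg: "even (wt g)" using g by (auto simp: even_quad_def wt_def)
          \<comment> \<open>The bound on \<open>wts gs\<close> gives total order \<open>wt g\<close>
            - 2 < 2n, the range of \<open>low_Lq\<close>.\<close>
          have 1: "Lq g (mono (?q # ?u)) \<in> W"
          proof -
            have "wt g \<le> 2 * n" using Suc.prems(7) by (simp add: gs)
            moreover have "mono (?q # ?u) \<in> W" using AP Suc.prems(8) wt_ge[of g] by (intro IH1) (auto simp: gs)
            ultimately show ?thesis using low_Lq[of "fst (fst g)" "fst (snd g)" "snd (fst g)" "snd (snd g)"] gAP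
              by (auto simp: wt_def)
          qed
          have 2: "F.OmL [?q] (ED g (mono ?u)) \<in> K"
          proof (rule ED_cone[OF g mem(1) K_cone])
            show "set [?q] \<subseteq> AP" "set ?u \<subseteq> AP" using AP by auto
            have main: "mono ([?q] @ u1 @ z' # u2) \<in> K"
              if u: "?u = u1 @ z # u2" and z: "wt z' = wt z + wt g" "z' \<in> AP" "even_quad j z \<longrightarrow> even_quad j z'" for u1 z z' u2
            proof -
              consider v where "gs' = u1 @ z # v" "u2 = v @ bs'" | v where "u1 = gs' @ v" "bs' = v @ z # u2"
                using u by (auto simp: append_eq_append_conv2 append_eq_Cons_conv Cons_eq_append_conv)
              then show ?thesis
              proof cases
                case (1 v)
                have "mono (?q # (u1 @ z' # v) @ bs') \<in> K"
                  using Suc.hyps(1)[of "u1 @ z' # v" a' s' bs'] Suc.prems gs 1 z by (auto simp: ac_simps)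
                then show ?thesis by (simp add: 1)
              next
                case (2 v)
                have "mono (?q # gs' @ (v @ z' # u2)) \<in> K"
                  using Suc.hyps(1)[of gs' a' s' "v @ z' # u2"] Suc.prems gs 2 z wt_ge[of g] by (auto simp: ac_simps)
                then show ?thesis by (simp add: 2)
              qed
            qed
            show "mono ([?q] @ u1 @ (raise g \<alpha>, \<beta>) # u2) \<in> K" if "?u = u1 @ (\<alpha>, \<beta>) # u2" "fst \<alpha> = j" for u1 \<alpha> \<beta> u2
              by (rule main[OF that(1)]) (use that AP wtg in \<open>auto simp: raise_def wt_def even_quad_def\<close>)
            show "mono ([?q] @ u1 @ (\<alpha>, raise g \<beta>) # u2) \<in> K" if "?u = u1 @ (\<alpha>, \<beta>) # u2" "fst \<beta> = j" for u1 \<alpha> \<beta> u2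
              by (rule main[OF that(1)]) (use that AP wtg in \<open>auto simp: raise_def wt_def even_quad_def\<close>)
          qed
          have wts_le: "wts gs' \<le> 2 * n" using Suc.prems(7) by (simp add: gs)
          have 3: "mono (((j, a' + wt g), (k, s')) # ?u) \<in> K" "bs' = bs \<Longrightarrow> mono (((j, a' + wt g), (k, s')) # ?u) \<in> Kp"
            using Suc.hyps(1)[of gs' "a' + wt g" s' bs'] Suc.prems gs wts_le wtg by (auto simp: wt_def[of "((_, _), _)"])
          have 4: "(if k = j then smult V (of_real (kr g (k, s'))) (mono (((j, a'), (k, s' + wt g)) # ?u)) else 0) \<in> K"
          proof (cases "k = j")
            case True
            have "mono (((j, a'), (k, s' + wt g)) # ?u) \<in> K"
              using Suc.hyps(1)[of gs' a' "s' + wt g" bs'] Suc.prems gs wts_le wtg True by (auto simp: wt_def[of "((_, _), _)"])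
            then show ?thesis using True K_scale kr_pos[of g "(k, s')"] by (simp add: less_imp_le)
          qed (simp add: WK subspace_0[OF W])
          have "mono (?q # gs @ bs') \<in> K"
            unfolding eq using WK[OF 1] 2 K_scale[OF 3(1)] 4 kr_pos[of g "(j, a')"]
            by (intro K_add) (auto intro: less_imp_le)
          moreover have "mono (?q # gs @ bs') \<in> Kp" if "bs' = bs"
          proof -
            have "smult V (of_real (kr g (j, a'))) (mono (((j, a' + wt g), (k, s')) # ?u)) \<in> Kp"
              using Kp_scale[OF 3(2)[OF that]] kr_pos by blast
            from Kp_add[OF Kp_add[OF Kp_add[OF this 4] 2] WK[OF 1]] show ?thesis
              unfolding eq by (simp only: ac_simps)
          qed
          ultimately show ?case by blast
        qed
        \<comment> \<open>The n factors of weight 2 make up for the 2n removed from the order N, so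
          the vanishing product has the weight of l.\<close>
        let ?r = "replicate n ((j, 0 :: nat), (j, 0 :: nat))" and ?s = "?N - 2 * n"
        have "wts ?r = 2 * n" by (simp add: wts_def wt_def sum_list_replicate)
        then have "mono (((j, 0), (k, ?s)) # ?r @ bs) \<in> Kp"
          using peel[of ?r 0 ?s bs] False bad mem by (auto simp: even_quad_def l b wt_def)
        moreover have "mono (((j, 0), (k, ?s)) # ?r @ bs) = 0"
        proof -
          have "F.OmL (replicate i ((j, 0), (j, 0))) v = (Om (j, 0) (j, 0) ^^ i) v" for i v
            by (induction i) auto
          then have "F.OmL ?r (Om (j, 0) (k, ?s) (mono bs)) = 0"
            using F.Om_pow_zero[of "(j, 0)" "(k, ?s)" "mono bs"] mem by simp
          moreover have "Om (j, 0) (k, ?s) (F.OmL ?r (mono bs)) = F.OmL ?r (Om (j, 0) (k, ?s) (mono bs))"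
          proof -
            have "set ?r \<subseteq> AP" using mem by (auto dest: in_set_replicate[THEN iffD1])
            then show ?thesis using OmL_commute[of ?r "((j, 0), (k, ?s))" "mono bs"] mem by simp
          qed
          ultimately show ?thesis by (simp add: mono_append)
        qed
        ultimately obtain r where "r > 0" "- smult V (of_real r) (x 0 ?N) \<in> W" unfolding Kp_def by auto
        then have "smult V (- of_real r) (x 0 ?N) \<in> W" "- of_real r \<noteq> (0::complex)" by auto
        then show ?thesis using subspace_scale_iff[OF W] by blast
      qed
      from W_of_zero[where x=x, OF step this] have "x a c \<in> W" by simp
      then show ?thesis by (simp add: x_def l b)
    qed
  qed
qed

end

section \<open>Minimality\<close>

context vector_space
begin

lemma span_image_sum:
  assumes "v \<in> span (f ` X)"
  obtains L u where "finite L" "L \<subseteq> X" "v = (\<Sum>l\<in>L. scale (u l) (f l))"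
proof -
  have "\<exists>L u. finite L \<and> L \<subseteq> X \<and> v = (\<Sum>l\<in>L. scale (u l) (f l))"
    using assms
  proof (induction rule: span_induct_alt)
    case base
    then show ?case by (intro exI[of _ "{}"]) auto
  next
    case (step k y v)
    obtain x where x: "x \<in> X" "y = f x" using step by blast
    obtain L u where L: "finite L" "L \<subseteq> X" "v = (\<Sum>l\<in>L. scale (u l) (f l))" using step by blast
    let ?w = "\<lambda>l. (if l = x then k else 0) + (if l \<in> L then u l else 0)"
    have "(\<Sum>l\<in>insert x L. scale (?w l) (f l)) =
      (\<Sum>l\<in>insert x L. if l = x then scale k (f x) else 0) + (\<Sum>l\<in>insert x L. if l \<in> L then scale (u l) (f l) else 0)"
      by (subst sum.distrib[symmetric], rule sum.cong) (auto simp: scale_left_distrib)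
    also have "(\<Sum>l\<in>insert x L. if l \<in> L then scale (u l) (f l) else 0) = v"
      unfolding L(3) by (rule sum.mono_neutral_cong_right) (use L in auto)
    also have "(\<Sum>l\<in>insert x L. if l = x then scale k (f x) else 0) = scale k y"
      using L x by simp
    finally show ?case
      using L x by (intro exI[of _ "insert x L"] exI[of _ ?w]) auto
  qed
  then show thesis using that by blast
qed

text \<open>Adjacent transpositions suffice. Fixing the content D demands the exchange property only
  for lists whose length and entries are under control.\<close>

lemma permutation_mod:
  assumes W: "subspace W"
    and swap: "\<And>l1 a b l2. mset (l1 @ a # b # l2) = D \<Longrightarrow> f (l1 @ a # b # l2) - f (l1 @ b # a # l2) \<in> W"
    and l: "mset l = D" "mset l' = D"
  shows "f l - f l' \<in> W"
proof -
  have front: "f (p @ l1 @ a # l2) - f (p @ a # l1 @ l2) \<in> W" if "mset (p @ l1 @ a # l2) = D" for p l1 a l2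
    using that
  proof (induction l1 arbitrary: p)
    case Nil
    then show ?case using subspace_0[OF W] by simp
  next
    case (Cons b l1)
    have "f ((p @ [b]) @ l1 @ a # l2) - f ((p @ [b]) @ a # l1 @ l2) \<in> W"
      by (rule Cons.IH) (use Cons.prems in simp)
    moreover have "f (p @ b # a # l1 @ l2) - f (p @ a # b # l1 @ l2) \<in> W"
      by (rule swap) (use Cons.prems in simp)
    ultimately have "(f ((p @ [b]) @ l1 @ a # l2) - f ((p @ [b]) @ a # l1 @ l2)) + (f (p @ b # a # l1 @ l2) - f (p @ a # b # l1 @ l2)) \<in> W"
      by (rule subspace_add[OF W])
    then show ?case by simp
  qed
  have "f (p @ l) - f (p @ l') \<in> W" if "mset l = mset l'" "mset (p @ l) = D" for p l l'
    using that
  proof (induction l arbitrary: p l')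
    case Nil
    then show ?case using subspace_0[OF W] by simp
  next
    case (Cons a l)
    have "a \<in> set l'" using Cons.prems(1) by (metis list.set_intros(1) set_mset_mset)
    then obtain l1 l2 where l': "l' = l1 @ a # l2" by (meson split_list)
    have "f ((p @ [a]) @ l) - f ((p @ [a]) @ (l1 @ l2)) \<in> W"
      by (rule Cons.IH) (use Cons.prems l' in auto)
    moreover have "f (p @ l1 @ a # l2) - f (p @ a # l1 @ l2) \<in> W"
      by (rule front) (use Cons.prems l' in auto)
    ultimately have "(f ((p @ [a]) @ l) - f ((p @ [a]) @ (l1 @ l2))) - (f (p @ l1 @ a # l2) - f (p @ a # l1 @ l2)) \<in> W"
      by (rule subspace_diff[OF W])
    then show ?case by (simp add: l')
  qed
  from this[of l l' "[]"] show ?thesis using l by simp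
qed

end

context symplectic_fermion_algebra
begin

section \<open>Unordered pairs and their representatives\<close>

abbreviation "ups \<equiv> F.ups"
abbreviation "pm \<equiv> F.pm"
abbreviation "Fn \<equiv> F.Fn"

lemma ups_eq_iff: "ups b = ups b' \<longleftrightarrow> b' = b \<or> b' = (snd b, fst b)"
  by (cases b; cases b') (auto simp: doubleton_eq_iff)

lemma wt_ups: "ups b = ups b' \<Longrightarrow> wt b = wt b'"
  unfolding ups_eq_iff by (auto simp: wt_def)

text \<open>Chooses one orientation of an unordered pair. After replacing factors by their
  representatives, equality of \<open>pm\<close> becomes equality up to permutation.\<close>

definition cp :: "(nat \<times> nat) set \<Rightarrow> (nat \<times> nat) \<times> (nat \<times> nat)" where
  "cp X = (SOME b. ups b = X)"

lemma ups_cp: "ups (cp (ups b)) = ups b"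
  unfolding cp_def by (rule someI[of "\<lambda>b'. ups b' = ups b" b]) simp

lemma wts_pm: "pm l = pm l' \<Longrightarrow> wts l = wts l'"
proof -
  have wts: "wts l = (\<Sum>X\<in>#pm l. wt (cp X))" for l
    by (induction l) (auto simp: wt_ups[OF ups_cp])
  show "pm l = pm l' \<Longrightarrow> wts l = wts l'" by (simp only: wts)
qed

lemma length_pm: "pm l = pm l' \<Longrightarrow> length l = length l'"
  by (drule arg_cong[where f=size]) simp

lemma map_cp_mset:
  assumes "pm l = pm l'"
  shows "mset (map (\<lambda>b. cp (ups b)) l) = mset (map (\<lambda>b. cp (ups b)) l')"
proof -
  have "mset (map (\<lambda>b. cp (ups b)) l) = image_mset cp (pm l)" for l
    by (induction l) auto
  then show ?thesis by (simp only: assms)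
qed

lemma cp_cases: "cp (ups b) = b \<or> cp (ups b) = (snd b, fst b)"
  using ups_cp[of b] ups_eq_iff[of b "cp (ups b)"] by auto

lemma cp_AP: "b \<in> AP \<Longrightarrow> cp (ups b) \<in> AP"
  using cp_cases[of b] by (auto simp: mem_Times_iff)

lemma cp_map_AP: "set l \<subseteq> AP \<Longrightarrow> set (map (\<lambda>b. cp (ups b)) l) \<subseteq> AP"
  unfolding set_map by (rule image_subsetI) (rule cp_AP, blast)

lemma Om_cp: "b \<in> AP \<Longrightarrow> Om (fst (cp (ups b))) (snd (cp (ups b))) v = Om (fst b) (snd b) v"
  using cp_cases[of b] F.Om_sym[of "snd b" "fst b" v] by (auto simp: mem_Times_iff)

lemma Lq_cp: "b \<in> AP \<Longrightarrow> Lq (cp (ups b)) v = Lq b v"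
  using cp_cases[of b] Lq_sym[of b v] by auto

lemma mono_pm:
  assumes "set l \<subseteq> AP" "set l' \<subseteq> AP" "pm l = pm l'"
  shows "mono l = mono l'"
proof -
  let ?c = "map (\<lambda>b. cp (ups b))"
  have cp: "mono (?c l) = mono l" if "set l \<subseteq> AP" for l
    using that by (induction l) (auto simp: Om_cp simp del: modes_iff)
  have "mono (?c l) - mono (?c l') \<in> {0}"
  proof (rule permutation_mod[where D="mset (?c l)"])
    fix l1 a b l2 assume D: "mset (l1 @ a # b # l2) = mset (?c l)"
    have "set (l1 @ a # b # l2) \<subseteq> AP"
      unfolding mset_eq_setD[OF D] by (rule cp_map_AP[OF assms(1)])
    then have "Om (fst a) (snd a) (Om (fst b) (snd b) (mono l2)) = Om (fst b) (snd b) (Om (fst a) (snd a) (mono l2))"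
      by (intro F.Om_commute) (auto simp: mem_Times_iff)
    then show "mono (l1 @ a # b # l2) - mono (l1 @ b # a # l2) \<in> {0}"
      by (simp add: mono_append)
  qed (use map_cp_mset[OF assms(3)] in auto)
  then show ?thesis using cp[OF assms(1)] cp[OF assms(2)] by simp
qed

section \<open>Wick monomials, their symbols and their commutators\<close>

definition Wk :: "((nat \<times> nat) \<times> (nat \<times> nat)) list \<Rightarrow> 'v" where
  "Wk l = foldr Lq l (vac V)"

lemma Wk_simps [simp]: "Wk [] = vac V" "Wk (b # l) = Lq b (Wk l)"
  by (auto simp: Wk_def)

lemma Wk_append: "Wk (l @ l') = foldr Lq l (Wk l')"
  by (simp add: Wk_def)

definition low :: "nat \<Rightarrow> nat \<Rightarrow> 'v set" where
  "low t h = span {mono l | l. set l \<subseteq> AP \<and> length l < t \<and> wts l = h}"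

lemma low_subspace: "subspace (low t h)"
  by (simp add: low_def)

lemma mono_space_low: "t < t' \<Longrightarrow> mono_space t h \<subseteq> low t' h"
  unfolding mono_space_def low_def by (rule span_mono) auto

lemma Lq_mono: "Lq b (mono l) = mono (b # l) - ED b (mono l)"
  by (simp add: ED_def)

lemma Lq_low:
  assumes "b \<in> AP" "y \<in> low t h"
  shows "Lq b y \<in> low (Suc t) (wt b + h)"
  using assms(2)[unfolded low_def] Lq_linear low_subspace
proof (rule span_linear_image)
  fix x assume "x \<in> {mono l | l. set l \<subseteq> AP \<and> length l < t \<and> wts l = h}"
  then obtain l where l: "x = mono l" "set l \<subseteq> AP" "length l < t" "wts l = h" by blast
  have "mono (b # l) \<in> low (Suc t) (wt b + h)"
    using mono_in_space[of "b # l"] mono_space_low[of "Suc (length l)" "Suc t"] assms(1) l by auto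
  moreover have "ED b (mono l) \<in> low (Suc t) (wt b + h)"
    using ED_mono_space[OF assms(1) l(2)] mono_space_low[of "length l" "Suc t"] l by auto
  ultimately show "Lq b x \<in> low (Suc t) (wt b + h)"
    unfolding l(1) Lq_mono by (rule subspace_diff[OF low_subspace])
qed

text \<open>Each correction \<open>ED\<close> merges two factors into one, so a Wick monomial has
  the corresponding \<open>Om\<close> monomial as its leading term.\<close>

lemma Wk_mono: "set l \<subseteq> AP \<Longrightarrow> Wk l - mono l \<in> low (length l) (wts l)"
proof (induction l)
  case Nil
  then show ?case using subspace_0[OF low_subspace] by simp
next
  case (Cons b l)
  have b: "b \<in> AP" "set l \<subseteq> AP" using Cons.prems by auto
  interpret L: Vector_Spaces.linear "smult V" "smult V" "Lq b" by (rule Lq_linear)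
  have "Lq b (Wk l - mono l) \<in> low (Suc (length l)) (wt b + wts l)"
    by (rule Lq_low[OF b(1) Cons.IH[OF b(2)]])
  moreover have "ED b (mono l) \<in> low (Suc (length l)) (wt b + wts l)"
    using ED_mono_space[OF b] mono_space_low[of "length l" "Suc (length l)"] by auto
  ultimately have "Lq b (Wk l - mono l) - ED b (mono l) \<in> low (Suc (length l)) (wt b + wts l)"
    by (rule subspace_diff[OF low_subspace])
  moreover have "Lq b (Wk l - mono l) - ED b (mono l) = Wk (b # l) - mono (b # l)"
    by (simp add: L.diff ED_def)
  ultimately show ?case by simp
qed

definition TQ :: "'v set" where
  "TQ = span {T (qd b) | b. b \<in> AP}"

text \<open>Modulo derivatives a quadratic depends only on the total order, up to the sign (-1)^u;
  the condition on z and z' compares these signs.\<close>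

lemma qd_mod_TQ:
  assumes "k \<in> {1..m}" "r \<in> {1..m}" "u + v = u' + v'" "z * (- 1) ^ u = z' * (- 1) ^ u'"
  shows "smult V z (qd ((k, u), (r, v))) - smult V z' (qd ((k, u'), (r, v'))) \<in> TQ"
proof -
  let ?x = "\<lambda>a b. qd ((k, a), (r, b))" and ?N = "u + v"
  have W: "subspace TQ" by (simp add: TQ_def)
  have step: "?x (Suc a) b + ?x a (Suc b) \<in> TQ" for a b
  proof -
    have "T (qd ((k, a), (r, b))) \<in> TQ"
      unfolding TQ_def using assms by (intro span_base) auto
    then show ?thesis by (simp add: T_qd up_def)
  qed
  have 1: "?x u v - smult V ((- 1) ^ u) (?x 0 ?N) \<in> TQ"
    by (rule alternating_mod[where x="?x", OF W step]) simp
  have 2: "?x u' v' - smult V ((- 1) ^ u') (?x 0 ?N) \<in> TQ"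
    by (rule alternating_mod[where x="?x", OF W step]) (simp add: assms)
  have "smult V z (?x u v - smult V ((- 1) ^ u) (?x 0 ?N)) - smult V z' (?x u' v' - smult V ((- 1) ^ u') (?x 0 ?N)) \<in> TQ"
    by (intro subspace_diff subspace_scale W 1 2)
  then show ?thesis using assms(4) by (simp add: scale_right_diff_distrib)
qed

lemma Lq_commutator:
  assumes b: "b1 \<in> AP" "b2 \<in> AP"
  shows "Lq b1 (Lq b2 v) - Lq b2 (Lq b1 v) = nprod V (Lq b1 (qd b2) - Lq b2 (qd b1)) (- 1) v"
  unfolding Lq_def by (rule left_symmetric) (use b qd_even in auto)

text \<open>The quartic parts commute and cancel. The remaining terms pair up with equal total
  order; the denominators of \<open>kp\<close> are symmetric, and the signs are those of moving
  derivatives. The first claim serves exchanges in words of length 2, the second those in longer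
  words.\<close>

lemma commutator_TQ:
  assumes "b1 \<in> AP" "b2 \<in> AP"
  shows "Lq b1 (qd b2) - Lq b2 (qd b1) \<in> TQ"
    and "Lq b1 (qd b2) - Lq b2 (qd b1) \<in> span (qd ` AP)"
proof -
  obtain j a k b where b1: "b1 = ((j, a), (k, b))" by (metis surj_pair)
  obtain g c r d where b2: "b2 = ((g, c), (r, d))" by (metis surj_pair)
  have mem: "j \<in> {1..m}" "k \<in> {1..m}" "g \<in> {1..m}" "r \<in> {1..m}" using assms by (auto simp: b1 b2)
  have W: "subspace TQ" by (simp add: TQ_def)
  have comm: "Om (g, c) (r, d) (qd b1) = Om (j, a) (k, b) (qd b2)"
    unfolding qd_def b1 b2 fst_conv snd_conv by (rule F.Om_commute) (use mem in auto)
  have qd: "Om \<alpha> \<beta> (vac V) = qd (\<alpha>, \<beta>)" for \<alpha> \<beta> by (simp add: qd_def)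
  have L1: "Lq b1 (qd b2) = Om (g, c) (r, d) (qd b1)
     - (if g = j then smult V (kp a c) (qd ((k, a + b + c + 2), (r, d))) else 0)
     - (if g = k then smult V (kp b c) (qd ((j, a + b + c + 2), (r, d))) else 0)
     - (if r = j then smult V (kp a d) (qd ((g, c), (k, a + b + d + 2))) else 0)
     - (if r = k then smult V (kp b d) (qd ((g, c), (j, a + b + d + 2))) else 0)"
    using Lq_Om[OF mem(3,4,1,2), of a b c d "vac V"] unfolding qd b1[symmetric] b2[symmetric] Lq_vac .
  have L2: "Lq b2 (qd b1) = Om (j, a) (k, b) (qd b2)
     - (if j = g then smult V (kp c a) (qd ((r, c + d + a + 2), (k, b))) else 0)
     - (if j = r then smult V (kp d a) (qd ((g, c + d + a + 2), (k, b))) else 0)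
     - (if k = g then smult V (kp c b) (qd ((j, a), (r, c + d + b + 2))) else 0)
     - (if k = r then smult V (kp d b) (qd ((j, a), (g, c + d + b + 2))) else 0)"
    using Lq_Om[OF mem(1,2,3,4), of c d a b "vac V"] unfolding qd b1[symmetric] b2[symmetric] Lq_vac .
  have eq: "Lq b1 (qd b2) - Lq b2 (qd b1) =
      (if g = j then smult V (kp c a) (qd ((r, c + d + a + 2), (k, b))) - smult V (kp a c) (qd ((k, a + b + c + 2), (r, d))) else 0)
    + (if g = k then smult V (kp c b) (qd ((j, a), (r, c + d + b + 2))) - smult V (kp b c) (qd ((j, a + b + c + 2), (r, d))) else 0)
    + (if r = j then smult V (kp d a) (qd ((g, c + d + a + 2), (k, b))) - smult V (kp a d) (qd ((g, c), (k, a + b + d + 2))) else 0)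
    + (if r = k then smult V (kp d b) (qd ((j, a), (g, c + d + b + 2))) - smult V (kp b d) (qd ((g, c), (j, a + b + d + 2))) else 0)"
    unfolding L1 L2 comm eq_commute[of j g] eq_commute[of j r] eq_commute[of k g] eq_commute[of k r]
    by (cases "g = j"; cases "g = k"; cases "r = j"; cases "r = k") (simp_all add: algebra_simps)
  have sg: "(- 1) ^ (x + x) = (1::complex)" for x by (simp add: power_add flip: power_mult_distrib)
  have s1: "qd ((r, c + d + a + 2), (k, b)) = qd ((k, b), (r, c + d + a + 2))"
    using qd_sym[of "((k, b), (r, c + d + a + 2))"] mem by simp
  have s4: "qd ((j, a), (g, c + d + b + 2)) = qd ((g, c + d + b + 2), (j, a))"
    using qd_sym[of "((g, c + d + b + 2), (j, a))"] mem by simp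
  show "Lq b1 (qd b2) - Lq b2 (qd b1) \<in> TQ"
    unfolding eq s1 s4
  proof (intro subspace_add W)
    have if0: "(if P then x else 0) \<in> TQ" if "x \<in> TQ" for P x using that subspace_0[OF W] by simp
    show "(if g = j then smult V (kp c a) (qd ((k, b), (r, c + d + a + 2))) - smult V (kp a c) (qd ((k, a + b + c + 2), (r, d))) else 0) \<in> TQ"
      by (intro if0 qd_mod_TQ mem) (simp_all add: kp_def power_add power_mult_distrib[symmetric] add.commute mult.assoc mult.left_commute)
    show "(if g = k then smult V (kp c b) (qd ((j, a), (r, c + d + b + 2))) - smult V (kp b c) (qd ((j, a + b + c + 2), (r, d))) else 0) \<in> TQ"
      by (intro if0 qd_mod_TQ mem) (simp_all add: kp_def power_add power_mult_distrib[symmetric] add.commute mult.assoc mult.left_commute)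
    show "(if r = j then smult V (kp d a) (qd ((g, c + d + a + 2), (k, b))) - smult V (kp a d) (qd ((g, c), (k, a + b + d + 2))) else 0) \<in> TQ"
      by (intro if0 qd_mod_TQ mem) (simp_all add: kp_def power_add power_mult_distrib[symmetric] add.commute mult.assoc mult.left_commute)
    show "(if r = k then smult V (kp d b) (qd ((g, c + d + b + 2), (j, a))) - smult V (kp b d) (qd ((g, c), (j, a + b + d + 2))) else 0) \<in> TQ"
      by (intro if0 qd_mod_TQ mem) (simp_all add: kp_def power_add power_mult_distrib[symmetric] add.commute mult.assoc mult.left_commute)
  qed
  have q: "qd ((x, y), (z, w)) \<in> span (qd ` AP)" if "x \<in> {1..m}" "z \<in> {1..m}" for x y z w
    by (intro span_base imageI) (use that in auto)
  have if0: "(if P then x else 0) \<in> span (qd ` AP)" if "x \<in> span (qd ` AP)" for P x using that span_zero by simp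
  show "Lq b1 (qd b2) - Lq b2 (qd b1) \<in> span (qd ` AP)"
    unfolding eq by (intro span_add if0 span_diff span_scale q mem)
qed

lemma foldr_Lq_linear: "lin (foldr Lq l)"
proof (induction l)
  case Nil
  then show ?case using VV.linear_compose_add vector_space_axioms by (simp add: Vector_Spaces.linear_iff id_def)
next
  case (Cons b l)
  then show ?case using F.lin_comp[OF Lq_linear[of b] Cons] by (simp add: o_def)
qed

text \<open>What may be neglected when looking for a linear relation at weight h: derivatives of
  quadratics, heavier monomials, and Wick products of 2 to t factors. Admitting all weights above h
  replaces a projection to one weight.\<close>

definition Nset :: "nat \<Rightarrow> nat \<Rightarrow> 'v set" where
  "Nset h t = span ({T (qd b) | b. b \<in> AP} \<union> {mono \<nu> | \<nu>. set \<nu> \<subseteq> AP \<and> wts \<nu> > h}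
     \<union> {Wk l | l. set l \<subseteq> AP \<and> 2 \<le> length l \<and> length l \<le> t})"

lemma Nset_subspace: "subspace (Nset h t)"
  by (simp add: Nset_def)

lemma TQ_Nset: "TQ \<subseteq> Nset h t"
  unfolding TQ_def Nset_def by (rule span_mono) blast

lemma Nset_mono: "t \<le> t' \<Longrightarrow> Nset h t \<subseteq> Nset h t'"
  unfolding Nset_def by (rule span_mono) auto

lemma Wk_Nset: "set l \<subseteq> AP \<Longrightarrow> 2 \<le> length l \<Longrightarrow> length l \<le> t \<Longrightarrow> Wk l \<in> Nset h t"
  unfolding Nset_def by (rule span_base) blast

lemma Wk_heavy:
  assumes "set l \<subseteq> AP" "wts l > h"
  shows "Wk l \<in> Nset h t"
proof -
  have "low (length l) (wts l) \<subseteq> Nset h t"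
    unfolding low_def Nset_def by (rule span_mono) (use assms in auto)
  then have "Wk l - mono l \<in> Nset h t" using Wk_mono[OF assms(1)] by blast
  moreover have "mono l \<in> Nset h t" unfolding Nset_def by (rule span_base) (use assms in blast)
  ultimately have "(Wk l - mono l) + mono l \<in> Nset h t" by (rule subspace_add[OF Nset_subspace])
  then show ?thesis by simp
qed

text \<open>The commutator of two factors is again a combination of quadratics, so the difference
  has one factor fewer; if nothing else is present, it is a derivative.\<close>

lemma Wk_swap:
  assumes "set (l1 @ a # b # l2) \<subseteq> AP" "length (l1 @ a # b # l2) = Suc t"
  shows "Wk (l1 @ a # b # l2) - Wk (l1 @ b # a # l2) \<in> Nset h t"
proof -
  interpret L: Vector_Spaces.linear "smult V" "smult V" "foldr Lq l1" by (rule foldr_Lq_linear)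
  have ab: "a \<in> AP" "b \<in> AP" using assms by auto
  let ?y = "Lq a (qd b) - Lq b (qd a)"
  have eq: "Wk (l1 @ a # b # l2) - Wk (l1 @ b # a # l2) = foldr Lq l1 (nprod V ?y (- 1) (Wk l2))"
    using Lq_commutator[OF ab] by (simp add: Wk_append flip: L.diff)
  show ?thesis
  proof (cases "l1 = [] \<and> l2 = []")
    case True
    then show ?thesis unfolding eq using commutator_TQ(1)[OF ab] TQ_Nset by (auto simp: vac_creation)
  next
    case False
    then have "t \<ge> 2" using assms(2) by (cases l1; cases l2) auto
    have lin: "lin (\<lambda>y. foldr Lq l1 (nprod V y (- 1) (Wk l2)))"
      by (rule F.lin_comp[OF foldr_Lq_linear nprod_linear_left])
    show ?thesis unfolding eq
    proof (rule span_linear_image[OF commutator_TQ(2)[OF ab] lin Nset_subspace])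
      fix x assume "x \<in> qd ` AP"
      then obtain b' where b': "b' \<in> AP" "x = qd b'" by blast
      have "Wk (l1 @ b' # l2) \<in> Nset h t"
        by (rule Wk_Nset) (use b' assms \<open>t \<ge> 2\<close> in auto)
      then show "foldr Lq l1 (nprod V x (- 1) (Wk l2)) \<in> Nset h t"
        by (simp add: b' Wk_append Lq_def)
    qed
  qed
qed

lemma Wk_pm:
  assumes "set l \<subseteq> AP" "set l' \<subseteq> AP" "pm l = pm l'" "length l = Suc t"
  shows "Wk l - Wk l' \<in> Nset h t"
proof -
  let ?c = "map (\<lambda>b. cp (ups b))"
  have cp: "Wk (?c l) = Wk l" if "set l \<subseteq> AP" for l
    using that by (induction l) (auto simp: Lq_cp simp del: modes_iff)
  have "Wk (?c l) - Wk (?c l') \<in> Nset h t"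
  proof (rule permutation_mod[where D="mset (?c l)", OF Nset_subspace])
    fix l1 a b l2 assume D: "mset (l1 @ a # b # l2) = mset (?c l)"
    have "set (l1 @ a # b # l2) \<subseteq> AP"
      unfolding mset_eq_setD[OF D] by (rule cp_map_AP[OF assms(1)])
    moreover have "length (l1 @ a # b # l2) = Suc t"
      using mset_eq_length[OF D] assms(4) by simp
    ultimately show "Wk (l1 @ a # b # l2) - Wk (l1 @ b # a # l2) \<in> Nset h t"
      by (rule Wk_swap)
  qed (use map_cp_mset[OF assms(3)] in auto)
  then show ?thesis using cp[OF assms(1)] cp[OF assms(2)] by simp
qed

lemma Fn_mono_eq_0:
  assumes "set l \<subseteq> AP" "length l \<le> n" "set \<nu> \<subseteq> AP" "length \<nu> \<noteq> length l \<or> wts \<nu> \<noteq> wts l"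
  shows "Fn 0 l (mono \<nu>) = 0"
proof -
  obtain N where "Fn 0 l (mono \<nu>) = of_nat N" "N \<noteq> 0 \<longleftrightarrow> pm l = pm \<nu>"
    using F.Fn_OmL[of l 0 \<nu>] assms by (auto simp: mono_def)
  moreover have "pm l \<noteq> pm \<nu>" using assms(4) wts_pm[of l \<nu>] length_pm[of l \<nu>] by auto
  ultimately show ?thesis by simp
qed

lemma Fn_diff: "Fn i l (x - y) = Fn i l x - Fn i l y"
  using F.Fn_add[of i l "x - y" y] by simp

lemma Fn_subspace: "subspace {v. Fn 0 l v = 0}"
  by (auto simp: subspace_def F.Fn_add F.Fn_scale)

lemma Fn_low: "set l \<subseteq> AP \<Longrightarrow> length l \<le> n \<Longrightarrow> t \<le> length l \<Longrightarrow> v \<in> low t h \<Longrightarrow> Fn 0 l v = 0"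
proof -
  assume a: "set l \<subseteq> AP" "length l \<le> n" "t \<le> length l" "v \<in> low t h"
  have "low t h \<subseteq> {v. Fn 0 l v = 0}"
    unfolding low_def by (rule span_minimal[OF _ Fn_subspace]) (use a Fn_mono_eq_0[OF a(1,2)] in auto)
  with a(4) show ?thesis by blast
qed

lemma Fn_Wk_less:
  assumes "set l \<subseteq> AP" "length l \<le> n" "set \<nu> \<subseteq> AP" "length \<nu> < length l"
  shows "Fn 0 l (Wk \<nu>) = 0"
proof -
  have "Fn 0 l (Wk \<nu> - mono \<nu>) = 0"
    by (rule Fn_low[OF assms(1,2) _ Wk_mono[OF assms(3)]]) (use assms(4) in simp)
  moreover have "Fn 0 l (mono \<nu>) = 0"
    by (rule Fn_mono_eq_0[OF assms(1-3)]) (use assms(4) in simp)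
  ultimately show ?thesis by (simp add: Fn_diff)
qed

text \<open>A test with as many pairs as the word has factors sees only the leading term.\<close>

lemma Fn_Wk_eq:
  assumes "set l \<subseteq> AP" "length l \<le> n" "set \<nu> \<subseteq> AP" "length \<nu> = length l"
  shows "Fn 0 l (Wk \<nu>) = Fn 0 l (mono \<nu>)"
proof -
  have "Fn 0 l (Wk \<nu> - mono \<nu>) = 0"
    by (rule Fn_low[OF assms(1,2) _ Wk_mono[OF assms(3)]]) (use assms(4) in simp)
  then show ?thesis by (simp add: Fn_diff)
qed

lemma T_qd_mono: "b \<in> AP \<Longrightarrow> \<exists>b1\<in>AP. \<exists>b2\<in>AP. T (qd b) = mono [b1] + mono [b2]"
proof -
  assume b: "b \<in> AP"
  have "T (qd b) = mono [(up (fst b), snd b)] + mono [(fst b, up (snd b))]"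
    using T_qd[of "fst b" "snd b"] by (simp only: mono_single prod.collapse)
  moreover have "(up (fst b), snd b) \<in> AP" "(fst b, up (snd b)) \<in> AP"
    using b by (auto simp: up_def)
  ultimately show ?thesis by blast
qed

lemma Fn_T_qd: "set l \<subseteq> AP \<Longrightarrow> length l \<le> n \<Longrightarrow> length l \<noteq> 1 \<Longrightarrow> b \<in> AP \<Longrightarrow> Fn 0 l (T (qd b)) = 0"
  using T_qd_mono[of b] Fn_mono_eq_0[of l "[_]"] by (auto simp: F.Fn_add simp del: mono_simps)

lemma Fn_Nset:
  assumes "set l \<subseteq> AP" "length l \<le> n" "t < length l" "2 \<le> length l" "wts l \<le> h" "v \<in> Nset h t"
  shows "Fn 0 l v = 0"
proof -
  have "Nset h t \<subseteq> {v. Fn 0 l v = 0}"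
    unfolding Nset_def
    by (rule span_minimal[OF _ Fn_subspace])
      (use assms Fn_T_qd[OF assms(1,2)] Fn_mono_eq_0[OF assms(1,2)] Fn_Wk_less[OF assms(1,2)] in \<open>auto simp del: modes_iff\<close>)
  with assms(6) show ?thesis by blast
qed

text \<open>Since products of at most \<open>n\<close> of the \<open>\<Omega>\<close> satisfy no relation, a combination of Wick products
  whose symbol vanishes can be shortened.\<close>

lemma Nset_reduce:
  assumes "v \<in> Nset h t" "t \<le> n" "\<And>l. set l \<subseteq> AP \<Longrightarrow> 2 \<le> length l \<Longrightarrow> length l \<le> n \<Longrightarrow> Fn 0 l v = 0"
  shows "v \<in> Nset h 1"
  using assms
proof (induction t)
  case 0
  then show ?case using Nset_mono[of 0 1 h] by auto
next
  case (Suc t)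
  show ?case
  proof (cases "t = 0")
    case True
    then show ?thesis using Suc.prems by simp
  next
    case False
    define X where "X = {l. set l \<subseteq> AP \<and> length l = Suc t \<and> wts l \<le> h}"
    have "Nset h (Suc t) \<subseteq> span (Nset h t \<union> Wk ` X)"
      unfolding Nset_def[of h "Suc t"]
    proof (rule span_minimal)
      show "{T (qd b) | b. b \<in> AP} \<union> {mono \<nu> | \<nu>. set \<nu> \<subseteq> AP \<and> wts \<nu> > h}
     \<union> {Wk l | l. set l \<subseteq> AP \<and> 2 \<le> length l \<and> length l \<le> Suc t} \<subseteq> span (Nset h t \<union> Wk ` X)"
      proof (intro Un_least subsetI)
        fix x assume "x \<in> {T (qd b) | b. b \<in> AP}"
        then have "x \<in> Nset h t" unfolding Nset_def by (intro span_base) blast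
        then show "x \<in> span (Nset h t \<union> Wk ` X)" by (intro span_base) blast
      next
        fix x assume "x \<in> {mono \<nu> | \<nu>. set \<nu> \<subseteq> AP \<and> wts \<nu> > h}"
        then have "x \<in> Nset h t" unfolding Nset_def by (intro span_base) blast
        then show "x \<in> span (Nset h t \<union> Wk ` X)" by (intro span_base) blast
      next
        fix x assume "x \<in> {Wk l | l. set l \<subseteq> AP \<and> 2 \<le> length l \<and> length l \<le> Suc t}"
        then obtain l where l: "x = Wk l" "set l \<subseteq> AP" "2 \<le> length l" "length l \<le> Suc t" by blast
        have "x \<in> Nset h t \<union> Wk ` X"
        proof (cases "wts l > h")
          case True
          then show ?thesis using Wk_heavy l by blast
        next
          case False
          then show ?thesis using l Wk_Nset[OF l(2,3)] by (cases "length l \<le> t") (auto simp: X_def)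
        qed
        then show "x \<in> span (Nset h t \<union> Wk ` X)" by (rule span_base)
      qed
    qed simp
    then have "v \<in> span (Nset h t \<union> Wk ` X)" using Suc.prems(1) by (rule subsetD)
    then obtain y b where yb: "v = y + b" "y \<in> Nset h t" "b \<in> span (Wk ` X)"
      unfolding span_Un span_eq_iff[THEN iffD2, OF Nset_subspace] by blast
    obtain L u where L: "finite L" "L \<subseteq> X" "b = (\<Sum>l\<in>L. smult V (u l) (Wk l))"
      by (rule span_image_sum[OF yb(3)])
    define rep where "rep = (\<lambda>\<kappa>. SOME l. l \<in> L \<and> pm l = \<kappa>)"
    have rep: "rep (pm l) \<in> L \<and> pm (rep (pm l)) = pm l" if "l \<in> L" for l
      unfolding rep_def by (rule someI[of "\<lambda>l'. l' \<in> L \<and> pm l' = pm l" l]) (use that in simp)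
    have XD: "set l \<subseteq> AP" "length l = Suc t" "wts l \<le> h" if "l \<in> L" for l
      using that L(2) by (auto simp: X_def)
    \<comment> \<open>The test for l0 kills shorter words and all words of the same length with
      another \<open>pm\<close>, so it isolates the total coefficient of the class of l0.\<close>
    have coeff: "(\<Sum>l\<in>{l \<in> L. pm l = pm l0}. u l) = 0" if l0: "l0 \<in> L" for l0
    proof -
      have "0 = Fn 0 l0 v" using Suc.prems(2,3) XD[OF l0] False by simp
      also have "\<dots> = Fn 0 l0 b"
        using Fn_Nset[OF XD(1)[OF l0] _ _ _ XD(3)[OF l0] yb(2)] XD(2)[OF l0] Suc.prems(2) False by (simp add: yb(1) F.Fn_add)
      also have "\<dots> = (\<Sum>l\<in>L. u l * Fn 0 l0 (mono l))"
        unfolding L(3) F.Fn_sum F.Fn_scale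
        by (rule sum.cong) (use XD l0 Suc.prems(2) in \<open>auto simp: Fn_Wk_eq simp del: modes_iff\<close>)
      also have "\<dots> = (\<Sum>l\<in>L. if pm l = pm l0 then u l * Fn 0 l0 (mono l0) else 0)"
      proof (rule sum.cong[OF refl])
        fix l assume l: "l \<in> L"
        show "u l * Fn 0 l0 (mono l) = (if pm l = pm l0 then u l * Fn 0 l0 (mono l0) else 0)"
        proof (cases "pm l = pm l0")
          case True
          then show ?thesis using mono_pm[OF XD(1)[OF l] XD(1)[OF l0]] by simp
        next
          case False
          then show ?thesis
            using F.Fn_OmL[of l0 0 l] XD[OF l0] XD[OF l] Suc.prems(2) by (auto simp: mono_def simp del: modes_iff)
        qed
      qed
      also have "\<dots> = (\<Sum>l\<in>{l \<in> L. pm l = pm l0}. u l) * Fn 0 l0 (mono l0)"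
        unfolding sum_distrib_right using L(1) by (rule sum.inter_filter[symmetric])
      finally have "(\<Sum>l\<in>{l \<in> L. pm l = pm l0}. u l) * Fn 0 l0 (mono l0) = 0" by simp
      moreover have "Fn 0 l0 (mono l0) \<noteq> 0"
        using F.Fn_OmL[of l0 0 l0] XD[OF l0] Suc.prems(2) by (auto simp: mono_def simp del: modes_iff)
      ultimately show ?thesis by simp
    qed
    have "(\<Sum>l\<in>L. smult V (u l) (Wk (rep (pm l))))
       = (\<Sum>\<kappa>\<in>pm ` L. \<Sum>l\<in>{l \<in> L. pm l = \<kappa>}. smult V (u l) (Wk (rep (pm l))))"
      by (rule sum.image_gen[OF L(1)])
    also have "\<dots> = (\<Sum>\<kappa>\<in>pm ` L. smult V (\<Sum>l\<in>{l \<in> L. pm l = \<kappa>}. u l) (Wk (rep \<kappa>)))"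
      by (rule sum.cong) (auto simp: scale_sum_left)
    also have "\<dots> = 0"
    proof (rule sum.neutral, rule ballI)
      fix \<kappa> assume "\<kappa> \<in> pm ` L"
      then obtain l0 where "l0 \<in> L" "\<kappa> = pm l0" by blast
      then show "smult V (\<Sum>l\<in>{l \<in> L. pm l = \<kappa>}. u l) (Wk (rep \<kappa>)) = 0"
        by (simp only: coeff scale_zero_left)
    qed
    \<comment> \<open>Since the class sums vanish, a common representative can be subtracted within
      each class; such differences are shorter by \<open>Wk_pm\<close>.\<close>
    finally have "b = (\<Sum>l\<in>L. smult V (u l) (Wk l - Wk (rep (pm l))))"
      by (simp add: L(3) scale_right_diff_distrib sum_subtractf)
    also have "\<dots> \<in> Nset h t"
      by (intro subspace_sum subspace_scale Nset_subspace Wk_pm) (use rep XD in \<open>auto simp del: modes_iff\<close>)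
    finally have "v \<in> Nset h t" unfolding yb(1) by (intro subspace_add Nset_subspace yb(2))
    then show ?thesis using Suc by simp
  qed
qed

end

lemma sign_times_indicators: "(- 1) ^ a * of_nat ((if a = u \<and> P then 1 else 0) + (if a = v \<and> Q then 1 else 0))
   = (if a = u then if P then (- 1 :: complex) ^ u else 0 else 0) + (if a = v then if Q then (- 1) ^ v else 0 else 0)"
  by (auto simp: distrib_left)

lemma shifted_indicators_cancel: "(if Suc u + v = N \<and> P then (- 1) ^ Suc u else 0) + (if Suc u + v = N \<and> Q then (- 1) ^ v else 0)
  + ((if u + Suc v = N \<and> P then (- 1) ^ u else 0) + (if u + Suc v = N \<and> Q then (- 1) ^ Suc v else 0)) = (0 :: complex)"
  by simp

context symplectic_fermion_algebra
begin

text \<open>The alternating sum vanishes on \<open>T (qd b)\<close>, since \<open>T\<close> shifts the two indices of \<open>b\<close> in turn.\<close>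

definition phi :: "nat \<Rightarrow> nat \<Rightarrow> nat \<Rightarrow> 'v \<Rightarrow> complex" where
  "phi j k N v = (\<Sum>a\<le>N. (- 1) ^ a * Fn 0 [((j, a), (k, N - a))] v)"

lemma phi_add: "phi j k N (x + y) = phi j k N x + phi j k N y"
  and phi_scale: "phi j k N (smult V t x) = t * phi j k N x"
  by (simp_all add: phi_def F.Fn_add F.Fn_scale sum.distrib algebra_simps sum_distrib_left del: F.Fn.simps)

lemma phi_subspace: "subspace {v. phi j k N v = 0}"
  using phi_add[of j k N] phi_scale[of j k N] by (auto simp: subspace_def phi_def)

text \<open>Both orientations of the pair are counted. For equal colours the two terms cancel
  exactly when N is odd, as quadratics of odd total order are then derivatives.\<close>

lemma phi_qd:
  assumes n: "n \<ge> 1" and jk: "j \<in> {1..m}" "k \<in> {1..m}" and gr: "g \<in> {1..m}" "r \<in> {1..m}"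
  shows "phi j k N (qd ((g, u), (r, v))) =
    (if u + v = N \<and> g = j \<and> r = k then (- 1) ^ u else 0) + (if u + v = N \<and> r = j \<and> g = k then (- 1) ^ v else 0)"
proof -
  let ?b = "((g, u), (r, v))"
  have "phi j k N (qd ?b) = (\<Sum>a\<le>N. (- 1) ^ a * of_nat (F.hits ((j, a), (k, N - a)) ?b))"
    unfolding phi_def
  proof (rule sum.cong[OF refl])
    fix a
    have "Fn 0 [((j, a), (k, N - a))] (qd ?b) = of_nat (F.hits ((j, a), (k, N - a)) ?b)"
      unfolding qd_def by (rule F.Fn_single) (use assms in auto)
    then show "(- 1) ^ a * Fn 0 [((j, a), (k, N - a))] (qd ?b) = (- 1) ^ a * of_nat (F.hits ((j, a), (k, N - a)) ?b)"
      by (simp only:)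
  qed
  also have "\<dots> = (\<Sum>a\<le>N. (if a = u then if u + v = N \<and> g = j \<and> r = k then (- 1) ^ u else 0 else 0)
      + (if a = v then if u + v = N \<and> r = j \<and> g = k then (- 1) ^ v else 0 else 0))"
  proof (rule sum.cong[OF refl])
    fix a assume "a \<in> {..N}"
    then have eqs: "((j, a), (k, N - a)) = ?b \<longleftrightarrow> a = u \<and> u + v = N \<and> g = j \<and> r = k"
      "((j, a), (k, N - a)) = (snd ?b, fst ?b) \<longleftrightarrow> a = v \<and> u + v = N \<and> r = j \<and> g = k"
      by auto
    show "(- 1) ^ a * of_nat (F.hits ((j, a), (k, N - a)) ?b)
      = (if a = u then if u + v = N \<and> g = j \<and> r = k then (- 1 :: complex) ^ u else 0 else 0)
        + (if a = v then if u + v = N \<and> r = j \<and> g = k then (- 1) ^ v else 0 else 0)"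
      unfolding F.hits_def eqs by (rule sign_times_indicators)
  qed
  also have "\<dots> = (if u + v = N \<and> g = j \<and> r = k then (- 1) ^ u else 0) + (if u + v = N \<and> r = j \<and> g = k then (- 1) ^ v else 0)"
    unfolding sum.distrib sum.delta[OF finite_atMost] by auto
  finally show ?thesis .
qed

lemma phi_T_qd:
  assumes "n \<ge> 1" "j \<in> {1..m}" "k \<in> {1..m}" "b \<in> AP"
  shows "phi j k N (T (qd b)) = 0"
proof -
  obtain g u r v where b: "b = ((g, u), (r, v))" by (metis surj_pair)
  have gr: "g \<in> {1..m}" "r \<in> {1..m}" using assms(4) by (simp_all add: b)
  have "T (qd b) = qd ((g, Suc u), (r, v)) + qd ((g, u), (r, Suc v))"
    unfolding b T_qd up_def by simp
  then show ?thesis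
    by (simp only: phi_add phi_qd[OF assms(1-3) gr] shifted_indicators_cancel)
qed

lemma phi_mono_eq_0:
  assumes "n \<ge> 1" "j \<in> {1..m}" "k \<in> {1..m}" "set \<nu> \<subseteq> AP" "wts \<nu> \<noteq> N + 2"
  shows "phi j k N (mono \<nu>) = 0"
proof -
  have "Fn 0 [((j, a), (k, N - a))] (mono \<nu>) = 0" if "a \<le> N" for a
  proof (rule Fn_mono_eq_0[OF _ _ assms(4)])
    show "set [((j, a), (k, N - a))] \<subseteq> AP" using assms(2,3) by simp
    show "length [((j, a), (k, N - a))] \<le> n" using assms(1) by simp
    have "wts [((j, a), (k, N - a))] = N + 2" using that by (simp add: wt_def)
    then show "length \<nu> \<noteq> length [((j, a), (k, N - a))] \<or> wts \<nu> \<noteq> wts [((j, a), (k, N - a))]"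
      using assms(5) by (simp only:) simp
  qed
  then show ?thesis unfolding phi_def by (intro sum.neutral ballI) (simp only: atMost_iff mult_zero_right)
qed

lemma phi_Nset:
  assumes "n \<ge> 1" "j \<in> {1..m}" "k \<in> {1..m}" "v \<in> Nset (N + 2) 1"
  shows "phi j k N v = 0"
proof -
  have "Nset (N + 2) 1 \<subseteq> {v. phi j k N v = 0}"
    unfolding Nset_def
  proof (rule span_minimal[OF _ phi_subspace], intro Un_least subsetI CollectI)
    fix x assume "x \<in> {T (qd b) | b. b \<in> AP}"
    then show "phi j k N x = 0" using phi_T_qd[OF assms(1-3)] by blast
  next
    fix x assume "x \<in> {mono \<nu> | \<nu>. set \<nu> \<subseteq> AP \<and> wts \<nu> > N + 2}"
    then obtain \<nu> where "x = mono \<nu>" "set \<nu> \<subseteq> AP" "wts \<nu> > N + 2" by blast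
    then show "phi j k N x = 0" using phi_mono_eq_0[OF assms(1-3), of \<nu> N] by simp
  next
    fix x assume "x \<in> {Wk l | l. set l \<subseteq> AP \<and> 2 \<le> length l \<and> length l \<le> 1}"
    then show "phi j k N x = 0" by auto
  qed
  with assms(4) show ?thesis by blast
qed

text \<open>Every factor weighs at least 2, so more than n of them exceed the weight h.\<close>

lemma Nset_top:
  assumes "h < 2 * n + 2" "set l \<subseteq> AP" "2 \<le> length l"
  shows "Wk l \<in> Nset h n"
proof (cases "length l \<le> n")
  case True
  then show ?thesis using Wk_Nset assms by blast
next
  case False
  have "2 * length l \<le> wts l" by (induction l) (auto simp: wt_def)
  then show ?thesis using Wk_heavy[OF assms(2)] assms(1) False by simp
qed

section \<open>Words in the generators and irredundancy\<close>

lemma T_span_qd: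
  assumes "x \<in> span (qd ` AP)"
  shows "T x \<in> span (qd ` AP)" "T x \<in> TQ"
proof -
  have TQ: "subspace TQ" by (simp add: TQ_def)
  have TQ_base: "T (qd b) \<in> TQ" if "b \<in> AP" for b
    unfolding TQ_def by (rule span_base) (use that in blast)
  show "T x \<in> TQ"
    by (rule span_linear_image[OF assms T_linear TQ]) (use TQ_base in blast)
  show "T x \<in> span (qd ` AP)"
  proof (rule span_linear_image[OF assms T_linear subspace_span])
    fix y assume "y \<in> qd ` AP"
    then obtain b where b: "y = qd b" "b \<in> AP" by (rule imageE)
    have "T y = qd (up (fst b), snd b) + qd (fst b, up (snd b))"
      using T_qd[of "fst b" "snd b"] b by simp
    moreover have "(up (fst b), snd b) \<in> AP" "(fst b, up (snd b)) \<in> AP" using b by (auto simp: up_def)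
    ultimately show "T y \<in> span (qd ` AP)" by (simp only: span_add span_base imageI)
  qed
qed

lemma wick_list_span:
  assumes "fst ` set as \<subseteq> span (qd ` AP)"
  shows "wick_list V (map (\<lambda>(a, k). (T ^^ k) a) as) \<in> span {Wk l | l. set l \<subseteq> AP \<and> length l = length as}"
  using assms
proof (induction as)
  case Nil
  then show ?case by (intro span_base) (auto simp: wick_list_def)
next
  case (Cons ak as)
  obtain a k where ak: "ak = (a, k)" by (cases ak)
  have "(T ^^ k) a \<in> span (qd ` AP)"
  proof (induction k)
    case 0
    then show ?case using Cons.prems ak by simp
  next
    case (Suc k)
    then show ?case using T_span_qd(1) by simp
  qed
  let ?w = "wick_list V (map (\<lambda>(a, k). (T ^^ k) a) as)"
  let ?S = "span {Wk l | l. set l \<subseteq> AP \<and> length l = length (ak # as)}"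
  have "nprod V ((T ^^ k) a) (- 1) ?w \<in> ?S"
  proof (rule span_linear_image[OF \<open>(T ^^ k) a \<in> span (qd ` AP)\<close> nprod_linear_left subspace_span])
    fix x assume "x \<in> qd ` AP"
    then obtain b where b: "b \<in> AP" "x = qd b" by blast
    have w: "?w \<in> span {Wk l | l. set l \<subseteq> AP \<and> length l = length as}" using Cons by auto
    show "nprod V x (- 1) ?w \<in> ?S"
    proof (rule span_linear_image[OF w nprod_linear_right subspace_span])
      fix y assume "y \<in> {Wk l | l. set l \<subseteq> AP \<and> length l = length as}"
      then obtain l where l: "y = Wk l" "set l \<subseteq> AP" "length l = length as" by blast
      have "nprod V x (- 1) y = Wk (b # l)" by (simp add: l b Lq_def)
      then show "nprod V x (- 1) y \<in> ?S" using l b by (intro span_base) (auto intro!: exI[of _ "b # l"])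
    qed
  qed
  then show ?case by (simp add: ak wick_list_def wick_def)
qed

definition gens :: "'v set" where
  "gens = {omega V n e f j j 0 (2 * r) | j r. 1 \<le> j \<and> j \<le> m \<and> r \<le> n - 1} \<union>
     {omega V n e f j k 0 s | j k s. 1 \<le> j \<and> j < k \<and> k \<le> m \<and> s \<le> 2 * n - 1}"

lemma gensE:
  assumes "s \<in> gens" "n \<ge> 1"
  obtains j k N where "j \<in> {1..m}" "k \<in> {1..m}" "j \<le> k" "j = k \<longrightarrow> even N" "N < 2 * n"
    "s = omega V n e f j k 0 N" "s = smult V (1 / 2) (qd ((j, 0), (k, N)))"
proof -
  have "\<exists>j k N. j \<in> {1..m} \<and> k \<in> {1..m} \<and> j \<le> k \<and> (j = k \<longrightarrow> even N) \<and> N < 2 * n \<and> s = omega V n e f j k 0 N"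
    using assms(1) unfolding gens_def
  proof (elim UnE)
    assume "s \<in> {omega V n e f j j 0 (2 * r) | j r. 1 \<le> j \<and> j \<le> m \<and> r \<le> n - 1}"
    then obtain j r where "s = omega V n e f j j 0 (2 * r)" "1 \<le> j" "j \<le> m" "r \<le> n - 1" by blast
    then show ?thesis using assms(2) by (intro exI[of _ j] exI[of _ "2 * r"]) auto
  next
    assume "s \<in> {omega V n e f j k 0 s | j k s. 1 \<le> j \<and> j < k \<and> k \<le> m \<and> s \<le> 2 * n - 1}"
    then obtain j k N where "s = omega V n e f j k 0 N" "1 \<le> j" "j < k" "k \<le> m" "N \<le> 2 * n - 1" by blast
    then show ?thesis using assms(2) by (intro exI[of _ j] exI[of _ k] exI[of _ N]) auto
  qed
  then obtain j k N where *: "j \<in> {1..m}" "k \<in> {1..m}" "j \<le> k" "j = k \<longrightarrow> even N" "N < 2 * n"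
    "s = omega V n e f j k 0 N" by (elim exE conjE)
  show thesis by (rule that[OF *]) (simp only: *(6) omega_eq[OF *(1,2)])
qed

text \<open>Write a missing generator as a combination of the vacuum and the remaining generators
  plus an element of \<open>Nset\<close>. The tests of length at least 2 vanish on all terms but the
  last, so that one reduces to derivatives and heavier terms; then \<open>phi\<close> tells the
  missing generator from everything else.\<close>

lemma gens_not_spanned:
  assumes n: "n \<ge> 1" and S: "S \<subset> gens" and gen: "gens \<subseteq> strong_span S"
  shows False
proof -
  obtain s0 where s0: "s0 \<in> gens" "s0 \<notin> S" using S by blast
  obtain j k N where jk: "j \<in> {1..m}" "k \<in> {1..m}" "j \<le> k" "j = k \<longrightarrow> even N" "N < 2 * n"
    "s0 = omega V n e f j k 0 N" "s0 = smult V (1 / 2) (qd ((j, 0), (k, N)))"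
    by (rule gensE[OF s0(1) n])
  let ?h = "N + 2"
  have span_qd: "s \<in> span (qd ` AP)" if sg: "s \<in> gens" for s
  proof -
    obtain j k N where s: "j \<in> {1..m}" "k \<in> {1..m}" "s = smult V (1 / 2) (qd ((j, 0), (k, N)))"
      by (rule gensE[OF sg n], rule that)
    show ?thesis unfolding s(3) by (intro span_scale span_base imageI) (use s in auto)
  qed
  \<comment> \<open>The words with at most one factor and no derivative; all other words fall into
    \<open>Nset\<close>.\<close>
  let ?A = "span (insert (vac V) S)"
  have "strong_span S \<subseteq> span (?A \<union> Nset ?h n)"
    unfolding strong_span_def
  proof (rule span_minimal, rule subsetI)
    fix x assume "x \<in> {wick_list V (map (\<lambda>(a, k). (T ^^ k) a) as) | as :: ('v \<times> nat) list. fst ` set as \<subseteq> S}"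
    then obtain as where as: "x = wick_list V (map (\<lambda>(a, k). (T ^^ k) a) as)" "fst ` set as \<subseteq> S" by blast
    have "x \<in> ?A \<union> Nset ?h n"
    proof (cases "length as \<ge> 2")
      case True
      have "fst ` set as \<subseteq> span (qd ` AP)" using as(2) S span_qd by blast
      then have "x \<in> span {Wk l | l. set l \<subseteq> AP \<and> length l = length as}" unfolding as(1) by (rule wick_list_span)
      moreover have "span {Wk l | l. set l \<subseteq> AP \<and> length l = length as} \<subseteq> Nset ?h n"
        by (rule span_minimal[OF _ Nset_subspace]) (use Nset_top[of ?h] jk(5) True in auto)
      ultimately show ?thesis by blast
    next
      case False
      show ?thesis
      proof (cases as)
        case Nil
        then show ?thesis by (simp add: as(1) wick_list_def span_base)
      next
        case (Cons ak as')
        obtain a i where a: "as = [(a, i)]" using Cons False by (cases ak; cases as') auto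
        then have x: "x = (T ^^ i) a" "a \<in> S" using as by (auto simp: wick_list_def wick_def vac_creation)
        show ?thesis
        proof (cases i)
          case 0
          then show ?thesis using x by (simp add: span_base)
        next
          case (Suc i')
          have "(T ^^ l) a \<in> span (qd ` AP)" for l
            by (induction l) (use x(2) S span_qd T_span_qd(1) in auto)
          then have "x \<in> TQ" unfolding x(1) Suc using T_span_qd(2) by simp
          then show ?thesis using TQ_Nset by blast
        qed
      qed
    qed
    then show "x \<in> span (?A \<union> Nset ?h n)" by (rule span_base)
  qed simp
  then have "s0 \<in> span (?A \<union> Nset ?h n)" using gen s0(1) by blast
  then obtain x y where xy: "s0 = x + y" "x \<in> ?A" "y \<in> Nset ?h n"
    unfolding span_Un span_eq_iff[THEN iffD2, OF Nset_subspace] span_span by blast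
  have qd_mono: "qd b = mono [b]" for b by (rule mono_single[symmetric])
  have Fn_gens: "Fn 0 l s = 0" if l: "set l \<subseteq> AP" "2 \<le> length l" "length l \<le> n" and s: "s \<in> gens" for l s
  proof -
    obtain j k N where s': "j \<in> {1..m}" "k \<in> {1..m}" "s = smult V (1 / 2) (qd ((j, 0), (k, N)))"
      by (rule gensE[OF s n], rule that)
    have "Fn 0 l (mono [((j, 0), (k, N))]) = 0"
      by (rule Fn_mono_eq_0[OF l(1,3)]) (use s' l in auto)
    then show ?thesis by (simp only: s'(3) F.Fn_scale qd_mono mult_zero_right)
  qed
  have "y \<in> Nset ?h 1"
  proof (rule Nset_reduce[OF xy(3) order_refl])
    fix l assume l: "set l \<subseteq> AP" "2 \<le> length l" "length l \<le> n"
    have "Fn 0 l (mono []) = 0" by (rule Fn_mono_eq_0[OF l(1,3)]) (use l in auto)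
    then have "?A \<subseteq> {v. Fn 0 l v = 0}"
      by (intro span_minimal Fn_subspace) (use Fn_gens[OF l] S in auto)
    then have "Fn 0 l x = 0" using xy(2) by blast
    moreover have "Fn 0 l s0 = 0" by (rule Fn_gens[OF l s0(1)])
    ultimately show "Fn 0 l y = 0" by (simp add: xy(1) F.Fn_add)
  qed
  then have y0: "phi j k N y = 0" by (rule phi_Nset[OF n jk(1,2)])
  have "phi j k N s = 0" if "s \<in> S" for s
  proof -
    have "s \<in> gens" "s \<noteq> s0" using that S s0 by auto
    obtain j' k' N' where s: "j' \<in> {1..m}" "k' \<in> {1..m}" "j' \<le> k'"
      "s = omega V n e f j' k' 0 N'" "s = smult V (1 / 2) (qd ((j', 0), (k', N')))"
      by (rule gensE[OF \<open>s \<in> gens\<close> n], rule that)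
    have "(j', k', N') \<noteq> (j, k, N)" using \<open>s \<noteq> s0\<close> s(4) jk(6) by auto
    then show ?thesis using s(1,2,3) jk(1,2,3)
      unfolding s(5) phi_scale phi_qd[OF n jk(1,2) s(1,2)] by auto
  qed
  moreover have "phi j k N (vac V) = 0"
    using phi_mono_eq_0[OF n jk(1,2), of "[]" N] by simp
  ultimately have "?A \<subseteq> {v. phi j k N v = 0}"
    by (intro span_minimal phi_subspace) auto
  then have "phi j k N s0 = 0" using xy y0 by (auto simp: phi_add)
  moreover have "phi j k N s0 \<noteq> 0"
  proof -
    \<comment> \<open>The value is 1/2 for different colours and 1 for equal ones, where N is
      even.\<close>
    have "phi j k N s0 = 1 / 2 * (1 + (if j = k then (- 1) ^ N else 0))"
      unfolding jk(7) phi_scale phi_qd[OF n jk(1,2) jk(1,2)] by simp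
    also have "\<dots> \<noteq> 0" using jk(4) by (cases "j = k") simp_all
    finally show ?thesis .
  qed
  ultimately show False by simp
qed

end

context sp_action
begin

lemma gens_invariant: "n \<ge> 1 \<Longrightarrow> gens \<subseteq> Sp_invariants n \<rho>"
proof
  fix s assume s: "s \<in> gens" and n: "n \<ge> 1"
  obtain j k N where s: "j \<in> {1..m}" "k \<in> {1..m}" "s = smult V (1 / 2) (qd ((j, 0), (k, N)))"
    by (rule gensE[OF s n], rule that)
  have "qd ((j, 0), (k, N)) \<in> Sp_invariants n \<rho>"
    using OmL_invariant[of "[((j, 0), (k, N))]"] s by (simp add: qd_def)
  then show "s \<in> Sp_invariants n \<rho>"
    unfolding s(3) by (rule subspace_scale[OF subspace_invariants])
qed

lemma strong_span_gens:
  assumes n: "n \<ge> 1"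
  shows "Sp_invariants n \<rho> = strong_span gens"
proof
  have wick: "wick_list V (map (\<lambda>(a, k). (T ^^ k) a) as) \<in> Sp_invariants n \<rho>" if "fst ` set as \<subseteq> gens" for as
    using that
  proof (induction as)
    case Nil
    then show ?case by (simp add: wick_list_def Sp_invariants_def rho_vac)
  next
    case (Cons ak as)
    obtain a k where ak: "ak = (a, k)" by (cases ak)
    have "a \<in> Sp_invariants n \<rho>" using Cons.prems gens_invariant[OF n] ak by auto
    then show ?case
      using Cons by (auto simp: ak wick_list_def wick_def Sp_invariants_def rho_nprod rho_T)
  qed
  show "strong_span gens \<subseteq> Sp_invariants n \<rho>"
    unfolding strong_span_def by (rule span_minimal[OF _ subspace_invariants]) (use wick in blast)
  have W: "subspace (strong_span gens)" by (simp add: strong_span_def)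
  have gen: "Lq ((j, 0), (k, s)) w \<in> strong_span gens"
    if "omega V n e f j k 0 s \<in> gens" "j \<in> {1..m}" "k \<in> {1..m}" "w \<in> strong_span gens" for j k s w
  proof -
    have "nprod V (smult V (1 / 2) (qd ((j, 0), (k, s)))) (- 1) w \<in> strong_span gens"
      using strong_span_wick[OF that(1,4), of 0] omega_eq[OF that(2,3), of 0 s] by simp
    then have "smult V (1 / 2) (Lq ((j, 0), (k, s)) w) \<in> strong_span gens"
      by (simp add: nprod_scale_left Lq_def)
    then show ?thesis using subspace_scale_iff[OF W] by simp
  qed
  interpret strong_closure V m n e f "strong_span gens"
  proof (unfold_locales)
    show "subspace (strong_span gens)" by (rule W)
    show "vac V \<in> strong_span gens" by (rule strong_span_vac)
    show "T w \<in> strong_span gens" if "w \<in> strong_span gens" for w using that by (rule strong_span_T)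
    show "Lq ((j, 0), (j, s)) w \<in> strong_span gens"
      if "j \<in> {1..m}" "even s" "s < 2 * n" "w \<in> strong_span gens" for j s w
    proof (rule gen[OF _ that(1,1,4)])
      have "s = 2 * (s div 2)" using that(2) by simp
      then show "omega V n e f j j 0 s \<in> gens"
        unfolding gens_def using that by (intro UnI1 CollectI exI[of _ j] exI[of _ "s div 2"]) auto
    qed
    show "Lq ((j, 0), (k, s)) w \<in> strong_span gens"
      if "j \<in> {1..m}" "k \<in> {1..m}" "j < k" "s < 2 * n" "w \<in> strong_span gens" for j k s w
    proof (rule gen[OF _ that(1,2,5)])
      show "omega V n e f j k 0 s \<in> gens"
        unfolding gens_def using that by (intro UnI2 CollectI exI[of _ j] exI[of _ k] exI[of _ s]) auto
    qed
  qed
  show "Sp_invariants n \<rho> \<subseteq> strong_span gens"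
    unfolding invariants_eq_span
    by (rule span_minimal[OF _ W]) (use mono_in_W in \<open>auto simp: mono_def simp del: modes_iff\<close>)
qed

theorem minimal_generation: "n \<ge> 1 \<Longrightarrow> minimal_strong_generating_set V gens (Sp_invariants n \<rho>)"
proof -
  assume n: "n \<ge> 1"
  have sg: "strongly_generates V S (Sp_invariants n \<rho>) \<longleftrightarrow> S \<subseteq> Sp_invariants n \<rho> \<and> Sp_invariants n \<rho> = strong_span S" for S
    by (simp only: strongly_generates_def strong_span_def)
  show ?thesis unfolding minimal_strong_generating_set_def sg
  proof (intro conjI allI impI notI)
    show "gens \<subseteq> Sp_invariants n \<rho>" by (rule gens_invariant[OF n])
    show "Sp_invariants n \<rho> = strong_span gens" by (rule strong_span_gens[OF n])
    fix S assume S: "S \<subset> gens" "S \<subseteq> Sp_invariants n \<rho> \<and> Sp_invariants n \<rho> = strong_span S"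
    then have "gens \<subseteq> strong_span S" using gens_invariant[OF n] by simp
    then show False by (rule gens_not_spanned[OF n S(1)])
  qed
qed

end

theorem theorem3p13:
  fixes V :: "('v::ab_group_add, 'z) vertex_data_scheme"
    and m n :: nat
    and e f :: "nat \<Rightarrow> nat \<Rightarrow> 'v"
    and \<rho> :: "complex mat \<Rightarrow> 'v \<Rightarrow> 'v"
  assumes "m \<ge> 1" and "n \<ge> 1"
    and "symplectic_fermion_algebra V m n e f"
    and "Sp_acts V m n e f \<rho>"
  shows "minimal_strong_generating_set V
           ({omega V n e f j j 0 (2 * r) | j r. 1 \<le> j \<and> j \<le> m \<and> r \<le> n - 1} \<union>
            {omega V n e f j k 0 s | j k s. 1 \<le> j \<and> j < k \<and> k \<le> m \<and> s \<le> 2 * n - 1})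
           (Sp_invariants n \<rho>)"
proof -
  interpret sp_action V m n e f \<rho>
    using assms by (intro sp_action.intro sp_action_axioms.intro)
  show ?thesis using minimal_generation[OF assms(2)] unfolding gens_def .
qed

end
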